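(* Let $n\le k\le 2n-1$. Then for the contact manifold $(S^{2n-1}\setminus\Pi_k,\xi_{\rm st})$ the cone $\mathfrak g^+$ is non-orderable up to conjugation.
   Context: Sphere: $\mathbb R^{2n}$ has coordinates ordered as $(x_1,\dots,x_n,y_1,\dots,y_n)$; $\alpha_{\rm st}$ is the restriction of $\frac12\sum_{j=1}^n(x_jdy_j-y_jdx_j)$ to the unit sphere $S^{2n-1}$ and $\xi_{\rm st}=\ker\alpha_{\rm st}$. $\Pi_k\subset\mathbb R^{2n}$ is the $k$-dimensional coordinate subspace spanned by the last $k$ basis vectors. General notions, for a noncompact contact manifold $(U,\xi)$ with fixed contact form $\alpha$ (here $\alpha=\alpha_{\rm st}|_U$, $U=S^{2n-1}\setminus\Pi_k$): $G=\mathrm{Diff}_c(U,\xi)$ is the identity component of the group of compactly supported contactomorphisms. Its Lie algebra $\mathfrak g$ of compactly supported contact vector fields is identified with $C_c^\infty(U)$ by $Y\mapsto\alpha(Y)$. The adjoint action is $\mathrm{Ad}_\psi K=(c_\psi K)\circ\psi^{-1}$, where $\psi^*\alpha=c_\psi\alpha$, $c_\psi>0$. $H\le K$ means $H(x)\le K(x)$ for all $x$. $\mathfrak g^{\ge0}$ is the cone of nonnegative functions in $\mathfrak g$. $\mathcal E(U,\xi)$ is the set of contact embeddings $\sigma:U\to U$ that are contactly isotopic to the identity (through contact embeddings $U\to U$) and such that $\sigma(U)$ has compact closure in $U$; $(U,\xi)$ is convex at infinity if $\mathcal E(U,\xi)\neq\emptyset$ (this holds for $S^{2n-1}\setminus\Pi_k$).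 Then $\mathfrak g^+:=\{H\in\mathfrak g^{\ge0}: H|_{\sigma(U)}>0\text{ for some }\sigma\in\mathcal E(U,\xi)\}$. $\mathfrak g^+$ is called non-orderable up to conjugation if for all $K_1,K_2\in\mathfrak g^+$ there exists $h\in G$ with $\mathrm{Ad}_hK_1\le K_2$ (equivalently, if there exist $H\in\mathfrak g^+$, $g\in G$ and $0<s<1$ with $\mathrm{Ad}_gH\le sH$). *)

theory Defs
  imports "HOL-Analysis.Analysis"
begin

section \<open>Smooth maps between subsets of Euclidean spaces\<close>

text \<open>Meaningful for open \<open>W\<close>; in finite dimension this is the usual class \<open>C\<^sup>k\<close>, since the
  partial derivatives are required to be again of class \<open>C\<^sup>k\<^sup>-\<^sup>1\<close>.\<close>

primrec Ck_on :: "nat \<Rightarrow> 'a::euclidean_space set \<Rightarrow> ('a \<Rightarrow> 'b::euclidean_space) \<Rightarrow> bool" where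
  "Ck_on 0 W f \<longleftrightarrow> continuous_on W f"
| "Ck_on (Suc k) W f \<longleftrightarrow>
     (\<forall>x\<in>W. f differentiable (at x)) \<and> (\<forall>v. Ck_on k W (\<lambda>x. frechet_derivative f (at x) v))"

text \<open>A map on an arbitrary subset of a Euclidean space is smooth if locally it is the restriction
  of a smooth map on an open subset of that space. For submanifolds this is the intrinsic notion;
  it also covers \<open>[0,1] \<times> U\<close>, the domain of an isotopy.\<close>

definition smooth_map_on :: "'a::euclidean_space set \<Rightarrow> ('a \<Rightarrow> 'b::euclidean_space) \<Rightarrow> bool" where
  "smooth_map_on X f \<longleftrightarrow>
     (\<forall>x\<in>X. \<exists>W F. open W \<and> x \<in> W \<and> (\<forall>k. Ck_on k W F) \<and> (\<forall>z\<in>W \<inter> X. F z = f z))"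

text \<open>A diffeomorphism onto its image.\<close>

definition smooth_embedding :: "'a::euclidean_space set \<Rightarrow> ('a \<Rightarrow> 'b::euclidean_space) \<Rightarrow> bool" where
  "smooth_embedding X f \<longleftrightarrow>
     inj_on f X \<and> smooth_map_on X f \<and> smooth_map_on (f ` X) (inv_into X f)"


section \<open>The standard contact structure on the sphere\<close>

text \<open>\<open>\<real>\<^sup>2\<^sup>n\<close> is \<open>(real^'n) \<times> (real^'n)\<close> with points \<open>(x, y)\<close>; the linear order on \<open>'n\<close> fixes the
  ordering \<open>(x\<^sub>1,\<dots>,x\<^sub>n,y\<^sub>1,\<dots>,y\<^sub>n)\<close> of the coordinates. The sphere is \<open>sphere 0 1\<close>.\<close>

definition alpha_st :: "(real^'n) \<times> (real^'n) \<Rightarrow> (real^'n) \<times> (real^'n) \<Rightarrow> real" where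
  "alpha_st p v = (1/2) * (\<Sum>j\<in>UNIV. fst p $ j * snd v $ j - snd p $ j * fst v $ j)"

definition tangent_sphere :: "(real^'n) \<times> (real^'n) \<Rightarrow> ((real^'n) \<times> (real^'n)) set" where
  "tangent_sphere p = {v. p \<bullet> v = 0}"

definition xi_st :: "(real^'n) \<times> (real^'n) \<Rightarrow> ((real^'n) \<times> (real^'n)) set" where
  "xi_st p = {v \<in> tangent_sphere p. alpha_st p v = 0}"

text \<open>The differential at \<open>p\<close> of a map defined on a relatively open subset \<open>U\<close> of the unit sphere:
  the derivative of its extension to the open cone over \<open>U\<close> that is constant on rays
  (\<open>sgn z = z / norm z\<close>). It is only applied to vectors tangent to the sphere, where it
  agrees with the derivative of any other extension.\<close>

definition sphere_differential ::
  "((real^'n) \<times> (real^'n) \<Rightarrow> 'b::real_normed_vector) \<Rightarrow> (real^'n) \<times> (real^'n) \<Rightarrow>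
   (real^'n) \<times> (real^'n) \<Rightarrow> 'b" where
  "sphere_differential f p v = frechet_derivative (\<lambda>z. f (sgn z)) (at p) v"

text \<open>The 1-based position of an index in the order of \<open>'n\<close>: \<open>x\<^sub>i\<close> is the coordinate number
  \<open>coord_pos i\<close> and \<open>y\<^sub>i\<close> the coordinate number \<open>n + coord_pos i\<close>.\<close>

definition coord_pos :: "'n::{finite,linorder} \<Rightarrow> nat" where
  "coord_pos i = card {j. j \<le> i}"

definition Pi_last :: "nat \<Rightarrow> ((real^'n::{finite,linorder}) \<times> (real^'n::{finite,linorder})) set" where
  "Pi_last k = span
     ({(axis i 1, 0) |i. coord_pos i > 2 * CARD('n) - k} \<union>
      {(0, axis i 1) |i. CARD('n) + coord_pos i > 2 * CARD('n) - k})"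


section \<open>Contact embeddings and contactomorphisms of an open subset of the sphere\<close>

text \<open>In the following, \<open>U\<close> is a relatively open subset of the unit sphere with contact form
  \<open>alpha_st\<close>. Maps and functions on \<open>U\<close> are total functions whose values outside \<open>U\<close> are
  irrelevant.\<close>

definition contact_embedding ::
  "((real^'n) \<times> (real^'n)) set \<Rightarrow> ((real^'n) \<times> (real^'n) \<Rightarrow> (real^'n) \<times> (real^'n)) \<Rightarrow> bool" where
  "contact_embedding U f \<longleftrightarrow>
     f ` U \<subseteq> U \<and> smooth_embedding U f \<and>
     (\<forall>p\<in>U. sphere_differential f p ` xi_st p = xi_st (f p))"

definition contactomorphism ::
  "((real^'n) \<times> (real^'n)) set \<Rightarrow> ((real^'n) \<times> (real^'n) \<Rightarrow> (real^'n) \<times> (real^'n)) \<Rightarrow> bool" where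
  "contactomorphism U f \<longleftrightarrow> contact_embedding U f \<and> f ` U = U"

text \<open>The identity component of the group of compactly supported contactomorphisms: those that
  are smoothly isotopic to the identity through contactomorphisms with support in a common
  compact set.\<close>

definition Diff_c ::
  "((real^'n) \<times> (real^'n)) set \<Rightarrow> ((real^'n) \<times> (real^'n) \<Rightarrow> (real^'n) \<times> (real^'n)) set" where
  "Diff_c U = {g. \<exists>F :: real \<times> ((real^'n) \<times> (real^'n)) \<Rightarrow> (real^'n) \<times> (real^'n).
     smooth_map_on ({0..1} \<times> U) F \<and>
     (\<forall>t\<in>{0..1}. contactomorphism U (\<lambda>p. F (t, p))) \<and>
     (\<exists>C. compact C \<and> C \<subseteq> U \<and> (\<forall>t\<in>{0..1}. \<forall>p\<in>U - C. F (t, p) = p)) \<and>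
     (\<forall>p\<in>U. F (0, p) = p) \<and> (\<forall>p\<in>U. F (1, p) = g p)}"

text \<open>The set \<open>\<E>(U, \<xi>)\<close>; \<open>U \<inter> closure (\<sigma> ` U)\<close> is the closure of the image relative to \<open>U\<close>.\<close>

definition compressing_embeddings ::
  "((real^'n) \<times> (real^'n)) set \<Rightarrow> ((real^'n) \<times> (real^'n) \<Rightarrow> (real^'n) \<times> (real^'n)) set" where
  "compressing_embeddings U = {\<sigma>. contact_embedding U \<sigma> \<and>
     (\<exists>F :: real \<times> ((real^'n) \<times> (real^'n)) \<Rightarrow> (real^'n) \<times> (real^'n).
       smooth_map_on ({0..1} \<times> U) F \<and>
       (\<forall>t\<in>{0..1}. contact_embedding U (\<lambda>p. F (t, p))) \<and>
       (\<forall>p\<in>U. F (0, p) = p) \<and> (\<forall>p\<in>U. F (1, p) = \<sigma> p)) \<and>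
     compact (U \<inter> closure (\<sigma> ` U))}"


section \<open>Contact Hamiltonians, the adjoint action and the cone\<close>

text \<open>The Lie algebra, with a contact vector field \<open>Y\<close> represented by the function \<open>\<alpha>(Y)\<close>:
  compactly supported smooth functions on \<open>U\<close>.\<close>

definition lie_g :: "((real^'n) \<times> (real^'n)) set \<Rightarrow> ((real^'n) \<times> (real^'n) \<Rightarrow> real) set" where
  "lie_g U = {H. smooth_map_on U H \<and> (\<exists>C. compact C \<and> C \<subseteq> U \<and> (\<forall>p\<in>U - C. H p = 0))}"

definition g_nonneg :: "((real^'n) \<times> (real^'n)) set \<Rightarrow> ((real^'n) \<times> (real^'n) \<Rightarrow> real) set" where
  "g_nonneg U = {H \<in> lie_g U. \<forall>p\<in>U. 0 \<le> H p}"

definition g_plus :: "((real^'n) \<times> (real^'n)) set \<Rightarrow> ((real^'n) \<times> (real^'n) \<Rightarrow> real) set" where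
  "g_plus U = {H \<in> g_nonneg U. \<exists>\<sigma>\<in>compressing_embeddings U. \<forall>p\<in>\<sigma> ` U. 0 < H p}"

text \<open>The factor \<open>c\<close> in \<open>\<psi>\<^sup>*\<alpha> = c \<alpha>\<close>; it is unique because \<open>\<alpha>\<close> has no zeros on the sphere.\<close>

definition conformal_factor ::
  "((real^'n) \<times> (real^'n) \<Rightarrow> (real^'n) \<times> (real^'n)) \<Rightarrow> (real^'n) \<times> (real^'n) \<Rightarrow> real" where
  "conformal_factor \<psi> p =
     (THE c. \<forall>v\<in>tangent_sphere p. alpha_st (\<psi> p) (sphere_differential \<psi> p v) = c * alpha_st p v)"

definition Ad ::
  "((real^'n) \<times> (real^'n)) set \<Rightarrow> ((real^'n) \<times> (real^'n) \<Rightarrow> (real^'n) \<times> (real^'n)) \<Rightarrow>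
   ((real^'n) \<times> (real^'n) \<Rightarrow> real) \<Rightarrow> (real^'n) \<times> (real^'n) \<Rightarrow> real" where
  "Ad U \<psi> K = (\<lambda>p. conformal_factor \<psi> p * K p) \<circ> inv_into U \<psi>"

definition non_orderable_up_to_conjugation :: "((real^'n) \<times> (real^'n)) set \<Rightarrow> bool" where
  "non_orderable_up_to_conjugation U \<longleftrightarrow>
     (\<forall>K\<^sub>1\<in>g_plus U. \<forall>K\<^sub>2\<in>g_plus U. \<exists>h\<in>Diff_c U. \<forall>p\<in>U. Ad U h K\<^sub>1 p \<le> K\<^sub>2 p)"

end

theory Submission
  imports Defs
begin

text \<open>Let \<open>V\<close> be the complement of \<open>\<Pi>\<^sub>k\<close>, an open cone over \<open>U\<close>. Since \<open>\<Pi>\<^sub>k\<close> contains all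
  \<open>y\<close>-directions, \<open>V\<close> is given by the non-vanishing of the coordinates \<open>x\<^sub>i\<close> with
  \<open>i \<le> m = 2n - k\<close>. The linear symplectic maps \<open>A\<^sub>s\<close> that multiply these \<open>x\<^sub>i\<close> by \<open>e\<^sup>s\<close> and the
  corresponding \<open>y\<^sub>i\<close> by \<open>e\<^sup>-\<^sup>s\<close> induce contactomorphisms of \<open>U\<close> whose conformal factor
  \<open>1 / |A\<^sub>s p|\<^sup>2\<close> tends to \<open>0\<close> uniformly on compact sets, and which keep the compact sets
  \<open>{|(x\<^sub>1,\<dots>,x\<^sub>m)| \<ge> \<delta>}\<close> invariant. If \<open>K\<^sub>2 > 0\<close> on \<open>\<sigma>(U)\<close>, then \<open>\<sigma> \<circ> A\<^sub>s\<close> maps the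
  support of \<open>K\<^sub>1\<close> into a fixed compact subset of \<open>\<sigma>(U)\<close>, so any \<open>h\<close> in \<open>Diff_c U\<close> that agrees with
  \<open>\<sigma> \<circ> A\<^sub>s\<close> near the support of \<open>K\<^sub>1\<close> satisfies \<open>Ad\<^sub>h K\<^sub>1 \<le> K\<^sub>2\<close> for large \<open>s\<close>.

  Such an \<open>h\<close> exists by contact isotopy extension. Instead of integrating a cut-off contact vector
  field, lift the isotopy to homogeneous symplectic maps of \<open>V\<close>. Two lifts at nearby times differ by
  a map close to the identity, which is the Cayley transform of a generating function that is
  homogeneous of degree 2 and can be cut off; connectedness of the time interval does the rest.\<close>

section \<open>Calculus of smooth maps\<close>

text \<open>The composite of \<open>\<sigma>\<close> with a squeezing map is usually neither onto
  nor compactly supported, so it cannot itself serve as \<open>h\<close>. Only its restriction to a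
  compact set matters, and extending that restriction is the main work. On the cone a contact map
  becomes a homogeneous map preserving the one-form \<open>alpha_st\<close>, its conformal factor is
  read off from the norm of the lift, and homogeneity turns every uniform estimate near the identity
  into one on the compact unit sphere. The generating function is taken in the midpoint variable (z
  + Z)/2, because this choice is linear, compatible with scaling, and symmetric: reversing time
  exchanges z and Z, so a map and its inverse are produced together. The invariance of the compact
  sets has a simple source: no coordinate grows faster than the chosen x-coordinates, so their share
  of the norm never drops. The contraction of the partner coordinates y that preservation of
  \<open>alpha_st\<close> enforces is harmless, since V puts no condition on y.\<close>

definition smooth_on :: "'a::euclidean_space set \<Rightarrow> ('a \<Rightarrow> 'b::euclidean_space) \<Rightarrow> bool" where
  "smooth_on W f \<longleftrightarrow> (\<forall>k. Ck_on k W f)"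

section \<open>Closure properties of C^k and smooth functions on open sets\<close>

lemma Ck_on_subset: "Ck_on k W f \<Longrightarrow> W' \<subseteq> W \<Longrightarrow> Ck_on k W' f"
proof (induction k arbitrary: f)
  case 0 then show ?case using continuous_on_subset by auto
qed auto

lemma Ck_on_cong:
  "open W \<Longrightarrow> Ck_on k W f \<Longrightarrow> (\<And>x. x \<in> W \<Longrightarrow> f x = g x) \<Longrightarrow> Ck_on k W g"
proof (induction k arbitrary: f g)
  case 0
  have "continuous_on W f = continuous_on W g" by (rule continuous_on_cong[OF refl 0(3)])
  with 0(2) show ?case by simp
next
  case (Suc k)
  have *: "(g has_derivative frechet_derivative f (at x)) (at x)" if "x \<in> W" for x
  proof (rule has_derivative_transform_within_open[OF _ Suc.prems(1) that])
    show "(f has_derivative frechet_derivative f (at x)) (at x)"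
      using Suc.prems(2) that by (simp add: frechet_derivative_works)
  qed (use Suc.prems(3) in auto)
  have eq: "frechet_derivative f (at x) = frechet_derivative g (at x)" if "x \<in> W" for x
    by (rule frechet_derivative_at[OF *[OF that]])
  have "Ck_on k W (\<lambda>x. frechet_derivative g (at x) v)" for v
  proof (rule Suc.IH[OF Suc.prems(1)])
    show "Ck_on k W (\<lambda>x. frechet_derivative f (at x) v)"
      using Suc.prems(2) by simp
  qed (simp add: eq)
  moreover have "g differentiable at x" if "x \<in> W" for x
    using *[OF that] by (rule differentiableI)
  ultimately show ?case by simp
qed

lemma Ck_on_SucI:
  assumes "open W" "\<And>x. x \<in> W \<Longrightarrow> (f has_derivative f' x) (at x)" "\<And>v. Ck_on k W (\<lambda>x. f' x v)"
  shows "Ck_on (Suc k) W f"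
proof -
  have "frechet_derivative f (at x) = f' x" if "x \<in> W" for x
    using frechet_derivative_at[OF assms(2)[OF that]] by simp
  then have "Ck_on k W (\<lambda>x. frechet_derivative f (at x) v)" for v
    by (intro Ck_on_cong[OF assms(1) assms(3)[of v]]) simp
  then show ?thesis
    using assms(2) by (auto simp: differentiable_def)
qed

lemma Ck_on_SucD: "Ck_on (Suc k) W f \<Longrightarrow> Ck_on k W f"
proof (induction k arbitrary: f)
  case 0 then show ?case
    by (simp add: continuous_at_imp_continuous_on differentiable_imp_continuous_within)
qed auto

lemma Ck_on_continuous: "Ck_on k W f \<Longrightarrow> continuous_on W f"
  by (induction k arbitrary: f) (auto simp: continuous_at_imp_continuous_on differentiable_imp_continuous_within)

lemma Ck_on_local:
  "(\<And>x. x \<in> W \<Longrightarrow> \<exists>W'. open W' \<and> x \<in> W' \<and> Ck_on k W' f) \<Longrightarrow> Ck_on k W f"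
proof (induction k arbitrary: f)
  case 0
  then have "isCont f x" if "x \<in> W" for x
    using continuous_on_interior[of _ f x] that by (metis Ck_on.simps(1) interior_open)
  then show ?case by (simp add: continuous_at_imp_continuous_on)
next
  case (Suc k)
  have "f differentiable at x" if "x \<in> W" for x
    using Suc.prems[OF that] by auto
  moreover have "Ck_on k W (\<lambda>x. frechet_derivative f (at x) v)" for v
    by (rule Suc.IH) (use Suc.prems in fastforce)
  ultimately show ?case by simp
qed

lemma Ck_on_const: "open W \<Longrightarrow> Ck_on k W (\<lambda>x. c)"
  by (induction k arbitrary: c) auto

lemma Ck_on_linear:
  fixes f :: "'a::euclidean_space \<Rightarrow> 'b::euclidean_space"
  assumes "open W" "bounded_linear f" shows "Ck_on k W f"
proof (cases k)
  case 0 then show ?thesis using assms by (simp add: linear_continuous_on)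
next
  case (Suc j)
  show ?thesis unfolding Suc
    by (rule Ck_on_SucI[where f' = "\<lambda>_. f"])
      (use assms in \<open>auto intro: bounded_linear_imp_has_derivative Ck_on_const\<close>)
qed

lemma Ck_on_deriv:
  assumes "Ck_on (Suc k) W f" "x \<in> W"
  shows "(f has_derivative frechet_derivative f (at x)) (at x)"
  using assms by (auto simp: frechet_derivative_works)

lemma Ck_on_add:
  "open W \<Longrightarrow> Ck_on k W f \<Longrightarrow> Ck_on k W g \<Longrightarrow> Ck_on k W (\<lambda>x. f x + g x)"
proof (induction k arbitrary: f g)
  case 0 then show ?case by (simp add: continuous_on_add)
next
  case (Suc k)
  show ?case
    by (rule Ck_on_SucI[OF Suc.prems(1)
        has_derivative_add[OF Ck_on_deriv[OF Suc.prems(2)] Ck_on_deriv[OF Suc.prems(3)]]])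
      (use Suc in auto)
qed

lemma Ck_on_bilinear:
  assumes "bounded_bilinear h"
  shows "open W \<Longrightarrow> Ck_on k W f \<Longrightarrow> Ck_on k W g \<Longrightarrow> Ck_on k W (\<lambda>x. h (f x) (g x))"
proof (induction k arbitrary: f g)
  case 0 then show ?case using bounded_bilinear.continuous_on[OF assms] by simp
next
  case (Suc k)
  show ?case
    by (rule Ck_on_SucI[OF Suc.prems(1)
        bounded_bilinear.FDERIV[OF assms Ck_on_deriv[OF Suc.prems(2)] Ck_on_deriv[OF Suc.prems(3)]]])
     (use Suc Ck_on_SucD[OF Suc.prems(2)] Ck_on_SucD[OF Suc.prems(3)] in \<open>auto intro!: Ck_on_add\<close>)
qed

lemma Ck_on_sum:
  assumes "open W" "\<And>i. i \<in> I \<Longrightarrow> Ck_on k W (f i)"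
  shows "Ck_on k W (\<lambda>x. \<Sum>i\<in>I. f i x)"
  using assms(2)
proof (induction I rule: infinite_finite_induct)
  case (insert x F) then show ?case using assms(1) by (simp add: Ck_on_add)
qed (use assms(1) Ck_on_const in auto)

lemma linear_apply_basis:
  fixes A :: "'a::euclidean_space \<Rightarrow> 'b::real_vector"
  assumes "linear A" shows "A v = (\<Sum>b\<in>Basis. (v \<bullet> b) *\<^sub>R A b)"
proof -
  have "A v = A (\<Sum>b\<in>Basis. (v \<bullet> b) *\<^sub>R b)" by (simp add: euclidean_representation)
  then show ?thesis by (simp add: linear_sum[OF assms] linear_cmul[OF assms])
qed

text \<open>Expanding \<open>g x\<close> in the basis reduces everything to evaluations at constant
  vectors, the only form in which \<open>Ck_on\<close> records the regularity of a
  derivative.\<close>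

lemma Ck_on_linear_apply:
  fixes A :: "'c::euclidean_space \<Rightarrow> 'a::euclidean_space \<Rightarrow> 'b::euclidean_space"
  assumes "open W" "\<And>x. x \<in> W \<Longrightarrow> linear (A x)" "\<And>v. Ck_on k W (\<lambda>x. A x v)" "Ck_on k W g"
  shows "Ck_on k W (\<lambda>x. A x (g x))"
proof -
  have "Ck_on k W (\<lambda>x. \<Sum>b\<in>Basis. (g x \<bullet> b) *\<^sub>R A x b)"
    by (intro Ck_on_sum Ck_on_bilinear[OF bounded_bilinear_scaleR]
        Ck_on_bilinear[OF bounded_bilinear_inner] assms Ck_on_const)
  then show ?thesis
    by (rule Ck_on_cong[OF assms(1)]) (use linear_apply_basis[OF assms(2)] in simp)
qed

lemma Ck_on_compose:
  assumes "open S" "open T"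
  shows "Ck_on k T g \<Longrightarrow> Ck_on k S f \<Longrightarrow> f ` S \<subseteq> T \<Longrightarrow> Ck_on k S (\<lambda>x. g (f x))"
proof (induction k arbitrary: g)
  case 0 then show ?case by (auto intro: continuous_on_compose2)
next
  case (Suc k)
  have f: "(f has_derivative frechet_derivative f (at x)) (at x)" if "x \<in> S" for x
    using Ck_on_deriv[OF Suc.prems(2) that] .
  have g: "(g has_derivative frechet_derivative g (at (f x))) (at (f x))" if "x \<in> S" for x
    using Ck_on_deriv[OF Suc.prems(1)] that Suc.prems(3) by blast
  have df: "Ck_on k S (\<lambda>x. frechet_derivative f (at x) v)" for v
    using Suc.prems(2) by simp
  have "Ck_on k S (\<lambda>x. frechet_derivative g (at (f x)) (frechet_derivative f (at x) v))" for v
  proof (rule Ck_on_linear_apply[OF assms(1) _ _ df])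
    show "linear (frechet_derivative g (at (f x)))" if "x \<in> S" for x
      using g[OF that] by (rule has_derivative_linear)
    show "Ck_on k S (\<lambda>x. frechet_derivative g (at (f x)) u)" for u
      using Suc.prems by (intro Suc.IH Ck_on_SucD[OF Suc.prems(2)]) auto
  qed
  then show ?case
    by (intro Ck_on_SucI[OF assms(1) has_derivative_compose[OF f g]])
qed

named_theorems smooth_intros

lemma smooth_on_subset: "smooth_on W f \<Longrightarrow> W' \<subseteq> W \<Longrightarrow> smooth_on W' f"
  unfolding smooth_on_def using Ck_on_subset by blast
lemma smooth_on_cong: "open W \<Longrightarrow> smooth_on W f \<Longrightarrow> (\<And>x. x \<in> W \<Longrightarrow> f x = g x) \<Longrightarrow> smooth_on W g"
  unfolding smooth_on_def using Ck_on_cong by blast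
lemma smooth_on_local:
  assumes "\<And>x. x \<in> W \<Longrightarrow> \<exists>W'. open W' \<and> x \<in> W' \<and> smooth_on W' f" shows "smooth_on W f"
  unfolding smooth_on_def
proof
  fix k show "Ck_on k W f" by (rule Ck_on_local) (use assms in \<open>auto simp: smooth_on_def\<close>)
qed
lemma smooth_on_continuous: "smooth_on W f \<Longrightarrow> continuous_on W f"
  unfolding smooth_on_def using Ck_on_continuous by blast
lemma smooth_on_has_derivative:
  "smooth_on W f \<Longrightarrow> x \<in> W \<Longrightarrow> (f has_derivative frechet_derivative f (at x)) (at x)"
  unfolding smooth_on_def using Ck_on_deriv by blast
lemma smooth_on_const [smooth_intros]: "open W \<Longrightarrow> smooth_on W (\<lambda>x. c)"
  unfolding smooth_on_def using Ck_on_const by blast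
lemma smooth_on_linear: "open W \<Longrightarrow> bounded_linear f \<Longrightarrow> smooth_on W f"
  unfolding smooth_on_def using Ck_on_linear by blast
lemma smooth_on_ident [smooth_intros]: "open W \<Longrightarrow> smooth_on W (\<lambda>x. x)"
  by (rule smooth_on_linear) auto
lemma smooth_on_compose:
  "open S \<Longrightarrow> open T \<Longrightarrow> smooth_on T g \<Longrightarrow> smooth_on S f \<Longrightarrow> f ` S \<subseteq> T \<Longrightarrow> smooth_on S (\<lambda>x. g (f x))"
  unfolding smooth_on_def using Ck_on_compose by blast
lemma smooth_on_linear_compose:
  "open W \<Longrightarrow> bounded_linear h \<Longrightarrow> smooth_on W f \<Longrightarrow> smooth_on W (\<lambda>x. h (f x))"
  by (rule smooth_on_compose[where T=UNIV]) (auto intro: smooth_on_linear)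
lemmas smooth_on_fst [smooth_intros] = smooth_on_linear_compose[OF _ bounded_linear_fst]
lemmas smooth_on_snd [smooth_intros] = smooth_on_linear_compose[OF _ bounded_linear_snd]
lemma smooth_on_bilinear:
  "bounded_bilinear h \<Longrightarrow> open W \<Longrightarrow> smooth_on W f \<Longrightarrow> smooth_on W g \<Longrightarrow> smooth_on W (\<lambda>x. h (f x) (g x))"
  unfolding smooth_on_def using Ck_on_bilinear by blast
lemmas smooth_on_scaleR [smooth_intros] = smooth_on_bilinear[OF bounded_bilinear_scaleR]
lemmas smooth_on_inner [smooth_intros] = smooth_on_bilinear[OF bounded_bilinear_inner]
lemma smooth_on_mult [smooth_intros]:
  fixes f g :: "_ \<Rightarrow> real"
  shows "open W \<Longrightarrow> smooth_on W f \<Longrightarrow> smooth_on W g \<Longrightarrow> smooth_on W (\<lambda>x. f x * g x)"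
  by (rule smooth_on_bilinear[OF bounded_bilinear_mult])
lemma smooth_on_add [smooth_intros]:
  "open W \<Longrightarrow> smooth_on W f \<Longrightarrow> smooth_on W g \<Longrightarrow> smooth_on W (\<lambda>x. f x + g x)"
  unfolding smooth_on_def using Ck_on_add by blast
lemma smooth_on_minus [smooth_intros]:
  "open W \<Longrightarrow> smooth_on W f \<Longrightarrow> smooth_on W (\<lambda>x. - f x)"
  by (rule smooth_on_linear_compose[OF _ bounded_linear_minus[OF bounded_linear_ident]])
lemma smooth_on_diff [smooth_intros]:
  "open W \<Longrightarrow> smooth_on W f \<Longrightarrow> smooth_on W g \<Longrightarrow> smooth_on W (\<lambda>x. f x - g x)"
  using smooth_on_add[OF _ _ smooth_on_minus, of W f g] by simp
lemma smooth_on_sum [smooth_intros]: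
  "open W \<Longrightarrow> (\<And>i. i \<in> I \<Longrightarrow> smooth_on W (f i)) \<Longrightarrow> smooth_on W (\<lambda>x. \<Sum>i\<in>I. f i x)"
  by (simp add: smooth_on_def Ck_on_sum)
lemma smooth_on_Pair [smooth_intros]:
  fixes f :: "_ \<Rightarrow> 'b::euclidean_space" and g :: "_ \<Rightarrow> 'c::euclidean_space"
  assumes "open W" "smooth_on W f" "smooth_on W g" shows "smooth_on W (\<lambda>x. (f x, g x))"
proof -
  have "bounded_linear (\<lambda>x::'b. (x, 0::'c))" "bounded_linear (\<lambda>x::'c. (0::'b, x))"
    by (auto intro!: bounded_linear_Pair bounded_linear_ident bounded_linear_zero)
  from smooth_on_add[OF assms(1) smooth_on_linear_compose[OF assms(1) this(1) assms(2)]
      smooth_on_linear_compose[OF assms(1) this(2) assms(3)]]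
  show ?thesis by simp
qed
lemma smooth_on_linear_apply:
  fixes A :: "'c::euclidean_space \<Rightarrow> 'a::euclidean_space \<Rightarrow> 'b::euclidean_space"
  assumes "open W" "\<And>x. x \<in> W \<Longrightarrow> linear (A x)" "\<And>v. smooth_on W (\<lambda>x. A x v)" "smooth_on W g"
  shows "smooth_on W (\<lambda>x. A x (g x))"
  using assms by (simp add: smooth_on_def Ck_on_linear_apply)
lemma smooth_on_frechet_derivative [smooth_intros]:
  assumes "open W" "smooth_on W f" "smooth_on W g"
  shows "smooth_on W (\<lambda>x. frechet_derivative f (at x) (g x))"
proof (rule smooth_on_linear_apply[OF assms(1) _ _ assms(3)])
  show "smooth_on W (\<lambda>x. frechet_derivative f (at x) v)" for v
    unfolding smooth_on_def
  proof
    fix k have "Ck_on (Suc k) W f" using assms(2) by (simp add: smooth_on_def)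
    then show "Ck_on k W (\<lambda>x. frechet_derivative f (at x) v)" by simp
  qed
qed (use smooth_on_has_derivative[OF assms(2)] has_derivative_linear in blast)

section \<open>Elementary functions: reciprocal, square root, norm, exponential\<close>

lemma Ck_on_inverse: "Ck_on k {x::real. x \<noteq> 0} inverse"
proof (induction k)
  case 0 show ?case by (auto intro!: continuous_intros)
next
  case (Suc k)
  have o: "open {x::real. x \<noteq> 0}" by (simp add: open_Collect_neq)
  \<comment> \<open>The derivative is written as a product of copies of \<open>inverse\<close>, so
    that the induction hypothesis applies to it.\<close>
  have "(inverse has_derivative (\<lambda>v. v * - (inverse x * inverse x))) (at x)"
    if "x \<in> {x::real. x \<noteq> 0}" for x
    using DERIV_inverse[of x UNIV, unfolded has_field_derivative_def] that
    by (rule_tac has_derivative_eq_rhs) (auto simp: fun_eq_iff)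
  then show ?case
  proof (rule Ck_on_SucI[OF o])
    fix v :: real
    show "Ck_on k {x. x \<noteq> 0} (\<lambda>x. v * - (inverse x * inverse x))"
      using Ck_on_bilinear[OF bounded_bilinear_mult o Ck_on_const[OF o, where c="- v"]
          Ck_on_bilinear[OF bounded_bilinear_mult o Suc Suc]] by simp
  qed
qed

lemma smooth_on_inverse [smooth_intros]:
  fixes f :: "_ \<Rightarrow> real"
  assumes "open W" "smooth_on W f" "\<And>x. x \<in> W \<Longrightarrow> f x \<noteq> 0" shows "smooth_on W (\<lambda>x. inverse (f x))"
  by (rule smooth_on_compose[where T="{x::real. x \<noteq> 0}"])
    (use assms Ck_on_inverse in \<open>auto simp: smooth_on_def open_Collect_neq\<close>)

lemma smooth_on_divide [smooth_intros]:
  fixes f :: "_ \<Rightarrow> real"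
  assumes "open W" "smooth_on W f" "smooth_on W g" "\<And>x. x \<in> W \<Longrightarrow> g x \<noteq> 0"
  shows "smooth_on W (\<lambda>x. f x / g x)"
  unfolding divide_inverse using assms by (intro smooth_intros)

lemma Ck_on_sqrt: "Ck_on k {x::real. x > 0} sqrt"
proof (induction k)
  case 0 show ?case by (auto intro!: continuous_intros)
next
  case (Suc k)
  have o: "open {x::real. x > 0}" by (simp add: open_Collect_less)
  have "(sqrt has_derivative (\<lambda>v. v * (inverse (sqrt x) / 2))) (at x)" if "x \<in> {x::real. x > 0}" for x
    using DERIV_real_sqrt[of x, unfolded has_field_derivative_def] that
    by (rule_tac has_derivative_eq_rhs) (auto simp: fun_eq_iff)
  then show ?case
  proof (rule Ck_on_SucI[OF o])
    fix v :: real
    have "Ck_on k {x::real. x > 0} (\<lambda>x. inverse (sqrt x))"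
      by (rule Ck_on_compose[OF o _ Ck_on_inverse Suc]) (auto simp: open_Collect_neq)
    from Ck_on_bilinear[OF bounded_bilinear_mult o Ck_on_const[OF o, of _ "v/2"] this]
    show "Ck_on k {x. 0 < x} (\<lambda>x. v * (inverse (sqrt x) / 2))" by simp
  qed
qed

lemma smooth_on_sqrt [smooth_intros]:
  assumes "open W" "smooth_on W f" "\<And>x. x \<in> W \<Longrightarrow> f x > 0" shows "smooth_on W (\<lambda>x. sqrt (f x))"
  by (rule smooth_on_compose[where T="{x::real. x > 0}"])
    (use assms Ck_on_sqrt in \<open>auto simp: smooth_on_def open_Collect_less\<close>)

lemma smooth_on_norm [smooth_intros]:
  fixes f :: "_ \<Rightarrow> 'b::euclidean_space"
  assumes "open W" "smooth_on W f" "\<And>x. x \<in> W \<Longrightarrow> f x \<noteq> 0" shows "smooth_on W (\<lambda>x. norm (f x))"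
  unfolding norm_eq_sqrt_inner using assms by (intro smooth_intros) auto

lemma smooth_on_sgn [smooth_intros]:
  fixes f :: "_ \<Rightarrow> 'b::euclidean_space"
  assumes "open W" "smooth_on W f" "\<And>x. x \<in> W \<Longrightarrow> f x \<noteq> 0" shows "smooth_on W (\<lambda>x. sgn (f x))"
  unfolding sgn_div_norm using assms by (intro smooth_intros) auto

lemma Ck_on_exp: "Ck_on k UNIV (\<lambda>x::real. exp x)"
proof (induction k)
  case (Suc k)
  have "((\<lambda>x. exp x) has_derivative (\<lambda>v. v * exp x)) (at x)" for x :: real
    by (auto intro!: derivative_eq_intros simp: fun_eq_iff)
  then show ?case
    by (rule Ck_on_SucI[OF open_UNIV])
      (rule Ck_on_bilinear[OF bounded_bilinear_mult open_UNIV Ck_on_const[OF open_UNIV] Suc])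
qed (auto intro!: continuous_intros)

lemma smooth_on_exp [smooth_intros]:
  assumes "open W" "smooth_on W f" shows "smooth_on W (\<lambda>x. exp (f x :: real))"
  by (rule smooth_on_compose[where T=UNIV]) (use assms Ck_on_exp in \<open>auto simp: smooth_on_def\<close>)

text \<open>Applied to \<open>(y, v) \<mapsto> (y, A y v)\<close>, invariance of domain and the differentiability of inverse
  maps yield that the inverse of a family of linear maps is as regular as the family.\<close>

lemma Ck_on_inverse_family:
  fixes A B :: "'c::euclidean_space \<Rightarrow> 'a::euclidean_space \<Rightarrow> 'a"
  assumes W: "open W" and lin: "\<And>x. x \<in> W \<Longrightarrow> linear (A x)" "\<And>x. x \<in> W \<Longrightarrow> linear (B x)"
    and AB: "\<And>x v. x \<in> W \<Longrightarrow> A x (B x v) = v"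
  shows "(\<And>v. Ck_on k W (\<lambda>x. A x v)) \<Longrightarrow> Ck_on k W (\<lambda>x. B x v)"
proof (induction k arbitrary: v)
  have BA: "B x (A x v) = v" if "x \<in> W" for x v
  proof -
    have "A x \<circ> B x = id" using AB[OF that] by (simp add: fun_eq_iff)
    then have "B x \<circ> A x = id" using linear_inverse_left[OF lin[OF that]] by simp
    then show ?thesis by (simp add: fun_eq_iff)
  qed
  define G where "G = (\<lambda>z. (fst z, A (fst z) (snd z)))"
  define G' where "G' = (\<lambda>z. (fst z, B (fst z) (snd z)))"
  have o: "open (W \<times> (UNIV :: 'a set))" using W by (simp add: open_Times)
  have GG': "G' (G z) = z" if "z \<in> W \<times> UNIV" for z
    using that BA by (auto simp: G_def G'_def)
  have img: "G ` (W \<times> UNIV) = W \<times> UNIV"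
  proof (intro equalityI subsetI)
    fix z assume "z \<in> W \<times> (UNIV :: 'a set)"
    then show "z \<in> G ` (W \<times> UNIV)"
      by (intro image_eqI[where x="G' z"]) (auto simp: G_def G'_def AB)
  qed (auto simp: G_def)
  have comb: "Ck_on k (W \<times> (UNIV :: 'a set)) G" if "\<And>v. Ck_on k W (\<lambda>x. A x v)" for k
  proof -
    have f: "Ck_on k (W \<times> (UNIV :: 'a set)) fst" "Ck_on k (W \<times> (UNIV :: 'a set)) snd"
      by (rule Ck_on_linear[OF o], rule bounded_linear_fst, rule Ck_on_linear[OF o], rule bounded_linear_snd)
    have "Ck_on k (W \<times> (UNIV :: 'a set)) (\<lambda>z. A (fst z) (snd z))"
    proof (rule Ck_on_linear_apply[OF o _ _ f(2)])
      show "linear (A (fst z))" if "z \<in> W \<times> UNIV" for z :: "'c \<times> 'a" using that lin by auto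
      show "Ck_on k (W \<times> (UNIV :: 'a set)) (\<lambda>z. A (fst z) v)" for v
        by (rule Ck_on_compose[OF o W that f(1)]) auto
    qed
    have 1: "Ck_on k UNIV (\<lambda>v::'c. (v, 0::'a))" and 2: "Ck_on k UNIV (\<lambda>v::'a. (0::'c, v))"
      by (auto intro!: Ck_on_linear bounded_linear_Pair bounded_linear_ident bounded_linear_zero)
    show ?thesis
      using Ck_on_add[OF o Ck_on_compose[OF o open_UNIV 1 f(1)]
          Ck_on_compose[OF o open_UNIV 2 \<open>Ck_on k (W \<times> (UNIV :: 'a set)) (\<lambda>z. A (fst z) (snd z))\<close>]]
      by (simp add: G_def)
  qed
  have slice: "continuous_on W (\<lambda>x. B x v)" if "continuous_on (W \<times> UNIV) G'" for v
  proof -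
    have "continuous_on W (\<lambda>x. snd (G' (x, v)))"
      by (intro continuous_on_snd continuous_on_compose2[OF that]) (auto intro!: continuous_intros)
    then show ?thesis by (simp add: G'_def)
  qed
  {
    case 0
    have "continuous_on (W \<times> UNIV) G" using comb[of 0] 0 by simp
    then have "continuous_on (G ` (W \<times> UNIV)) G'"
      by (rule continuous_on_inverse_open[OF o]) (use GG' in auto)
    then show ?case using slice by (simp add: img)
  next
    case (Suc k)
    have cG: "Ck_on (Suc k) (W \<times> UNIV) G" using comb[of "Suc k"] Suc.prems by simp
    have dA: "((\<lambda>x. A x v) has_derivative frechet_derivative (\<lambda>x. A x v) (at x)) (at x)" if "x \<in> W" for x v
      using Ck_on_deriv[OF Suc.prems that] .
    have IH: "Ck_on k W (\<lambda>x. B x v)" for v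
      by (rule Suc.IH[OF Ck_on_SucD[OF Suc.prems]])
    define D where "D = (\<lambda>x u. \<Sum>b\<in>Basis. (B x v \<bullet> b) *\<^sub>R frechet_derivative (\<lambda>x. A x b) (at x) u)"
    have dB: "((\<lambda>x. B x v) has_derivative (\<lambda>u. - B x (D x u))) (at x)" if x: "x \<in> W" for x
    proof -
      define G1 where "G1 = (\<lambda>(u, w). (u, D x u + A x w))"
      define G2 where "G2 = (\<lambda>(u, w). (u, B x (w - D x u)))"
      \<comment> \<open>Only the maps \<open>A\<close> at fixed vectors are known to be
        differentiable, so \<open>G\<close> is differentiated through the basis expansion of
        \<open>A (fst z) (snd z)\<close>.\<close>
      have "((\<lambda>z. (fst z, \<Sum>b\<in>Basis. (snd z \<bullet> b) *\<^sub>R A (fst z) b)) has_derivative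
          (\<lambda>(u, w). (u, \<Sum>b\<in>Basis. (B x v \<bullet> b) *\<^sub>R frechet_derivative (\<lambda>x. A x b) (at x) u
              + (w \<bullet> b) *\<^sub>R A x b))) (at (x, B x v))"
        unfolding case_prod_beta
        by (auto intro!: derivative_eq_intros has_derivative_compose[OF has_derivative_fst[OF has_derivative_ident]] dA x)
      moreover have "(\<lambda>(u, w). (u, \<Sum>b\<in>Basis. (B x v \<bullet> b) *\<^sub>R frechet_derivative (\<lambda>x. A x b) (at x) u
              + (w \<bullet> b) *\<^sub>R A x b)) = G1"
        by (simp add: fun_eq_iff G1_def D_def sum.distrib) (simp only: linear_apply_basis[OF lin(1)[OF x], symmetric] simp_thms)
      ultimately have "((\<lambda>z. (fst z, \<Sum>b\<in>Basis. (snd z \<bullet> b) *\<^sub>R A (fst z) b)) has_derivative G1) (at (x, B x v))"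
        by (simp only:)
      then have dG: "(G has_derivative G1) (at (x, B x v))"
        by (rule has_derivative_transform_within_open[OF _ o])
          (use x in \<open>auto simp: G_def intro!: linear_apply_basis[OF lin(1), symmetric]\<close>)
      have "(G' has_derivative G2) (at (G (x, B x v)))"
      proof (rule has_derivative_inverse_strong[OF o _ Ck_on_continuous[OF cG] GG' dG])
        show "G1 \<circ> G2 = id"
          by (auto simp: G1_def G2_def fun_eq_iff AB[OF x])
      qed (use x in auto)
      then have "(G' has_derivative G2) (at (x, v))" by (simp add: G_def AB[OF x])
      moreover have "((\<lambda>x. (x, v)) has_derivative (\<lambda>u. (u, 0))) (at x)"
        by (auto intro!: derivative_eq_intros)
      ultimately have "((\<lambda>x. G' (x, v)) has_derivative (\<lambda>u. G2 (u, 0))) (at x)"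
        using has_derivative_compose by blast
      from has_derivative_snd[OF this] show ?thesis
        by (simp add: G'_def G2_def linear_neg[OF lin(2)[OF x]])
    qed
    show ?case
    proof (rule Ck_on_SucI[OF W dB])
      fix u
      have "Ck_on k W (\<lambda>x. B x (D x u))"
        by (rule Ck_on_linear_apply[OF W lin(2) IH])
          (use Suc.prems in \<open>auto simp: D_def intro!: Ck_on_sum[OF W] Ck_on_bilinear[OF bounded_bilinear_scaleR W]
            Ck_on_bilinear[OF bounded_bilinear_inner W] IH Ck_on_const W\<close>)
      then have "Ck_on k W (\<lambda>x. (-1) *\<^sub>R B x (D x u))"
        by (rule Ck_on_bilinear[OF bounded_bilinear_scaleR W Ck_on_const[OF W]])
      then show "Ck_on k W (\<lambda>x. - B x (D x u))" by simp
    qed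
  }
qed

text \<open>The derivative of \<open>g\<close> at \<open>y\<close> inverts that of \<open>f\<close>
  at \<open>g y\<close>. If \<open>g\<close> is C^k, this family of inverses is C^k as well, which
  makes \<open>g\<close> C^(k+1); the induction starts from the differentiability of
  \<open>g\<close>.\<close>

lemma smooth_on_inverse_map:
  fixes f g :: "'a::euclidean_space \<Rightarrow> 'a"
  assumes S: "open S" and f: "smooth_on S f" and gf: "\<And>x. x \<in> S \<Longrightarrow> g (f x) = x"
    and inj: "\<And>x v. x \<in> S \<Longrightarrow> frechet_derivative f (at x) v = 0 \<Longrightarrow> v = 0"
  shows "open (f ` S)" "smooth_on (f ` S) g"
proof -
  have "inj_on f S" using gf by (metis inj_onI)
  then show T: "open (f ` S)"
    using invariance_of_domain[OF smooth_on_continuous[OF f] S] by blast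
  define B where "B = (\<lambda>y. inv (frechet_derivative f (at (g y))))"
  have d: "(f has_derivative frechet_derivative f (at (g y))) (at (g y))" if "y \<in> f ` S" for y
    using smooth_on_has_derivative[OF f] that gf by auto
  have lin: "linear (frechet_derivative f (at (g y)))" if "y \<in> f ` S" for y
    using d[OF that] has_derivative_linear by blast
  have injD: "inj (frechet_derivative f (at (g y)))" if "y \<in> f ` S" for y
    using linear_injective_0[OF lin[OF that]] inj gf that by auto
  have B1: "frechet_derivative f (at (g y)) (B y v) = v" if "y \<in> f ` S" for y v
    unfolding B_def
    using linear_injective_imp_surjective[OF lin[OF that] injD[OF that]] surj_f_inv_f by auto
  have B2: "linear (B y)" if "y \<in> f ` S" for y
    unfolding B_def
    using linear_injective_imp_surjective[OF lin[OF that] injD[OF that]] lin[OF that] injD[OF that]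
    by (metis bij_def inj_linear_imp_inv_linear)
  have dg: "(g has_derivative B y) (at y)" if y: "y \<in> f ` S" for y
  proof -
    have "(g has_derivative B y) (at (f (g y)))"
      by (rule has_derivative_inverse_strong[OF S _ smooth_on_continuous[OF f] gf d[OF y]])
        (use y gf B1 in \<open>auto simp: fun_eq_iff\<close>)
    then show ?thesis using y gf by auto
  qed
  have "Ck_on k (f ` S) g" for k
  proof (induction k)
    case 0
    show ?case
      using has_derivative_continuous[OF dg] by (simp add: continuous_at_imp_continuous_on)
  next
    case (Suc k)
    have sub: "g ` f ` S \<subseteq> S" using gf by auto
    have "Ck_on k S (\<lambda>x. frechet_derivative f (at x) v)" for v
    proof -
      have "Ck_on (Suc k) S f" using f by (simp add: smooth_on_def)
      then show ?thesis by simp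
    qed
    then have A: "Ck_on k (f ` S) (\<lambda>y. frechet_derivative f (at (g y)) v)" for v
      by (rule Ck_on_compose[OF T S _ Suc sub])
    have "Ck_on k (f ` S) (\<lambda>y. B y v)" for v
      by (rule Ck_on_inverse_family[OF T lin B2 B1 A])
    from Ck_on_SucI[OF T dg this] show ?case .
  qed
  then show "smooth_on (f ` S) g" by (simp add: smooth_on_def)
qed


text \<open>The factors \<open>inverse x ^ n\<close> make the family closed under differentiation.\<close>

definition flat :: "nat \<Rightarrow> real \<Rightarrow> real" where
  "flat n x = (if x > 0 then inverse x ^ n * exp (- inverse x) else 0)"

lemma flat_tendsto_0: "(flat n \<longlongrightarrow> 0) (at 0)"
proof (rule filterlim_split_at)
  have "((\<lambda>x. inverse x ^ n / exp (inverse x)) \<longlongrightarrow> 0) (at_right (0::real))"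
    by (rule filterlim_compose[OF tendsto_power_div_exp_0 filterlim_inverse_at_top_right])
  then show "(flat n \<longlongrightarrow> 0) (at_right 0)"
    by (rule tendsto_cong[THEN iffD1, rotated])
      (auto simp: eventually_at_right[of 0 1] flat_def exp_minus divide_inverse intro!: exI[of _ 1])
  show "(flat n \<longlongrightarrow> 0) (at_left 0)"
    by (rule tendsto_cong[THEN iffD1, OF _ tendsto_const])
      (auto simp: eventually_at_left[of "-1" 0] flat_def intro!: exI[of _ "-1"])
qed

lemma flat_has_derivative: "(flat n has_real_derivative (flat (n + 2) x - n * flat (n + 1) x)) (at x)"
proof -
  consider "x > 0" | "x = 0" | "x < 0" by linarith
  then show ?thesis
  proof cases
    case 1
    have d: "(inverse has_real_derivative - (inverse x ^ Suc (Suc 0))) (at x)"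
      using 1 by (intro DERIV_inverse) simp
    have eq: "real n * (- (i ^ Suc (Suc 0)) * i ^ (n - Suc 0)) * e + e * - (- (i ^ Suc (Suc 0))) * i ^ n =
        i ^ (n + 2) * e - real n * (i ^ (n + 1) * e)" for i e :: real
      by (cases n) (auto simp: algebra_simps)
    have "((\<lambda>x. inverse x ^ n * exp (- inverse x)) has_real_derivative (flat (n + 2) x - n * flat (n + 1) x)) (at x)"
      using DERIV_mult[OF DERIV_power[OF d, of n] DERIV_fun_exp[OF DERIV_minus[OF d]]] 1
      unfolding eq by (simp only: flat_def if_True)
    then show ?thesis
      by (rule has_field_derivative_transform_within_open[of _ _ _ "{0<..}"]) (use 1 in \<open>auto simp: flat_def\<close>)
  next
    case 2
    \<comment> \<open>The difference quotient of \<open>flat n\<close> at 0 is the next member of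
      the family, which tends to 0.\<close>
    have "flat n h / h = flat (Suc n) h" for h by (simp add: flat_def divide_inverse)
    then show ?thesis
      unfolding 2 DERIV_def using flat_tendsto_0[of "Suc n"] by (simp add: flat_def[of _ 0])
  next
    case 3
    have "(flat n has_real_derivative 0) (at x)"
      by (rule has_field_derivative_transform_within_open[of "\<lambda>_. 0" _ _ "{..<0}"]) (use 3 in \<open>auto simp: flat_def\<close>)
    then show ?thesis using 3 by (simp add: flat_def)
  qed
qed

lemma smooth_on_flat [smooth_intros]:
  assumes "open W" "smooth_on W f" shows "smooth_on W (\<lambda>x. flat n (f x))"
proof (rule smooth_on_compose[OF assms(1) open_UNIV _ assms(2)])
  have "Ck_on k UNIV (flat n)" for k
  proof (induction k arbitrary: n)
    case 0
    show ?case
      using DERIV_isCont[OF flat_has_derivative] by (simp add: continuous_at_imp_continuous_on)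
  next
    case (Suc k)
    have "(flat n has_derivative (\<lambda>v. v * flat (n + 2) x + (- (v * n)) * flat (n + 1) x)) (at x)" for x
      using flat_has_derivative[of n x, unfolded has_field_derivative_def]
      by (rule has_derivative_eq_rhs) (simp add: fun_eq_iff algebra_simps)
    then show ?case
      by (rule Ck_on_SucI[OF open_UNIV])
        (intro Ck_on_add Ck_on_bilinear[OF bounded_bilinear_mult] open_UNIV Ck_on_const Suc)
  qed
  then show "smooth_on UNIV (flat n)" by (simp add: smooth_on_def)
qed auto

section \<open>Step functions and cutoffs\<close>

definition smooth_step :: "real \<Rightarrow> real" where
  "smooth_step x = flat 0 x / (flat 0 x + flat 0 (1 - x))"

lemma smooth_step_simps:
  "x \<le> 0 \<Longrightarrow> smooth_step x = 0" "x \<ge> 1 \<Longrightarrow> smooth_step x = 1" "smooth_step x \<in> {0..1}"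
  and smooth_step_pos: "flat 0 x + flat 0 (1 - x) > 0"
proof -
  have nn: "flat 0 x \<ge> 0" for x by (simp add: flat_def)
  show p: "flat 0 x + flat 0 (1 - x) > 0"
    by (cases "x > 0") (auto simp: flat_def intro: add_pos_nonneg)
  show "smooth_step x \<in> {0..1}"
    using nn[of x] nn[of "1 - x"] p by (simp add: smooth_step_def)
qed (auto simp: smooth_step_def flat_def)

lemma smooth_on_smooth_step [smooth_intros]:
  assumes "open W" "smooth_on W f" shows "smooth_on W (\<lambda>x. smooth_step (f x))"
  unfolding smooth_step_def
  by (intro smooth_intros assms less_imp_neq[OF smooth_step_pos, symmetric])

text \<open>Bumps on finitely many balls covering \<open>K\<close> add up to a function with a
  positive minimum on \<open>K\<close>, which \<open>smooth_step\<close> then flattens. The value 1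
  is attained on a whole neighbourhood \<open>N\<close>, since derivatives at points of
  \<open>K\<close> are taken later.\<close>

lemma smooth_cutoff:
  fixes K W :: "'a::euclidean_space set"
  assumes "compact K" "open W" "K \<subseteq> W"
  obtains \<rho> :: "'a \<Rightarrow> real" and N Q where "smooth_on UNIV \<rho>" "open N" "K \<subseteq> N" "compact Q" "Q \<subseteq> W"
    "\<And>x. x \<in> N \<Longrightarrow> \<rho> x = 1" "\<And>x. x \<notin> Q \<Longrightarrow> \<rho> x = 0"
proof (cases "K = {}")
  case True
  then show ?thesis
    using that[of "\<lambda>_. 0" "{}" "{}"] smooth_on_const[OF open_UNIV] by auto
next
  case False
  have "\<forall>x\<in>K. \<exists>r>0. cball x r \<subseteq> W"
    using assms open_contains_cball by blast
  then obtain r where r: "\<And>x. x \<in> K \<Longrightarrow> r x > 0" "\<And>x. x \<in> K \<Longrightarrow> cball x (r x) \<subseteq> W"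
    by metis
  have "K \<subseteq> (\<Union>x\<in>K. ball x (r x))" using r(1) by auto
  from compactE_image[OF assms(1) open_ball this]
  obtain D where D: "D \<subseteq> K" "finite D" "K \<subseteq> (\<Union>x\<in>D. ball x (r x))" .
  define \<phi> where "\<phi> = (\<lambda>z. \<Sum>x\<in>D. flat 0 ((r x)\<^sup>2 - (z - x) \<bullet> (z - x)))"
  have sm: "smooth_on UNIV \<phi>"
    unfolding \<phi>_def by (intro smooth_intros open_UNIV)
  have nn: "flat 0 x \<ge> 0" for x by (simp add: flat_def)
  have pos: "\<phi> z > 0" if zK: "z \<in> K" for z
  proof -
    obtain x where x: "x \<in> D" "dist x z < r x" using D(3) zK by auto
    then have "(norm (z - x))\<^sup>2 < (r x)\<^sup>2"
      by (intro power_strict_mono) (auto simp: dist_norm norm_minus_commute)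
    then have "flat 0 ((r x)\<^sup>2 - (z - x) \<bullet> (z - x)) > 0"
      by (simp add: flat_def power2_norm_eq_inner)
    then show ?thesis
      unfolding \<phi>_def by (intro sum_pos2[OF D(2) x(1)] nn)
  qed
  obtain z0 where z0: "z0 \<in> K" "\<And>z. z \<in> K \<Longrightarrow> \<phi> z0 \<le> \<phi> z"
    using continuous_attains_inf[OF assms(1) False, of \<phi>] continuous_on_subset[OF smooth_on_continuous[OF sm]]
    by auto
  define m where "m = \<phi> z0"
  have m: "m > 0" using pos z0 by (simp add: m_def)
  show ?thesis
  \<comment> \<open>With \<open>m\<close> the minimum on \<open>K\<close>, the factor
    \<open>2 / m\<close> lifts the argument of \<open>smooth_step\<close> above 1 as soon as the sum
    exceeds \<open>m / 2\<close>, which is an open condition satisfied on \<open>K\<close>.\<close>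
  proof (rule that[of "\<lambda>z. smooth_step (2 / m * \<phi> z)" "{z. \<phi> z > m / 2}" "\<Union>x\<in>D. cball x (r x)"])
    show "smooth_on UNIV (\<lambda>z. smooth_step (2 / m * \<phi> z))"
      by (intro smooth_intros open_UNIV sm)
    show "open {z. \<phi> z > m / 2}"
      by (intro open_Collect_less continuous_on_const smooth_on_continuous sm)
    show "K \<subseteq> {z. \<phi> z > m / 2}"
      using z0(2) m unfolding m_def by fastforce
    show "smooth_step (2 / m * \<phi> x) = 1" if "x \<in> {z. \<phi> z > m / 2}" for x
      using that m by (intro smooth_step_simps(2)) (simp add: field_simps)
    show "smooth_step (2 / m * \<phi> z) = 0" if z: "z \<notin> (\<Union>x\<in>D. cball x (r x))" for z
    proof -
      have "flat 0 ((r x)\<^sup>2 - (z - x) \<bullet> (z - x)) = 0" if "x \<in> D" for x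
      proof -
        have "r x < norm (z - x)" "r x > 0" using z that r(1) D(1) by (auto simp: dist_norm norm_minus_commute)
        then have "(r x)\<^sup>2 < (norm (z - x))\<^sup>2" by (intro power_strict_mono) auto
        then show ?thesis by (simp add: flat_def power2_norm_eq_inner)
      qed
      then have "\<phi> z = 0" by (simp add: \<phi>_def)
      then show ?thesis by (simp add: smooth_step_simps)
    qed
    show "(\<Union>x\<in>D. cball x (r x)) \<subseteq> W" using r(2) D(1) by blast
    show "compact (\<Union>x\<in>D. cball x (r x))" using D(2) by (intro compact_UN) auto
  qed
qed

section \<open>Homogeneous maps\<close>

lemma smooth_on_slice_derivative:
  assumes "smooth_on W f" "(t, z) \<in> W"
  shows "((\<lambda>z. f (t, z)) has_derivative (\<lambda>v. frechet_derivative f (at (t, z)) (0, v))) (at z)"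
  by (rule has_derivative_compose[where f="\<lambda>z. (t, z)" and f'="\<lambda>v. (0, v)"])
    (use smooth_on_has_derivative[OF assms] in \<open>auto intro!: derivative_eq_intros\<close>)

lemma smooth_on_slice:
  assumes "smooth_on (I \<times> S) f" "t \<in> I" "open I" "open S"
  shows "smooth_on S (\<lambda>z. f (t, z))"
  by (rule smooth_on_compose[OF assms(4) open_Times[OF assms(3,4)] assms(1)])
    (use assms in \<open>auto intro!: smooth_intros\<close>)

definition open_cone :: "'a::euclidean_space set \<Rightarrow> bool" where
  "open_cone V \<longleftrightarrow> open V \<and> 0 \<notin> V \<and> (\<forall>z\<in>V. \<forall>r>0. r *\<^sub>R z \<in> V)"

definition homog :: "nat \<Rightarrow> 'a::real_vector set \<Rightarrow> ('a \<Rightarrow> 'b::real_vector) \<Rightarrow> bool" where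
  "homog d V f \<longleftrightarrow> (\<forall>z\<in>V. \<forall>r>0. f (r *\<^sub>R z) = r ^ d *\<^sub>R f z)"

lemma open_coneD: "open_cone V \<Longrightarrow> open V" "open_cone V \<Longrightarrow> z \<in> V \<Longrightarrow> z \<noteq> 0"
    "open_cone V \<Longrightarrow> z \<in> V \<Longrightarrow> r > 0 \<Longrightarrow> r *\<^sub>R z \<in> V"
  by (auto simp: open_cone_def)

lemma open_cone_punctured [simp]: "open_cone (- {0})"
  by (auto simp: open_cone_def)

lemma open_cone_scale_iff: "open_cone V \<Longrightarrow> r > 0 \<Longrightarrow> r *\<^sub>R z \<in> V \<longleftrightarrow> z \<in> V"
  using open_coneD(3)[of V "r *\<^sub>R z" "inverse r"] open_coneD(3) by auto

lemma open_cone_sgn: "open_cone V \<Longrightarrow> sgn z \<in> V \<longleftrightarrow> z \<in> V"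
  using open_cone_scale_iff[of V "inverse (norm z)" z] open_coneD(2)[of V 0]
  by (cases "z = 0") (auto simp: sgn_div_norm)

lemma sgn_scaleR_pos: "r > 0 \<Longrightarrow> sgn (r *\<^sub>R z) = sgn (z::'a::real_normed_vector)"
  by (simp add: sgn_scaleR)

lemma homogD: "homog d V f \<Longrightarrow> z \<in> V \<Longrightarrow> r > 0 \<Longrightarrow> f (r *\<^sub>R z) = r ^ d *\<^sub>R f z"
  by (simp add: homog_def)

lemma homog_sgn:
  assumes "homog d V f" "z \<in> V" "z \<noteq> 0" shows "f z = norm z ^ d *\<^sub>R f (sgn z)"
  using homogD[OF assms(1,2), of "inverse (norm z)"] assms(3)
  by (simp add: sgn_div_norm power_inverse)

text \<open>Differentiating \<open>f (r z) = r^d f z\<close> in \<open>z\<close>: the derivative has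
  degree \<open>d - 1\<close>. The factor \<open>r\<close> stays on the left so that degree 0 is
  covered too.\<close>

lemma homog_derivative_scale:
  fixes f :: "'a::euclidean_space \<Rightarrow> 'b::euclidean_space"
  assumes V: "open_cone V" and f: "smooth_on V f" "homog d V f" and z: "z \<in> V" "r > 0"
  shows "r *\<^sub>R frechet_derivative f (at (r *\<^sub>R z)) v = r ^ d *\<^sub>R frechet_derivative f (at z) v"
proof -
  have lin: "linear (frechet_derivative f (at (r *\<^sub>R z)))"
    using smooth_on_has_derivative[OF f(1)] open_coneD(3)[OF V] z has_derivative_linear by blast
  have 1: "((\<lambda>z. f (r *\<^sub>R z)) has_derivative (\<lambda>v. frechet_derivative f (at (r *\<^sub>R z)) (r *\<^sub>R v))) (at z)"
    by (rule has_derivative_compose[where f="\<lambda>z. r *\<^sub>R z"])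
      (use smooth_on_has_derivative[OF f(1)] open_coneD(3)[OF V] z in \<open>auto intro!: derivative_eq_intros\<close>)
  have "((\<lambda>z. r ^ d *\<^sub>R f z) has_derivative (\<lambda>v. r ^ d *\<^sub>R frechet_derivative f (at z) v)) (at z)"
    using smooth_on_has_derivative[OF f(1) z(1)] by (auto intro!: derivative_eq_intros)
  then have "((\<lambda>z. f (r *\<^sub>R z)) has_derivative (\<lambda>v. r ^ d *\<^sub>R frechet_derivative f (at z) v)) (at z)"
    by (rule has_derivative_transform_within_open[OF _ open_coneD(1)[OF V] z(1)])
      (use f(2) z in \<open>auto simp: homog_def\<close>)
  from fun_cong[OF has_derivative_unique[OF 1 this], of v] show ?thesis
    using linear_cmul[OF lin] by simp
qed

lemma homog_euler:
  fixes f :: "'a::euclidean_space \<Rightarrow> 'b::euclidean_space"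
  assumes f: "smooth_on V f" "homog d V f" and z: "z \<in> V"
  shows "frechet_derivative f (at z) z = real d *\<^sub>R f z"
proof -
  have 1: "((\<lambda>r. f (r *\<^sub>R z)) has_derivative (\<lambda>v. frechet_derivative f (at z) (v *\<^sub>R z))) (at (1::real))"
    by (rule has_derivative_compose[where f="\<lambda>r. r *\<^sub>R z"])
      (use smooth_on_has_derivative[OF f(1) z] in \<open>auto intro!: derivative_eq_intros\<close>)
  have "((\<lambda>r. r ^ d *\<^sub>R f z) has_derivative (\<lambda>v. (real d * v) *\<^sub>R f z)) (at (1::real))"
    by (auto intro!: derivative_eq_intros)
  then have "((\<lambda>r. f (r *\<^sub>R z)) has_derivative (\<lambda>v. (real d * v) *\<^sub>R f z)) (at (1::real))"
    by (rule has_derivative_transform_within_open[of _ _ _ _ "{0<..}"]) (use homogD[OF f(2) z] in auto)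
  from fun_cong[OF has_derivative_unique[OF 1 this], of 1] show ?thesis by simp
qed

text \<open>The derivative of a map of degree 1 has degree 0, so a bound on the unit sphere is a
  bound everywhere. On that compact sphere continuity in \<open>t\<close> is uniform, and at
  \<open>t0\<close> the derivative vanishes.\<close>

lemma homog_small_derivative:
  fixes D :: "real \<times> 'a::euclidean_space \<Rightarrow> 'b::euclidean_space"
  assumes I: "open I" "t0 \<in> I" and D: "smooth_on (I \<times> - {0}) D"
    and hom: "\<And>t. t \<in> I \<Longrightarrow> homog 1 (- {0}) (\<lambda>z. D (t, z))"
    and D0: "\<And>z. z \<noteq> 0 \<Longrightarrow> D (t0, z) = 0" and e: "e > 0"
  obtains \<delta> where "\<delta> > 0" "ball t0 \<delta> \<subseteq> I"
    "\<And>t z v. t \<in> ball t0 \<delta> \<Longrightarrow> z \<noteq> 0 \<Longrightarrow> norm (frechet_derivative (\<lambda>z. D (t, z)) (at z) v) \<le> e * norm v"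
proof -
  \<comment> \<open>Since the coordinates of \<open>v\<close> are at most \<open>norm v\<close>,
    this sum over the basis bounds the operator norm, and it is visibly continuous.\<close>
  define g where "g = (\<lambda>p. \<Sum>b\<in>Basis. norm (frechet_derivative D (at p) (0, b)))"
  have fr: "frechet_derivative (\<lambda>z. D (t, z)) (at z) = (\<lambda>v. frechet_derivative D (at (t, z)) (0, v))"
    if "t \<in> I" "z \<noteq> 0" for t z
    by (rule frechet_derivative_at[symmetric, OF smooth_on_slice_derivative[OF D]]) (use that in auto)
  have "continuous_on (I \<times> - {0}) g"
    unfolding g_def
    by (intro continuous_on_sum continuous_on_norm smooth_on_continuous smooth_on_frechet_derivative
        smooth_on_const D open_Times I) auto
  then have "continuous_on (I \<times> sphere 0 1) g" by (rule continuous_on_subset) auto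
  from continuous_on_prod_compactE[OF this compact_sphere I(2) e]
  obtain X0 where X0: "t0 \<in> X0" "open X0"
    "\<forall>t\<in>X0 \<inter> I. \<forall>z\<in>sphere 0 1. dist (g (t, z)) (g (t0, z)) \<le> e" .
  have g0: "g (t0, z) = 0" if "z \<noteq> 0" for z
  proof -
    have "open (- {0::'a})" "z \<in> - {0}" using that by auto
    then have "((\<lambda>z. D (t0, z)) has_derivative (\<lambda>v. 0)) (at z)"
      by (rule has_derivative_transform_within_open[OF has_derivative_const[of 0]]) (simp add: D0)
    then have "frechet_derivative D (at (t0, z)) (0, b) = 0" for b
      using fr[OF I(2) that] frechet_derivative_at[of "\<lambda>z. D (t0, z)" "\<lambda>v. 0" z] by (metis (no_types))
    then show ?thesis by (simp add: g_def)
  qed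
  obtain \<delta> where \<delta>: "\<delta> > 0" "ball t0 \<delta> \<subseteq> X0 \<inter> I"
    by (metis IntI X0(1,2) I open_Int open_contains_ball)
  show ?thesis
  proof (rule that[OF \<delta>(1)])
    fix t z v assume t: "t \<in> ball t0 \<delta>" and z: "(z::'a) \<noteq> 0"
    have tI: "t \<in> I" "t \<in> X0 \<inter> I" using t \<delta> by auto
    let ?A = "frechet_derivative (\<lambda>z. D (t, z)) (at (sgn z))"
    have sz: "sgn z \<noteq> 0" "sgn z \<in> sphere 0 1" using z by (auto simp: sgn_zero_iff norm_sgn)
    have sl: "smooth_on (- {0}) (\<lambda>z. D (t, z))"
      by (rule smooth_on_slice[OF D tI(1) I(1)]) auto
    have "frechet_derivative (\<lambda>z. D (t, z)) (at z) v = ?A v"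
      using homog_derivative_scale[OF open_cone_punctured sl hom[OF tI(1)], of z "inverse (norm z)" v] z
      by (simp add: sgn_div_norm)
    moreover have "norm (?A v) \<le> e * norm v"
    proof -
      have "linear ?A"
        using smooth_on_has_derivative[OF sl, of "sgn z"] sz has_derivative_linear by blast
      then have "?A v = (\<Sum>b\<in>Basis. (v \<bullet> b) *\<^sub>R ?A b)" by (rule linear_apply_basis)
      then have "norm (?A v) \<le> (\<Sum>b\<in>Basis. \<bar>v \<bullet> b\<bar> * norm (?A b))"
        using norm_sum[of "\<lambda>b. (v \<bullet> b) *\<^sub>R ?A b" Basis] by simp
      also have "\<dots> \<le> (\<Sum>b\<in>Basis. norm v * norm (?A b))"
        by (intro sum_mono mult_right_mono Basis_le_norm) auto
      also have "\<dots> = norm v * g (t, sgn z)"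
        using fr[OF tI(1) sz(1)] by (simp add: g_def sum_distrib_left)
      also have "\<dots> \<le> norm v * e"
        using X0(3)[rule_format, OF tI(2) sz(2)] g0[OF sz(1)] by (intro mult_left_mono) (auto simp: dist_norm)
      finally show ?thesis by (simp add: mult.commute)
    qed
    ultimately show "norm (frechet_derivative (\<lambda>z. D (t, z)) (at z) v) \<le> e * norm v" by simp
  qed (use \<delta> in auto)
qed

text \<open>On a segment avoiding the origin this is the mean value inequality. On a segment through
  the origin, where \<open>D\<close> may fail to be differentiable, the norms of the end points add
  up to the length, and Euler's identity bounds \<open>D\<close> at each of them.\<close>

lemma homog_lipschitz:
  fixes D :: "'a::euclidean_space \<Rightarrow> 'b::euclidean_space"
  assumes D: "smooth_on (- {0}) D" "homog 1 (- {0}) D" "D 0 = 0"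
    and bd: "\<And>z v. z \<noteq> 0 \<Longrightarrow> norm (frechet_derivative D (at z) v) \<le> e * norm v"
  shows "norm (D x - D y) \<le> e * norm (x - y)"
proof (cases "0 \<in> closed_segment x y")
  case True
  have *: "norm (D z) \<le> e * norm z" for z
    using bd[of z z] homog_euler[OF D(1,2), of z] D(3) by (cases "z = 0") auto
  have "dist x y = dist x 0 + dist 0 y"
    using True between between_mem_segment by metis
  then have "norm (x - y) = norm x + norm y" by (simp add: dist_norm)
  then show ?thesis
    using norm_triangle_ineq4[of "D x" "D y"] *[of x] *[of y] by (simp add: algebra_simps)
next
  case False
  show ?thesis
  proof (rule differentiable_bound[OF convex_closed_segment])
    fix z assume "z \<in> closed_segment x y"
    with False have z: "z \<noteq> 0" by auto
    then show "(D has_derivative frechet_derivative D (at z)) (at z within closed_segment x y)"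
      using smooth_on_has_derivative[OF D(1)] has_derivative_at_withinI by blast
    show "onorm (frechet_derivative D (at z)) \<le> e"
      by (rule onorm_le) (rule bd[OF z])
  qed auto
qed

text \<open>A homogeneous perturbation of the identity with Lipschitz constant \<open>1/2\<close> is inverted by
  Banach's fixed point theorem.\<close>

lemma homog_perturbation_inverse:
  fixes D :: "real \<times> 'a::euclidean_space \<Rightarrow> 'a"
  assumes I: "open I" and D: "smooth_on (I \<times> - {0}) D"
    and hom: "\<And>t. t \<in> I \<Longrightarrow> homog 1 (- {0}) (\<lambda>z. D (t, z))"
    and bd: "\<And>t z v. t \<in> I \<Longrightarrow> z \<noteq> 0 \<Longrightarrow>
      norm (frechet_derivative (\<lambda>z. D (t, z)) (at z) v) \<le> 1/2 * norm v"
  obtains G where "smooth_on (I \<times> - {0}) G"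
    "\<And>t. t \<in> I \<Longrightarrow> homog 1 (- {0}) (\<lambda>w. G (t, w))"
    "\<And>t w. t \<in> I \<Longrightarrow> w \<noteq> 0 \<Longrightarrow> G (t, w) \<noteq> 0"
    "\<And>t w. t \<in> I \<Longrightarrow> w \<noteq> 0 \<Longrightarrow> G (t, w) + D (t, G (t, w)) = w"
    "\<And>t z. t \<in> I \<Longrightarrow> z \<noteq> 0 \<Longrightarrow> z + D (t, z) \<noteq> 0"
    "\<And>t z. t \<in> I \<Longrightarrow> z \<noteq> 0 \<Longrightarrow> G (t, z + D (t, z)) = z"
proof -
  \<comment> \<open>The value 0 at the origin gives a contraction on the whole, complete space, as
    the fixed point theorem requires.\<close>
  define D' where "D' = (\<lambda>t z. if z = 0 then 0 else D (t, z))"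
  have o: "open (I \<times> - {0::'a})" using I by (simp add: open_Times open_Compl)
  have lip: "norm (D' t x - D' t y) \<le> 1/2 * norm (x - y)" if t: "t \<in> I" for t x y
  proof (rule homog_lipschitz)
    have "smooth_on (- {0}) (\<lambda>z. D (t, z))" by (rule smooth_on_slice[OF D t I]) auto
    then show "smooth_on (- {0}) (D' t)" by (rule smooth_on_cong[rotated]) (auto simp: D'_def)
    show "homog 1 (- {0}) (D' t)" using hom[OF t] by (auto simp: homog_def D'_def)
    fix z v assume z: "(z::'a) \<noteq> 0"
    have "frechet_derivative (\<lambda>z. D (t, z)) (at z) = frechet_derivative (D' t) (at z)"
      by (rule frechet_derivative_transform_within_open[of _ _ "- {0}"])
        (use smooth_on_slice_derivative[OF D, of t z] z t in \<open>auto simp: D'_def differentiable_def\<close>)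
    then show "norm (frechet_derivative (D' t) (at z) v) \<le> 1/2 * norm v" using bd[OF t z, of v] by simp
  qed (simp add: D'_def)
  have D'0: "D' t 0 = 0" for t by (simp add: D'_def)
  have nz: "z + D' t z \<noteq> 0" if "t \<in> I" "z \<noteq> 0" for t z
  proof
    assume "z + D' t z = 0"
    then have "norm z = norm (D' t z)" by (metis add_eq_0_iff norm_minus_cancel)
    then show False using lip[OF that(1), of z 0] that(2) by (simp add: D'0)
  qed
  have ex1: "\<exists>!z. w - D' t z = z" if t: "t \<in> I" for t w
    by (rule banach_fix_type[of "1/2"]) (use lip[OF t] in \<open>auto simp: dist_norm norm_minus_commute\<close>)
  define G where "G = (\<lambda>p. THE z. snd p - D' (fst p) z = z)"
  have G1: "G (t, w) + D' t (G (t, w)) = w" if "t \<in> I" for t w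
  proof -
    have "w - D' t (G (t, w)) = G (t, w)" using theI'[OF ex1[OF that, of w]] by (simp add: G_def)
    then show ?thesis by (metis diff_add_cancel)
  qed
  have G2: "G (t, z + D' t z) = z" if "t \<in> I" for t z
    unfolding G_def using the1_equality[OF ex1[OF that, of "z + D' t z"], of z] by simp
  have Gnz: "G (t, w) \<noteq> 0" if "t \<in> I" "w \<noteq> 0" for t w
    using G1[OF that(1), of w] that(2) D'0 by auto
  \<comment> \<open>Carrying the parameter along as a component makes the inverse smooth jointly in
    \<open>t\<close> and \<open>w\<close>.\<close>
  define \<Theta> where "\<Theta> = (\<lambda>p. (fst p, snd p + D p))"
  have \<Theta>: "smooth_on (I \<times> - {0}) \<Theta>" unfolding \<Theta>_def by (intro smooth_intros o D)
  have \<Theta>': "\<Theta> (t, z) = (t, z + D' t z)" if "z \<noteq> 0" for t z by (simp add: \<Theta>_def D'_def that)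
  have img: "\<Theta> ` (I \<times> - {0}) = I \<times> - {0}"
  proof (intro equalityI subsetI)
    fix p assume "p \<in> I \<times> - {0::'a}"
    then have "p = \<Theta> (fst p, G p)" "(fst p, G p) \<in> I \<times> - {0}"
      by (cases p; simp add: \<Theta>' Gnz G1)+
    then show "p \<in> \<Theta> ` (I \<times> - {0})" by blast
  qed (auto simp: \<Theta>' nz)
  have "smooth_on (\<Theta> ` (I \<times> - {0})) (\<lambda>p. (fst p, G p))"
  proof (rule smooth_on_inverse_map(2)[OF o \<Theta>])
    fix p u assume p: "p \<in> I \<times> - {0::'a}" and u: "frechet_derivative \<Theta> (at p) u = 0"
    obtain t z where tz: "p = (t, z)" "t \<in> I" "z \<noteq> 0" using p by auto
    have "(\<Theta> has_derivative (\<lambda>u. (fst u, snd u + frechet_derivative D (at p) u))) (at p)"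
      unfolding \<Theta>_def
      by (auto intro!: derivative_eq_intros smooth_on_has_derivative[OF D p])
    then have "frechet_derivative \<Theta> (at p) u = (fst u, snd u + frechet_derivative D (at p) u)"
      by (simp add: frechet_derivative_at[symmetric])
    with u have u0: "fst u = 0" "snd u + frechet_derivative D (at p) u = 0" by (auto simp: zero_prod_def)
    then have "u = (0, snd u)" by (cases u) auto
    moreover have "frechet_derivative (\<lambda>z. D (t, z)) (at z) = (\<lambda>v. frechet_derivative D (at (t, z)) (0, v))"
      by (rule frechet_derivative_at[symmetric, OF smooth_on_slice_derivative[OF D]]) (use tz in auto)
    \<comment> \<open>A kernel vector of the derivative of \<open>\<Theta>\<close> has no time
      component, and its space component has the same length as its image under the derivative of
      \<open>D\<close>, which is at most half as long.\<close>
    ultimately have "norm (frechet_derivative D (at p) u) \<le> 1/2 * norm (snd u)"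
      using bd[OF tz(2,3), of "snd u"] tz(1) by metis
    moreover have "norm (frechet_derivative D (at p) u) = norm (snd u)"
      using u0(2) by (metis add_eq_0_iff norm_minus_cancel)
    ultimately have "snd u = 0" by simp
    then show "u = 0" using \<open>u = (0, snd u)\<close> by (simp add: zero_prod_def)
  qed (auto simp: \<Theta>' G2)
  then have sG: "smooth_on (I \<times> - {0}) G"
    using smooth_on_snd[OF o] by (fastforce simp: img)
  have DD: "D (t, z) = D' t z" if "z \<noteq> 0" for t z using that by (simp add: D'_def)
  show ?thesis
  proof (rule that[OF sG])
    show "homog 1 (- {0}) (\<lambda>w. G (t, w))" if t: "t \<in> I" for t
      unfolding homog_def
    proof (intro ballI allI impI)
      fix w :: 'a and r :: real assume w: "w \<in> - {0}" "r > 0"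
      define z where "z = G (t, w)"
      have z: "z \<noteq> 0" "z + D' t z = w" using Gnz[OF t] G1[OF t] w by (auto simp: z_def)
      have "D' t (r *\<^sub>R z) = r *\<^sub>R D' t z"
        using hom[OF t] z w by (auto simp: homog_def D'_def)
      then have "r *\<^sub>R w = r *\<^sub>R z + D' t (r *\<^sub>R z)" using z(2) by (simp add: algebra_simps flip: z(2))
      then show "G (t, r *\<^sub>R w) = r ^ 1 *\<^sub>R G (t, w)"
        using G2[OF t, of "r *\<^sub>R z"] by (simp add: z_def)
    qed
  qed (use Gnz G1 G2 nz DD in auto)
qed

section \<open>Smooth maps on arbitrary subsets\<close>

lemma smooth_map_onE:
  assumes "smooth_map_on X f" "x \<in> X"
  obtains W F where "open W" "x \<in> W" "smooth_on W F" "\<forall>z\<in>W \<inter> X. F z = f z"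
proof -
  from bspec[OF assms(1)[unfolded smooth_map_on_def] assms(2)]
  obtain W F where "open W" "x \<in> W" "\<forall>k. Ck_on k W F" "\<forall>z\<in>W \<inter> X. F z = f z" by (elim exE conjE)
  then show thesis by (intro that[of W F]) (auto simp: smooth_on_def)
qed

lemma smooth_map_on_localI:
  assumes "\<And>x. x \<in> X \<Longrightarrow> \<exists>W F. open W \<and> x \<in> W \<and> smooth_on W F \<and> (\<forall>z\<in>W \<inter> X. F z = f z)"
  shows "smooth_map_on X f"
  unfolding smooth_map_on_def using assms unfolding smooth_on_def by (rule ballI)

lemma smooth_map_onI:
  assumes "open W" "X \<subseteq> W" "smooth_on W F" "\<And>z. z \<in> X \<Longrightarrow> F z = f z"
  shows "smooth_map_on X f"
  by (rule smooth_map_on_localI, intro exI[of _ W] exI[of _ F]) (use assms in auto)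

lemma smooth_map_on_cong:
  assumes "smooth_map_on X f" "\<And>z. z \<in> X \<Longrightarrow> f z = g z" shows "smooth_map_on X g"
proof (rule smooth_map_on_localI)
  fix x assume "x \<in> X"
  from smooth_map_onE[OF assms(1) this]
  obtain W F where "open W" "x \<in> W" "smooth_on W F" "\<forall>z\<in>W \<inter> X. F z = f z" .
  then show "\<exists>W F. open W \<and> x \<in> W \<and> smooth_on W F \<and> (\<forall>z\<in>W \<inter> X. F z = g z)"
    by (intro exI[of _ W] exI[of _ F]) (simp add: assms(2))
qed

lemma smooth_map_on_subset:
  assumes "smooth_map_on X f" "Y \<subseteq> X" shows "smooth_map_on Y f"
proof (rule smooth_map_on_localI)
  fix x assume "x \<in> Y"
  with assms(2) have "x \<in> X" by blast
  from smooth_map_onE[OF assms(1) this]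
  obtain W F where "open W" "x \<in> W" "smooth_on W F" "\<forall>z\<in>W \<inter> X. F z = f z" .
  then show "\<exists>W F. open W \<and> x \<in> W \<and> smooth_on W F \<and> (\<forall>z\<in>W \<inter> Y. F z = f z)"
    using assms(2) by (intro exI[of _ W] exI[of _ F]) auto
qed

text \<open>The local extensions of \<open>f\<close> are evaluated only at values of
  \<open>g\<close>, hence in \<open>X\<close>, where they agree with \<open>f\<close>. With
  \<open>g = sgn\<close> this turns maps on part of the sphere into smooth maps on an open
  cone.\<close>

lemma smooth_map_on_compose_smooth_on:
  assumes "open W" "smooth_map_on X f" "smooth_on W g" "g ` W \<subseteq> X"
  shows "smooth_on W (\<lambda>z. f (g z))"
proof (rule smooth_on_local)
  fix x assume x: "x \<in> W"
  then have "g x \<in> X" using assms(4) by auto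
  from smooth_map_onE[OF assms(2) this]
  obtain W' F where F: "open W'" "g x \<in> W'" "smooth_on W' F" "\<forall>z\<in>W' \<inter> X. F z = f z" .
  define W2 where "W2 = W \<inter> g -` W'"
  have o: "open W2"
    unfolding W2_def using continuous_open_preimage[OF smooth_on_continuous[OF assms(3)] assms(1) F(1)] .
  have "smooth_on W2 (\<lambda>z. F (g z))"
    by (rule smooth_on_compose[OF o F(1,3) smooth_on_subset[OF assms(3)]])
      (auto simp: W2_def)
  then have "smooth_on W2 (\<lambda>z. f (g z))"
    by (rule smooth_on_cong[OF o]) (use F(4) assms(4) in \<open>auto simp: W2_def\<close>)
  then show "\<exists>W'. open W' \<and> x \<in> W' \<and> smooth_on W' (\<lambda>z. f (g z))"
    using o x F(2) by (intro exI[of _ W2]) (auto simp: W2_def)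
qed

lemma smooth_map_on_compose:
  assumes g: "smooth_map_on Y g" and f: "smooth_map_on X f" and sub: "f ` X \<subseteq> Y"
  shows "smooth_map_on X (\<lambda>x. g (f x))"
proof (rule smooth_map_on_localI)
  fix x assume x: "x \<in> X"
  then have fx: "f x \<in> Y" using sub by blast
  obtain W F where F: "open W" "x \<in> W" "smooth_on W F" "\<forall>z\<in>W \<inter> X. F z = f z"
    using smooth_map_onE[OF f x] .
  obtain W' G where G: "open W'" "f x \<in> W'" "smooth_on W' G" "\<forall>z\<in>W' \<inter> Y. G z = g z"
    using smooth_map_onE[OF g fx] .
  define W2 where "W2 = W \<inter> F -` W'"
  have o: "open W2"
    unfolding W2_def using continuous_open_preimage[OF smooth_on_continuous[OF F(3)] F(1) G(1)] .
  have "smooth_on W2 (\<lambda>z. G (F z))"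
    by (rule smooth_on_compose[OF o G(1) G(3) smooth_on_subset[OF F(3)]]) (auto simp: W2_def)
  moreover have "\<forall>z\<in>W2 \<inter> X. G (F z) = g (f z)"
  proof
    fix z assume z: "z \<in> W2 \<inter> X"
    then have "F z = f z" "F z \<in> W'" "f z \<in> Y" using F(4) sub by (auto simp: W2_def)
    then show "G (F z) = g (f z)" using G(4) by auto
  qed
  moreover have "x \<in> W2" using x F(2,4) G(2) by (simp add: W2_def)
  ultimately show "\<exists>W F. open W \<and> x \<in> W \<and> smooth_on W F \<and> (\<forall>z\<in>W \<inter> X. F z = g (f z))"
    using o by (intro exI[of _ W2] exI[of _ "\<lambda>z. G (F z)"] conjI)
qed

lemma smooth_map_on_continuous: assumes "smooth_map_on X f" shows "continuous_on X f"
  unfolding continuous_on_eq_continuous_within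
proof
  fix x assume x: "x \<in> X"
  obtain W F where F: "open W" "x \<in> W" "smooth_on W F" "\<forall>z\<in>W \<inter> X. F z = f z"
    using smooth_map_onE[OF assms x] .
  have "isCont F x" using smooth_on_continuous[OF F(3)] F(1,2) continuous_on_eq_continuous_at by blast
  then have "continuous (at x within X) F" by (rule continuous_at_imp_continuous_at_within)
  then show "continuous (at x within X) f"
    by (rule continuous_transform_within_openin[OF _ openin_open_Int[OF F(1)]]) (use F x in auto)
qed

section \<open>Contact embeddings and their symplectic lifts\<close>

lemma alpha_st_eq: "alpha_st p v = (fst p \<bullet> snd v - snd p \<bullet> fst v) / 2"
  by (simp add: alpha_st_def inner_vec_def sum_subtractf)

text \<open>Multiplication by i under \<open>x + i y\<close>. At a unit vector \<open>p\<close>,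
  \<open>symp_J p\<close> is half the Reeb vector of the contact form.\<close>

definition symp_J :: "(real^'n) \<times> (real^'n) \<Rightarrow> (real^'n) \<times> (real^'n)" where
  "symp_J p = (- snd p, fst p)"

lemma bounded_linear_symp_J: "bounded_linear symp_J"
  unfolding symp_J_def
  by (intro bounded_linear_Pair bounded_linear_minus bounded_linear_fst bounded_linear_snd)

lemma alpha_st_symp_J: "alpha_st p (symp_J v) = (p \<bullet> v) / 2"
  by (simp add: alpha_st_eq symp_J_def inner_prod_def)

text \<open>As a form in both arguments, \<open>alpha_st\<close> is half the standard symplectic
  form. One function thus serves as Liouville form, with the base point in the first slot, and as
  symplectic pairing of two vectors.\<close>

lemma bounded_bilinear_alpha_st: "bounded_bilinear alpha_st"
proof -
  have eq: "alpha_st = (\<lambda>p v. p \<bullet> (- (1/2)) *\<^sub>R symp_J (v :: (real^'n) \<times> (real^'n)))"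
    by (simp add: fun_eq_iff alpha_st_eq symp_J_def inner_prod_def inner_commute field_simps)
  show ?thesis
    unfolding eq
    by (intro bounded_bilinear.comp[OF bounded_bilinear_inner bounded_linear_ident]
        bounded_linear_const_scaleR bounded_linear_symp_J)
qed

lemmas smooth_on_alpha_st [smooth_intros] = smooth_on_bilinear[OF bounded_bilinear_alpha_st]
lemmas smooth_on_symp_J [smooth_intros] = smooth_on_linear_compose[OF _ bounded_linear_symp_J]

lemmas alpha_st_simps =
  bounded_bilinear.add_left[OF bounded_bilinear_alpha_st]
  bounded_bilinear.add_right[OF bounded_bilinear_alpha_st]
  bounded_bilinear.diff_left[OF bounded_bilinear_alpha_st]
  bounded_bilinear.diff_right[OF bounded_bilinear_alpha_st]
  bounded_bilinear.scaleR_left[OF bounded_bilinear_alpha_st]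
  bounded_bilinear.scaleR_right[OF bounded_bilinear_alpha_st]
  bounded_bilinear.minus_left[OF bounded_bilinear_alpha_st]
  bounded_bilinear.minus_right[OF bounded_bilinear_alpha_st]
  bounded_bilinear.zero_left[OF bounded_bilinear_alpha_st]
  bounded_bilinear.zero_right[OF bounded_bilinear_alpha_st]

lemma alpha_st_self [simp]: "alpha_st p p = 0"
  by (simp add: alpha_st_eq inner_commute)

lemma alpha_st_flip: "alpha_st p v = - alpha_st v p"
  by (simp add: alpha_st_eq inner_commute field_simps)

lemma alpha_st_nondegenerate:
  assumes "\<And>u. alpha_st u X = alpha_st u Y" shows "X = Y"
proof -
  have "alpha_st u (X - Y) = 0" for u using assms by (simp add: alpha_st_simps)
  from this[of "symp_J (X - Y)"] have "(X - Y) \<bullet> (X - Y) = 0"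
    by (subst (asm) alpha_st_flip) (simp add: alpha_st_symp_J)
  then show ?thesis by simp
qed

text \<open>Only the shape of the radial term matters: \<open>alpha_st y\<close> annihilates it, and
  tangency to the sphere determines \<open>l u\<close> in the case where its value is
  wanted.\<close>

lemma sgn_has_derivative:
  fixes y :: "'a::euclidean_space"
  assumes "y \<noteq> 0"
  obtains l where "linear l"
    "(sgn has_derivative (\<lambda>u. l u *\<^sub>R y + inverse (norm y) *\<^sub>R u)) (at y)"
proof -
  have "smooth_on (- {0::'a}) (\<lambda>y. inverse (norm y))" by (intro smooth_intros) auto
  from smooth_on_has_derivative[OF this, of y] assms
  have d: "((\<lambda>y. inverse (norm y)) has_derivative frechet_derivative (\<lambda>y. inverse (norm y)) (at y)) (at y)" by auto
  have "((\<lambda>y. inverse (norm y) *\<^sub>R y) has_derivative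
      (\<lambda>u. frechet_derivative (\<lambda>y. inverse (norm y)) (at y) u *\<^sub>R y + inverse (norm y) *\<^sub>R u)) (at y)"
    by (rule has_derivative_eq_rhs[OF has_derivative_scaleR[OF d has_derivative_ident]]) (simp add: add.commute)
  then show thesis
    using that[OF has_derivative_linear[OF d]] by (simp add: sgn_div_norm[abs_def])
qed

lemma unit_derivative_orthogonal:
  assumes "(g has_derivative g') (at z)" "open W" "z \<in> W" "\<And>z. z \<in> W \<Longrightarrow> norm (g z) = 1"
  shows "g z \<bullet> g' v = 0"
proof -
  have 1: "((\<lambda>z. g z \<bullet> g z) has_derivative (\<lambda>v. g z \<bullet> g' v + g' v \<bullet> g z)) (at z)"
    using assms(1) by (auto intro!: derivative_eq_intros)
  have "((\<lambda>z. 1::real) has_derivative (\<lambda>v. 0)) (at z)" by simp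
  then have "((\<lambda>z. g z \<bullet> g z) has_derivative (\<lambda>v. 0)) (at z)"
    by (rule has_derivative_transform_within_open[OF _ assms(2,3)])
      (use assms(4) in \<open>auto simp: norm_eq_1\<close>)
  from fun_cong[OF has_derivative_unique[OF 1 this], of v] show ?thesis
    by (simp add: inner_commute)
qed

text \<open>The radial part disappears because \<open>alpha_st y y = 0\<close>, and two factors
  \<open>inverse (norm y)\<close> remain. Every conformal factor computed below originates
  here.\<close>

lemma sgn_derivative_alpha_st:
  assumes "y \<noteq> 0"
  shows "alpha_st (sgn y) (frechet_derivative sgn (at y) u) = alpha_st y u / (norm y)\<^sup>2"
proof -
  obtain l where "(sgn has_derivative (\<lambda>u. l u *\<^sub>R y + inverse (norm y) *\<^sub>R u)) (at y)"
    using sgn_has_derivative[OF assms] .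
  then have "frechet_derivative sgn (at y) u = l u *\<^sub>R y + inverse (norm y) *\<^sub>R u"
    by (simp add: frechet_derivative_at[symmetric])
  then show ?thesis
    by (simp add: sgn_div_norm alpha_st_simps power2_eq_square divide_inverse)
qed

lemma sgn_derivative_tangent:
  fixes y :: "'a::euclidean_space"
  assumes "norm y = 1" "y \<bullet> u = 0"
  shows "frechet_derivative sgn (at y) u = u"
proof -
  have y: "y \<noteq> 0" using assms by auto
  obtain l where l: "(sgn has_derivative (\<lambda>u. l u *\<^sub>R y + inverse (norm y) *\<^sub>R u)) (at y)"
    using sgn_has_derivative[OF y] .
  have "sgn y \<bullet> (l u *\<^sub>R y + inverse (norm y) *\<^sub>R u) = 0"
    by (rule unit_derivative_orthogonal[OF l, of "- {0}"]) (use y in \<open>auto simp: norm_sgn\<close>)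
  then have "l u = 0" using assms by (simp add: sgn_div_norm inner_add_right dot_square_norm)
  then show ?thesis using l assms by (simp add: frechet_derivative_at[symmetric])
qed

lemma sgn_derivative_kernel:
  fixes y :: "'a::euclidean_space"
  assumes "y \<noteq> 0" "frechet_derivative sgn (at y) u = 0"
  obtains r where "u = r *\<^sub>R y"
proof -
  obtain l where l: "(sgn has_derivative (\<lambda>u. l u *\<^sub>R y + inverse (norm y) *\<^sub>R u)) (at y)"
    using sgn_has_derivative[OF assms(1)] .
  then have "l u *\<^sub>R y + inverse (norm y) *\<^sub>R u = 0"
    using assms(2) by (simp add: frechet_derivative_at[symmetric])
  then have "inverse (norm y) *\<^sub>R u = - (l u *\<^sub>R y)" by (simp add: add_eq_0_iff)
  then have "norm y *\<^sub>R (inverse (norm y) *\<^sub>R u) = norm y *\<^sub>R - (l u *\<^sub>R y)" by simp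
  then have "u = (- (norm y * l u)) *\<^sub>R y" using assms(1) by simp
  then show thesis by (rule that)
qed

section \<open>Differentials of maps between parts of the sphere\<close>

lemma sgn_unit [simp]: "norm (y::'a::real_normed_vector) = 1 \<Longrightarrow> sgn y = y"
  by (simp add: sgn_div_norm)

lemma open_cone_sgn_sphere: "open_cone V \<Longrightarrow> z \<in> V \<Longrightarrow> sgn z \<in> sphere 0 1 \<inter> V"
  using open_coneD(2)[of V z] by (simp add: open_cone_sgn norm_sgn)

lemma smooth_map_on_sgn:
  assumes "open_cone V" "smooth_map_on (sphere 0 1 \<inter> V) f"
  shows "smooth_on V (\<lambda>z. f (sgn z))"
proof (rule smooth_map_on_compose_smooth_on[OF open_coneD(1)[OF assms(1)] assms(2)])
  show "smooth_on V sgn"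
    by (rule smooth_on_sgn[OF open_coneD(1)[OF assms(1)] smooth_on_ident[OF open_coneD(1)[OF assms(1)]]
        open_coneD(2)[OF assms(1)]])
  show "sgn ` V \<subseteq> sphere 0 1 \<inter> V" using open_cone_sgn_sphere[OF assms(1)] by blast
qed

lemma sphere_differential_has_derivative:
  assumes "open_cone V" "smooth_map_on (sphere 0 1 \<inter> V) f" "p \<in> V"
  shows "((\<lambda>z. f (sgn z)) has_derivative sphere_differential f p) (at p)"
  using smooth_on_has_derivative[OF smooth_map_on_sgn[OF assms(1,2)] assms(3)]
  by (simp add: sphere_differential_def[abs_def])

lemma sphere_differential_tangent:
  assumes "open_cone V" "smooth_map_on (sphere 0 1 \<inter> V) f" "f ` (sphere 0 1 \<inter> V) \<subseteq> sphere 0 1"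
    and "p \<in> sphere 0 1 \<inter> V"
  shows "sphere_differential f p v \<in> tangent_sphere (f p)"
proof -
  have p: "p \<in> V" "norm p = 1" using assms(4) by auto
  have "f (sgn p) \<bullet> sphere_differential f p v = 0"
    by (rule unit_derivative_orthogonal[OF sphere_differential_has_derivative[OF assms(1,2) p(1)]
        open_coneD(1)[OF assms(1)] p(1)])
      (use open_cone_sgn_sphere[OF assms(1)] assms(3) in \<open>auto simp: image_subset_iff\<close>)
  then show ?thesis using p by (simp add: tangent_sphere_def)
qed

text \<open>The chain rule for the extensions constant on rays. The \<open>sgn\<close> that arises
  between \<open>f\<close> and \<open>g\<close> acts trivially, since \<open>g\<close> takes values
  in the unit sphere.\<close>

lemma sphere_differential_compose:
  assumes V: "open_cone V" and f: "smooth_map_on (sphere 0 1 \<inter> V) f"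
    and g: "smooth_map_on (sphere 0 1 \<inter> V) g" "g ` (sphere 0 1 \<inter> V) \<subseteq> sphere 0 1 \<inter> V"
    and p: "p \<in> sphere 0 1 \<inter> V"
  shows "sphere_differential (\<lambda>p. f (g p)) p v = sphere_differential f (g p) (sphere_differential g p v)"
proof -
  have p': "p \<in> V" "norm p = 1" "g p \<in> V" using p g by auto
  have "((\<lambda>z. f (sgn (g (sgn z)))) has_derivative (\<lambda>v. sphere_differential f (g p) (sphere_differential g p v))) (at p)"
    by (rule has_derivative_compose[OF sphere_differential_has_derivative[OF V g(1)]])
      (use sphere_differential_has_derivative[OF V f] p' in auto)
  then have "((\<lambda>z. f (g (sgn z))) has_derivative (\<lambda>v. sphere_differential f (g p) (sphere_differential g p v))) (at p)"
  proof (rule has_derivative_transform_within_open[OF _ open_coneD(1)[OF V] p'(1)])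
    fix z assume z: "z \<in> V"
    then have "sgn z \<in> sphere 0 1 \<inter> V" by (rule open_cone_sgn_sphere[OF V])
    then have "g (sgn z) \<in> sphere 0 1 \<inter> V" using g(2) by blast
    then have "norm (g (sgn z)) = 1" by simp
    then show "f (sgn (g (sgn z))) = f (g (sgn z))" by simp
  qed
  from fun_cong[OF frechet_derivative_at[OF this], of v] show ?thesis
    by (simp add: sphere_differential_def)
qed

lemma sphere_differential_cong:
  assumes "open_cone V" "\<And>p. p \<in> sphere 0 1 \<inter> V \<Longrightarrow> f p = g p" "p \<in> V"
    and f: "smooth_map_on (sphere 0 1 \<inter> V) f"
  shows "sphere_differential f p = sphere_differential g p"
proof -
  have "((\<lambda>z. g (sgn z)) has_derivative sphere_differential f p) (at p)"
    by (rule has_derivative_transform_within_open[OF sphere_differential_has_derivative[OF assms(1) f assms(3)]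
        open_coneD(1)[OF assms(1)] assms(3) assms(2)[OF open_cone_sgn_sphere[OF assms(1)]]])
  then have "sphere_differential f p = frechet_derivative (\<lambda>z. g (sgn z)) (at p)"
    by (rule frechet_derivative_at)
  then show ?thesis by (simp add: sphere_differential_def fun_eq_iff)
qed

lemma contact_embeddingD:
  assumes "contact_embedding U f"
  shows "f ` U \<subseteq> U" "inj_on f U" "smooth_map_on U f" "smooth_map_on (f ` U) (inv_into U f)"
    "\<And>p. p \<in> U \<Longrightarrow> sphere_differential f p ` xi_st p = xi_st (f p)"
  using assms by (auto simp: contact_embedding_def smooth_embedding_def)

lemma contact_embedding_compose:
  assumes V: "open_cone V" and f: "contact_embedding (sphere 0 1 \<inter> V) f"
    and g: "contact_embedding (sphere 0 1 \<inter> V) g"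
  shows "contact_embedding (sphere 0 1 \<inter> V) (\<lambda>p. f (g p))"
proof -
  let ?U = "sphere 0 1 \<inter> V"
  note F = contact_embeddingD[OF f] and G = contact_embeddingD[OF g]
  have inj: "inj_on (\<lambda>p. f (g p)) ?U"
    using comp_inj_on[OF G(2) inj_on_subset[OF F(2) G(1)]] by (simp add: comp_def)
  have inv: "inv_into ?U g (inv_into ?U f y) = inv_into ?U (\<lambda>p. f (g p)) y"
    if "y \<in> (\<lambda>p. f (g p)) ` ?U" for y
  proof -
    obtain x where x: "x \<in> ?U" "y = f (g x)" using \<open>y \<in> _\<close> by blast
    have gx: "g x \<in> ?U" using G(1) x(1) by blast
    have "inv_into ?U f y = g x" unfolding x(2) by (rule inv_into_f_f[OF F(2) gx])
    moreover have "inv_into ?U g (g x) = x" by (rule inv_into_f_f[OF G(2) x(1)])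
    moreover have "inv_into ?U (\<lambda>p. f (g p)) y = x"
      unfolding x(2) by (rule inv_into_f_f[OF inj x(1)])
    ultimately show ?thesis by simp
  qed
  have "smooth_map_on ((\<lambda>p. f (g p)) ` ?U) (\<lambda>y. inv_into ?U g (inv_into ?U f y))"
  proof (rule smooth_map_on_compose[OF G(4) smooth_map_on_subset[OF F(4)]])
    show "inv_into ?U f ` (\<lambda>p. f (g p)) ` ?U \<subseteq> g ` ?U"
      using inv_into_f_f[OF F(2)] G(1) by (auto simp: image_subset_iff)
  qed (use G(1) in auto)
  then have "smooth_map_on ((\<lambda>p. f (g p)) ` ?U) (inv_into ?U (\<lambda>p. f (g p)))"
    by (rule smooth_map_on_cong) (rule inv)
  moreover have "sphere_differential (\<lambda>p. f (g p)) p ` xi_st p = xi_st (f (g p))" if p: "p \<in> ?U" for p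
  proof -
    have "sphere_differential (\<lambda>p. f (g p)) p ` xi_st p = sphere_differential f (g p) ` sphere_differential g p ` xi_st p"
      using sphere_differential_compose[OF V F(3) G(3) G(1) p] by (auto simp: image_image)
    also have "\<dots> = xi_st (f (g p))" unfolding G(5)[OF p] by (rule F(5)) (use G(1) p in blast)
    finally show ?thesis .
  qed
  ultimately show ?thesis
    unfolding contact_embedding_def smooth_embedding_def
    using inj smooth_map_on_compose[OF F(3) G(3,1)] F(1) G(1) by (auto simp: image_subset_iff)
qed

text \<open>The cone with the one-form \<open>alpha_st\<close> is the symplectization of its trace
  on the sphere: at \<open>r p\<close>, with \<open>p\<close> a unit vector, the form is
  \<open>r^2\<close> times the contact form. The last condition says that \<open>f\<close> pulls
  this Liouville form back to itself.\<close>

definition symplectic_lift ::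
  "((real^'n) \<times> (real^'n)) set \<Rightarrow> ((real^'n) \<times> (real^'n) \<Rightarrow> (real^'n) \<times> (real^'n)) \<Rightarrow> bool" where
  "symplectic_lift V f \<longleftrightarrow> smooth_on V f \<and> homog 1 V f \<and> f ` V \<subseteq> V \<and>
     (\<forall>z\<in>V. \<forall>v. alpha_st (f z) (frechet_derivative f (at z) v) = alpha_st z v)"

text \<open>Since \<open>f\<close> preserves \<open>alpha_st\<close> and radial projection divides
  it by the squared norm, the conformal factor is \<open>1 / (norm (f p))^2\<close>. By homogeneity
  \<open>sgn (f z)\<close> depends only on the direction of \<open>z\<close>, so
  \<open>sphere_differential\<close> may be computed from \<open>f\<close> itself.\<close>

lemma symplectic_lift_sphere:
  assumes V: "open_cone V" and f: "symplectic_lift V f"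
  shows "smooth_map_on (sphere 0 1 \<inter> V) (\<lambda>p. sgn (f p))"
    "(\<lambda>p. sgn (f p)) ` (sphere 0 1 \<inter> V) \<subseteq> sphere 0 1 \<inter> V"
    "\<And>p v. p \<in> sphere 0 1 \<inter> V \<Longrightarrow>
      alpha_st (sgn (f p)) (sphere_differential (\<lambda>p. sgn (f p)) p v) = alpha_st p v / (norm (f p))\<^sup>2"
    "\<And>p. p \<in> sphere 0 1 \<inter> V \<Longrightarrow> sphere_differential (\<lambda>p. sgn (f p)) p ` xi_st p \<subseteq> xi_st (sgn (f p))"
    "\<And>z. z \<in> V \<Longrightarrow> sgn (f (sgn z)) = sgn (f z)"
proof -
  have sf: "smooth_on V f" "homog 1 V f" "\<And>z. z \<in> V \<Longrightarrow> f z \<in> V"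
    and a: "\<And>z v. z \<in> V \<Longrightarrow> alpha_st (f z) (frechet_derivative f (at z) v) = alpha_st z v"
    using f by (auto simp: symplectic_lift_def)
  have nz: "f z \<noteq> 0" if "z \<in> V" for z using open_coneD(2)[OF V sf(3)[OF that]] .
  have ss: "smooth_on V (\<lambda>z. sgn (f z))"
    by (intro smooth_intros open_coneD(1)[OF V] sf nz)
  show sm: "smooth_map_on (sphere 0 1 \<inter> V) (\<lambda>p. sgn (f p))"
    by (rule smooth_map_onI[OF open_coneD(1)[OF V] _ ss]) auto
  show im: "(\<lambda>p. sgn (f p)) ` (sphere 0 1 \<inter> V) \<subseteq> sphere 0 1 \<inter> V"
  proof (rule image_subsetI)
    fix p assume "p \<in> sphere 0 1 \<inter> V"
    then have "f p \<in> V" using sf(3) by blast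
    then show "sgn (f p) \<in> sphere 0 1 \<inter> V" by (rule open_cone_sgn_sphere[OF V])
  qed
  show hs: "sgn (f (sgn z)) = sgn (f z)" if "z \<in> V" for z
    using homog_sgn[OF sf(2) that open_coneD(2)[OF V that]] sgn_scaleR_pos[of "norm z" "f (sgn z)"]
      open_coneD(2)[OF V that] by simp
  show al: "alpha_st (sgn (f p)) (sphere_differential (\<lambda>p. sgn (f p)) p v) = alpha_st p v / (norm (f p))\<^sup>2"
    if p: "p \<in> sphere 0 1 \<inter> V" for p v
  proof -
    have pV: "p \<in> V" using p by auto
    have "(sgn has_derivative frechet_derivative sgn (at (f p))) (at (f p))"
    proof -
      obtain l where "(sgn has_derivative (\<lambda>u. l u *\<^sub>R f p + inverse (norm (f p)) *\<^sub>R u)) (at (f p))"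
        using sgn_has_derivative[OF nz[OF pV]] .
      from iffD1[OF frechet_derivative_works differentiableI[OF this]] show ?thesis .
    qed
    from has_derivative_compose[OF smooth_on_has_derivative[OF sf(1) pV] this]
    have "((\<lambda>z. sgn (f (sgn z))) has_derivative
        (\<lambda>v. frechet_derivative sgn (at (f p)) (frechet_derivative f (at p) v))) (at p)"
      by (rule has_derivative_transform_within_open[OF _ open_coneD(1)[OF V] pV]) (simp add: hs)
    then have "sphere_differential (\<lambda>p. sgn (f p)) p v =
        frechet_derivative sgn (at (f p)) (frechet_derivative f (at p) v)"
      by (simp add: sphere_differential_def frechet_derivative_at[symmetric])
    then show ?thesis using sgn_derivative_alpha_st[OF nz[OF pV]] a[OF pV] by simp
  qed
  show "sphere_differential (\<lambda>p. sgn (f p)) p ` xi_st p \<subseteq> xi_st (sgn (f p))"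
    if p: "p \<in> sphere 0 1 \<inter> V" for p
    using sphere_differential_tangent[OF V sm _ p] im al[OF p] by (auto simp: xi_st_def)
qed

lemma symplectic_lift_inverse:
  assumes V: "open_cone V" and f: "symplectic_lift V f"
    and f': "smooth_on V f'" "f' ` V \<subseteq> V" "\<And>z. z \<in> V \<Longrightarrow> f' (f z) = z" "\<And>z. z \<in> V \<Longrightarrow> f (f' z) = z"
  shows "symplectic_lift V f'"
proof -
  have sf: "smooth_on V f" "homog 1 V f" "\<And>z. z \<in> V \<Longrightarrow> f z \<in> V"
    and a: "\<And>z v. z \<in> V \<Longrightarrow> alpha_st (f z) (frechet_derivative f (at z) v) = alpha_st z v"
    using f by (auto simp: symplectic_lift_def)
  have V': "f' z \<in> V" if "z \<in> V" for z using f'(2) that by auto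
  have "homog 1 V f'"
    unfolding homog_def
  proof (intro ballI allI impI)
    fix z and r :: real assume z: "z \<in> V" "r > 0"
    have "r *\<^sub>R z = f (r *\<^sub>R f' z)" using homogD[OF sf(2) V'[OF z(1)] z(2)] f'(4)[OF z(1)] by simp
    then show "f' (r *\<^sub>R z) = r ^ 1 *\<^sub>R f' z"
      using f'(3)[OF open_coneD(3)[OF V V'[OF z(1)] z(2)]] by simp
  qed
  moreover have "alpha_st (f' z) (frechet_derivative f' (at z) v) = alpha_st z v" if z: "z \<in> V" for z v
  proof -
    have "((\<lambda>z. f (f' z)) has_derivative (\<lambda>v. frechet_derivative f (at (f' z)) (frechet_derivative f' (at z) v))) (at z)"
      using has_derivative_compose[OF smooth_on_has_derivative[OF f'(1) z] smooth_on_has_derivative[OF sf(1) V'[OF z]]] .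
    then have "((\<lambda>z. z) has_derivative (\<lambda>v. frechet_derivative f (at (f' z)) (frechet_derivative f' (at z) v))) (at z)"
      by (rule has_derivative_transform_within_open[OF _ open_coneD(1)[OF V] z]) (simp add: f')
    from fun_cong[OF has_derivative_unique[OF this has_derivative_ident], of v]
    have "frechet_derivative f (at (f' z)) (frechet_derivative f' (at z) v) = v" .
    then show ?thesis using a[OF V'[OF z], of "frechet_derivative f' (at z) v"] f'(4)[OF z] by simp
  qed
  ultimately show ?thesis using f' by (simp add: symplectic_lift_def)
qed

text \<open>Both \<open>f\<close> and \<open>f'\<close> map contact hyperplanes into contact
  hyperplanes. Applied to the pair, the chain rule turns the inclusion for \<open>f\<close> into the
  equality that \<open>contact_embedding\<close> demands.\<close>

lemma symplectic_lift_contactomorphism: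
  assumes V: "open_cone V" and f: "symplectic_lift V f"
    and f': "smooth_on V f'" "f' ` V \<subseteq> V" "\<And>z. z \<in> V \<Longrightarrow> f' (f z) = z" "\<And>z. z \<in> V \<Longrightarrow> f (f' z) = z"
  shows "contactomorphism (sphere 0 1 \<inter> V) (\<lambda>p. sgn (f p))"
proof -
  let ?U = "sphere 0 1 \<inter> V"
  let ?g = "\<lambda>p. sgn (f p)" let ?g' = "\<lambda>p. sgn (f' p)"
  note F = symplectic_lift_sphere[OF V f]
  have "symplectic_lift V f'" by (rule symplectic_lift_inverse[OF V f f'])
  note F' = symplectic_lift_sphere[OF V this]
  have fV: "f z \<in> V" "f' z \<in> V" if "z \<in> V" for z
    using f f'(2) that by (auto simp: symplectic_lift_def)
  have 1: "?g' (?g p) = p" "?g (?g' p) = p" if p: "p \<in> ?U" for p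
    using F'(5)[of "f p"] F(5)[of "f' p"] fV[of p] p f'(3,4)[of p] by auto
  have inj: "inj_on ?g ?U" by (rule inj_on_inverseI[of _ ?g']) (rule 1(1))
  have im: "?g ` ?U = ?U"
  proof
    show "?U \<subseteq> ?g ` ?U"
    proof
      fix p assume p: "p \<in> ?U"
      have "p = ?g (?g' p)" using 1(2)[OF p] by (rule sym)
      moreover have "?g' p \<in> ?U" using F'(2) p by blast
      ultimately show "p \<in> ?g ` ?U" by blast
    qed
  qed (rule F(2))
  have inv: "inv_into ?U ?g p = ?g' p" if p: "p \<in> ?U" for p
  proof -
    have "?g' p \<in> ?U" using F'(2) p by blast
    from inv_into_f_f[OF inj this] show ?thesis unfolding 1(2)[OF p] .
  qed
  have "smooth_map_on (?g ` ?U) (inv_into ?U ?g)"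
    unfolding im by (rule smooth_map_on_cong[OF F'(1) inv[symmetric]])
  moreover have "sphere_differential ?g p ` xi_st p = xi_st (?g p)" if p: "p \<in> ?U" for p
  proof
    show "xi_st (?g p) \<subseteq> sphere_differential ?g p ` xi_st p"
    proof
      fix w assume w: "w \<in> xi_st (?g p)"
      have gp: "?g p \<in> ?U" using F(2) p by blast
      have "sphere_differential ?g' (?g p) w \<in> xi_st (?g' (?g p))" using F'(4)[OF gp] w by blast
      then have 2: "sphere_differential ?g' (?g p) w \<in> xi_st p" using 1(1)[OF p] by simp
      have "sphere_differential ?g p (sphere_differential ?g' (?g p) w) = sphere_differential (\<lambda>q. ?g (?g' q)) (?g p) w"
        using sphere_differential_compose[OF V F(1) F'(1) F'(2) gp] 1(1)[OF p] by simp
      also have "\<dots> = sphere_differential (\<lambda>q. q) (?g p) w"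
      proof (rule fun_cong[OF sphere_differential_cong[OF V 1(2)]])
        show "smooth_map_on ?U (\<lambda>q. ?g (?g' q))" by (rule smooth_map_on_compose[OF F(1) F'(1,2)])
      qed (use gp in auto)
      also have "\<dots> = w"
        unfolding sphere_differential_def
        by (rule sgn_derivative_tangent) (use w gp in \<open>auto simp: xi_st_def tangent_sphere_def\<close>)
      finally show "w \<in> sphere_differential ?g p ` xi_st p" using 2 by (intro image_eqI) auto
    qed
  qed (rule F(4)[OF p])
  ultimately show ?thesis
    unfolding contactomorphism_def contact_embedding_def smooth_embedding_def
    using inj im F(1) by auto
qed

section \<open>Contact isotopy extension\<close>

text \<open>The Hamiltonian vector field: \<open>symp_J\<close> applied to the gradient. With this
  sign, the derivative of \<open>H\<close> in direction \<open>u\<close> is the symplectic pairing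
  \<open>2 * alpha_st\<close> of \<open>u\<close> with the field.\<close>

definition ham :: "((real^'n) \<times> (real^'n) \<Rightarrow> real) \<Rightarrow> (real^'n) \<times> (real^'n) \<Rightarrow> (real^'n) \<times> (real^'n)" where
  "ham H w = symp_J (\<Sum>b\<in>Basis. frechet_derivative H (at w) b *\<^sub>R b)"

lemma ham_eq:
  assumes "smooth_on S H" "w \<in> S"
  shows "frechet_derivative H (at w) u = 2 * alpha_st u (ham H w)"
proof -
  have "linear (frechet_derivative H (at w))"
    using smooth_on_has_derivative[OF assms] by (rule has_derivative_linear)
  from linear_apply_basis[OF this, of u] show ?thesis
    by (simp add: ham_def alpha_st_symp_J inner_sum_right mult.commute)
qed

lemma smooth_on_ham:
  assumes "open S" "smooth_on S H" shows "smooth_on S (ham H)"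
  unfolding ham_def[abs_def] by (intro smooth_intros assms)

lemma ham_homog:
  assumes V: "open_cone V" and H: "smooth_on V H" "homog 2 V H"
  shows "homog 1 V (ham H)"
  unfolding homog_def
proof (intro ballI allI impI)
  fix z and r :: real assume z: "z \<in> V" "r > 0"
  have "r * frechet_derivative H (at (r *\<^sub>R z)) b = r * (r * frechet_derivative H (at z) b)" for b
    using homog_derivative_scale[OF V H z, of b] by (simp add: power2_eq_square mult.assoc)
  then have "frechet_derivative H (at (r *\<^sub>R z)) b = r * frechet_derivative H (at z) b" for b
    using z(2) by (metis less_irrefl mult_left_cancel)
  then have "(\<Sum>b\<in>Basis. frechet_derivative H (at (r *\<^sub>R z)) b *\<^sub>R b) =
      r *\<^sub>R (\<Sum>b\<in>Basis. frechet_derivative H (at z) b *\<^sub>R b)"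
    by (simp add: scaleR_sum_right)
  then show "ham H (r *\<^sub>R z) = r ^ 1 *\<^sub>R ham H z"
    unfolding ham_def using linear_cmul[OF bounded_linear.linear[OF bounded_linear_symp_J]] by simp
qed

text \<open>The Cayley transform \<open>w - X/2 \<mapsto> w + X/2\<close> of a Hamiltonian vector field \<open>X\<close> with
  homogeneous Hamiltonian \<open>H\<close> preserves the Liouville form because \<open>H w = alpha_st z Z\<close>
  for \<open>z = w - X/2\<close> and \<open>Z = w + X/2\<close>, by Euler's identity.\<close>

lemma cayley_Diff_c:
  fixes H :: "(real^'n) \<times> (real^'n) \<Rightarrow> real"
  assumes V: "open_cone V" and H: "smooth_on (- {0}) H" "homog 2 (- {0}) H"
    and bd: "\<And>w v. w \<noteq> 0 \<Longrightarrow> norm (frechet_derivative (ham H) (at w) v) \<le> 1/2 * norm v"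
    and Q: "compact Q" "Q \<subseteq> V" and supp: "\<And>w. w \<noteq> 0 \<Longrightarrow> sgn w \<notin> Q \<Longrightarrow> ham H w = 0"
  obtains \<psi> \<psi>' where "\<psi> \<in> Diff_c (sphere 0 1 \<inter> V)" "\<psi>' \<in> Diff_c (sphere 0 1 \<inter> V)"
    "\<And>w. w \<noteq> 0 \<Longrightarrow> \<psi> (sgn (w - (1/2) *\<^sub>R ham H w)) = sgn (w + (1/2) *\<^sub>R ham H w)"
    "\<And>w. w \<noteq> 0 \<Longrightarrow> \<psi>' (sgn (w + (1/2) *\<^sub>R ham H w)) = sgn (w - (1/2) *\<^sub>R ham H w)"
proof -
  let ?U = "sphere 0 1 \<inter> V"
  define X where "X = ham H"
  have o0: "open (- {0 :: (real^'n) \<times> (real^'n)})" by auto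
  have sX: "smooth_on (- {0}) X" unfolding X_def by (rule smooth_on_ham[OF o0 H(1)])
  have hX: "homog 1 (- {0}) X" unfolding X_def by (rule ham_homog[OF open_cone_punctured H])
  have dX: "(X has_derivative frechet_derivative X (at w)) (at w)" if "w \<noteq> 0" for w
    using smooth_on_has_derivative[OF sX] that by simp
  have dH: "frechet_derivative H (at w) u = 2 * alpha_st u (X w)" if "w \<noteq> 0" for w u
    unfolding X_def by (rule ham_eq[OF H(1)]) (use that in simp)
  \<comment> \<open>The isotopy is the Cayley transform of \<open>s X\<close>. The range is open,
    contains [-1,1], is symmetric so that it covers the inverse maps, and keeps \<open>s / 2\<close>
    below 1 in absolute value, so that the derivative bound 1/2 survives.\<close>
  define I where "I = {-2<..<2::real}"
  have I: "open I" by (simp add: I_def)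
  have oI: "open (I \<times> - {0 :: (real^'n) \<times> (real^'n)})" by (intro open_Times I o0)
  define D where "D = (\<lambda>p. (- (fst p / 2)) *\<^sub>R X (snd p))"
  have D_eq: "D (s, w) = (- (s / 2)) *\<^sub>R X w" for s w by (simp add: D_def)
  have sXs: "smooth_on (I \<times> - {0}) (\<lambda>p. X (snd p))"
    by (rule smooth_on_compose[OF oI o0 sX smooth_on_snd[OF oI smooth_on_ident[OF oI]]]) auto
  have sD: "smooth_on (I \<times> - {0}) D"
    unfolding D_def by (intro smooth_intros sXs oI) auto
  have hD: "homog 1 (- {0}) (\<lambda>w. D (s, w))" for s
    using hX by (simp add: homog_def D_eq)
  have bD: "norm (frechet_derivative (\<lambda>w. D (s, w)) (at w) v) \<le> 1/2 * norm v"
    if s: "s \<in> I" and w: "w \<noteq> 0" for s w v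
  proof -
    have "((\<lambda>w. D (s, w)) has_derivative (\<lambda>v. (- (s / 2)) *\<^sub>R frechet_derivative X (at w) v)) (at w)"
      unfolding D_eq by (rule has_derivative_scaleR_right[OF dX[OF w]])
    then have "frechet_derivative (\<lambda>w. D (s, w)) (at w) v = (- (s / 2)) *\<^sub>R frechet_derivative X (at w) v"
      by (simp add: frechet_derivative_at[symmetric])
    moreover have "\<bar>- (s / 2)\<bar> * norm (frechet_derivative X (at w) v) \<le> 1 * (1/2 * norm v)"
      using s bd[OF w, of v] by (intro mult_mono) (auto simp: I_def X_def)
    ultimately show ?thesis by simp
  qed
  obtain G where G: "smooth_on (I \<times> - {0}) G"
    "\<And>t. t \<in> I \<Longrightarrow> homog 1 (- {0}) (\<lambda>w. G (t, w))"
    "\<And>t w. t \<in> I \<Longrightarrow> w \<noteq> 0 \<Longrightarrow> G (t, w) \<noteq> 0"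
    "\<And>t w. t \<in> I \<Longrightarrow> w \<noteq> 0 \<Longrightarrow> G (t, w) + D (t, G (t, w)) = w"
    "\<And>t z. t \<in> I \<Longrightarrow> z \<noteq> 0 \<Longrightarrow> z + D (t, z) \<noteq> 0"
    "\<And>t z. t \<in> I \<Longrightarrow> z \<noteq> 0 \<Longrightarrow> G (t, z + D (t, z)) = z"
    by (rule homog_perturbation_inverse[OF I sD hD bD]) blast+
  \<comment> \<open>\<open>G\<close> recovers the midpoint \<open>w\<close> of \<open>z\<close> and
    its image, so the image is \<open>2 w - z\<close>. Changing the sign of \<open>s\<close>
    exchanges the two end points and hence inverts the map.\<close>
  define \<Psi> where "\<Psi> = (\<lambda>p. 2 *\<^sub>R G p - snd p)"
  have Ieq: "- s \<in> I" if "s \<in> I" for s using that by (auto simp: I_def)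
  have \<Psi>_eq: "\<Psi> (s, w - (s / 2) *\<^sub>R X w) = w + (s / 2) *\<^sub>R X w" if "s \<in> I" "w \<noteq> 0" for s w
    using G(6)[OF that] by (simp add: \<Psi>_def D_eq scaleR_2)
  have nz: "w - (s / 2) *\<^sub>R X w \<noteq> 0" if "s \<in> I" "w \<noteq> 0" for s w
    using G(5)[OF that] by (simp add: D_eq)
  have par: "\<exists>w. w \<noteq> 0 \<and> z = w - (s / 2) *\<^sub>R X w \<and> G (s, z) = w" if "s \<in> I" "z \<noteq> 0" for s z
    using G(3,4)[OF that] by (intro exI[of _ "G (s, z)"]) (simp add: D_eq)
  have \<Psi>nz: "\<Psi> (s, z) \<noteq> 0" and \<Psi>inv: "\<Psi> (- s, \<Psi> (s, z)) = z" if s: "s \<in> I" and z: "z \<noteq> 0" for s z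
  proof -
    obtain w where w: "w \<noteq> 0" "z = w - (s / 2) *\<^sub>R X w" using par[OF s z] by blast
    have e: "\<Psi> (s, z) = w - ((- s) / 2) *\<^sub>R X w" using \<Psi>_eq[OF s w(1)] w(2) by simp
    show "\<Psi> (s, z) \<noteq> 0" unfolding e by (rule nz[OF Ieq[OF s] w(1)])
    show "\<Psi> (- s, \<Psi> (s, z)) = z" unfolding e using \<Psi>_eq[OF Ieq[OF s] w(1)] w(2) by simp
  qed
  have fixed: "\<Psi> (s, z) = z" if s: "s \<in> I" and z: "z \<noteq> 0" "sgn z \<notin> Q \<or> s = 0" for s z
  proof -
    have e: "(s / 2) *\<^sub>R X z = 0" using supp[OF z(1)] z(2) by (auto simp: X_def)
    show ?thesis using \<Psi>_eq[OF s z(1)] by (simp only: e diff_zero add_0_right)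
  qed
  \<comment> \<open>A point leaving \<open>V\<close> would arrive in a direction outside
    \<open>Q\<close>, where the inverse map is the identity; it would then have started outside
    \<open>V\<close>.\<close>
  have \<Psi>V: "\<Psi> (s, z) \<in> V" if s: "s \<in> I" and z: "z \<in> V" for s z
  proof (rule ccontr)
    assume n: "\<Psi> (s, z) \<notin> V"
    have z0: "z \<noteq> 0" by (rule open_coneD(2)[OF V z])
    have "sgn (\<Psi> (s, z)) \<notin> Q" using n Q(2) open_cone_sgn[OF V] by blast
    then have "\<Psi> (- s, \<Psi> (s, z)) = \<Psi> (s, z)" by (intro fixed[OF Ieq[OF s] \<Psi>nz[OF s z0]]) simp
    then show False using \<Psi>inv[OF s z0] n z by simp
  qed
  have s\<Psi>: "smooth_on (I \<times> - {0}) \<Psi>"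
    unfolding \<Psi>_def by (intro smooth_intros oI G(1))
  have s\<Psi>s: "smooth_on (- {0}) (\<lambda>z. \<Psi> (s, z))" if "s \<in> I" for s
    by (rule smooth_on_slice[OF s\<Psi> that I o0])
  have Vsub: "V \<subseteq> - {0}" using open_coneD(2)[OF V] by blast
  have lift: "symplectic_lift V (\<lambda>z. \<Psi> (s, z))" if s: "s \<in> I" for s
    unfolding symplectic_lift_def
  proof (intro conjI ballI allI)
    show "smooth_on V (\<lambda>z. \<Psi> (s, z))" by (rule smooth_on_subset[OF s\<Psi>s[OF s] Vsub])
    show "homog 1 V (\<lambda>z. \<Psi> (s, z))"
      unfolding homog_def
    proof (intro ballI allI impI)
      fix z and r :: real assume "z \<in> V" "r > 0"
      then have "G (s, r *\<^sub>R z) = r ^ 1 *\<^sub>R G (s, z)"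
        using Vsub by (intro homogD[OF G(2)[OF s]]) blast+
      then show "\<Psi> (s, r *\<^sub>R z) = r ^ 1 *\<^sub>R \<Psi> (s, z)" by (simp add: \<Psi>_def algebra_simps)
    qed
    show "(\<lambda>z. \<Psi> (s, z)) ` V \<subseteq> V" using \<Psi>V[OF s] by blast
    fix z v assume "z \<in> V"
    then have z: "z \<noteq> 0" by (rule open_coneD(2)[OF V])
    have sG: "smooth_on (- {0}) (\<lambda>z. G (s, z))" by (rule smooth_on_slice[OF G(1) s I o0])
    let ?w = "G (s, z)" and ?dw = "frechet_derivative (\<lambda>z. G (s, z)) (at z) v"
    let ?Z = "\<Psi> (s, z)" and ?dZ = "frechet_derivative (\<lambda>z. \<Psi> (s, z)) (at z) v"
    have dw: "((\<lambda>z. G (s, z)) has_derivative frechet_derivative (\<lambda>z. G (s, z)) (at z)) (at z)"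
      using smooth_on_has_derivative[OF sG] z by simp
    have dZ: "((\<lambda>z. \<Psi> (s, z)) has_derivative frechet_derivative (\<lambda>z. \<Psi> (s, z)) (at z)) (at z)"
      using smooth_on_has_derivative[OF s\<Psi>s[OF s]] z by simp
    have "((\<lambda>z. \<Psi> (s, z)) has_derivative (\<lambda>v. 2 *\<^sub>R frechet_derivative (\<lambda>z. G (s, z)) (at z) v - v)) (at z)"
      unfolding \<Psi>_def snd_conv
      by (rule has_derivative_diff[OF has_derivative_scaleR_right[OF dw] has_derivative_ident])
    from fun_cong[OF has_derivative_unique[OF dZ this], of v] have dZ_eq: "?dZ = 2 *\<^sub>R ?dw - v" .
    have w0: "?w \<noteq> 0" by (rule G(3)[OF s z])
    have wX: "\<Psi> (s, z) - z = s *\<^sub>R X (G (s, z))" if "z \<noteq> 0" for z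
    proof -
      let ?w = "G (s, z)"
      have "?w + D (s, ?w) = z" by (rule G(4)[OF s that])
      then have e: "?w - (s / 2) *\<^sub>R X ?w = z" by (simp add: D_eq)
      have "\<Psi> (s, z) = ?w + (s / 2) *\<^sub>R X ?w"
        using \<Psi>_eq[OF s G(3)[OF s that]] unfolding e .
      from arg_cong2[where f=minus, OF this e[symmetric]]
      have "\<Psi> (s, z) - z = (s / 2) *\<^sub>R X ?w + (s / 2) *\<^sub>R X ?w" by simp
      then show "\<Psi> (s, z) - z = s *\<^sub>R X ?w" by (simp add: scaleR_left_distrib[symmetric])
    qed
    have id: "s * H (G (s, z)) = alpha_st z (\<Psi> (s, z))" if z: "z \<noteq> 0" for z
    proof -
      let ?w = "G (s, z)"
      have w0: "?w \<noteq> 0" by (rule G(3)[OF s z])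
      have "2 * H ?w = 2 * alpha_st ?w (X ?w)"
        using homog_euler[OF H, of ?w] w0 dH[OF w0] by simp
      then have "s * H ?w = alpha_st ?w (\<Psi> (s, z) - z)"
        using wX[OF z] by (simp add: alpha_st_simps)
      moreover have "alpha_st z (\<Psi> (s, z)) = alpha_st ?w (\<Psi> (s, z) - z)"
        using alpha_st_flip[of ?w z] by (simp add: \<Psi>_def alpha_st_simps)
      ultimately show ?thesis by simp
    qed
    \<comment> \<open>The identity is differentiated in direction \<open>v\<close>, with the
      derivative of \<open>H\<close> expressed by \<open>X\<close>. Inserting
      \<open>s X = Z - z\<close> and \<open>2 dw = dZ + v\<close> gives a bilinear identity whose
      mixed terms cancel, leaving the invariance of the Liouville form.\<close>
    have "((\<lambda>z. s * H (G (s, z))) has_derivative (\<lambda>v. s * frechet_derivative H (at ?w) (frechet_derivative (\<lambda>z. G (s, z)) (at z) v))) (at z)"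
      using has_derivative_compose[OF dw smooth_on_has_derivative[OF H(1), of ?w]] w0
      by (intro has_derivative_mult_right) auto
    then have d1: "((\<lambda>z. alpha_st z (\<Psi> (s, z))) has_derivative (\<lambda>v. s * frechet_derivative H (at ?w) (frechet_derivative (\<lambda>z. G (s, z)) (at z) v))) (at z)"
      by (rule has_derivative_transform_within_open[OF _ o0]) (use z id in auto)
    have "((\<lambda>z. alpha_st z (\<Psi> (s, z))) has_derivative (\<lambda>v. alpha_st z (frechet_derivative (\<lambda>z. \<Psi> (s, z)) (at z) v) + alpha_st v ?Z)) (at z)"
      by (rule bounded_bilinear.FDERIV[OF bounded_bilinear_alpha_st has_derivative_ident dZ])
    from fun_cong[OF has_derivative_unique[OF d1 this], of v]
    have "s * frechet_derivative H (at ?w) ?dw = alpha_st z ?dZ + alpha_st v ?Z" .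
    then have "2 * alpha_st ?dw (?Z - z) = alpha_st z ?dZ + alpha_st v ?Z"
      unfolding dH[OF w0] wX[OF z] by (simp add: alpha_st_simps)
    moreover have "2 * alpha_st ?dw (?Z - z) = alpha_st (?dZ + v) (?Z - z)"
      unfolding dZ_eq by (simp add: alpha_st_simps)
    ultimately have "alpha_st (?dZ + v) (?Z - z) = alpha_st z ?dZ + alpha_st v ?Z" by simp
    then show "alpha_st ?Z ?dZ = alpha_st z v"
      using alpha_st_flip[of ?Z ?dZ] alpha_st_flip[of z v] alpha_st_flip[of z ?dZ]
      by (simp add: alpha_st_simps)
  qed
  have contact: "contactomorphism ?U (\<lambda>p. sgn (\<Psi> (s, p)))" if s: "s \<in> I" for s
  proof (rule symplectic_lift_contactomorphism[OF V lift[OF s]])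
    show "smooth_on V (\<lambda>z. \<Psi> (- s, z))" by (rule smooth_on_subset[OF s\<Psi>s[OF Ieq[OF s]] Vsub])
    show "(\<lambda>z. \<Psi> (- s, z)) ` V \<subseteq> V" using \<Psi>V[OF Ieq[OF s]] by blast
    show "\<Psi> (- s, \<Psi> (s, z)) = z" if "z \<in> V" for z using \<Psi>inv[OF s open_coneD(2)[OF V that]] .
    show "\<Psi> (s, \<Psi> (- s, z)) = z" if "z \<in> V" for z
      using \<Psi>inv[OF Ieq[OF s] open_coneD(2)[OF V that]] by simp
  qed
  \<comment> \<open>Both signs are treated at once: \<open>e = 1\<close> yields the map and
    \<open>e = -1\<close> its inverse, each with its own compactly supported isotopy.\<close>
  have Diff: "(\<lambda>p. sgn (\<Psi> (e, p))) \<in> Diff_c ?U" if e: "\<bar>e\<bar> = 1" for e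
    unfolding Diff_c_def
  proof (intro CollectI exI[of _ "\<lambda>(s, p). sgn (\<Psi> (e * s, p))"] conjI ballI)
    have eI: "e * s \<in> I" if "s \<in> {0..1}" for s
    proof -
      have "\<bar>e * s\<bar> \<le> 1" using that e by (simp add: abs_mult)
      then show ?thesis by (auto simp: I_def)
    qed
    have eI2: "e * s \<in> I" if "s \<in> I" for s
    proof -
      have "\<bar>e * s\<bar> < 2" using that e by (auto simp: abs_mult I_def)
      then show ?thesis by (auto simp: I_def)
    qed
    have "smooth_on (I \<times> - {0}) (\<lambda>p. sgn (\<Psi> (e * fst p, snd p)))"
    proof (rule smooth_on_sgn[OF oI])
      show "smooth_on (I \<times> - {0}) (\<lambda>p. \<Psi> (e * fst p, snd p))"
        by (rule smooth_on_compose[OF oI oI s\<Psi>]) (use eI2 in \<open>auto intro!: smooth_intros oI\<close>)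
    qed (use \<Psi>nz eI2 in auto)
    then show "smooth_map_on ({0..1} \<times> ?U) (\<lambda>(s, p). sgn (\<Psi> (e * s, p)))"
      by (rule smooth_map_onI[OF oI, rotated]) (use Vsub in \<open>auto simp: I_def\<close>)
    show "contactomorphism ?U (\<lambda>p. case (s, p) of (s, p) \<Rightarrow> sgn (\<Psi> (e * s, p)))" if "s \<in> {0..1}" for s
      using contact[OF eI[OF that]] by simp
    have fx: "sgn (\<Psi> (e * s, p)) = p" if "s \<in> {0..1}" "p \<in> ?U" "p \<notin> Q \<or> e * s = 0" for s p
    proof -
      have p: "p \<noteq> 0" "sgn p = p" using that(2) by auto
      then show ?thesis using fixed[OF eI[OF that(1)] p(1)] that(3) by simp
    qed
    show "\<exists>C. compact C \<and> C \<subseteq> ?U \<and> (\<forall>t\<in>{0..1}. \<forall>p\<in>?U - C. (case (t, p) of (s, p) \<Rightarrow> sgn (\<Psi> (e * s, p))) = p)"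
    proof (intro exI[of _ "sphere 0 1 \<inter> Q"] conjI ballI)
      show "compact (sphere 0 1 \<inter> Q)" using Q(1) by (intro closed_Int_compact) auto
      show "sphere 0 1 \<inter> Q \<subseteq> ?U" using Q(2) by blast
      fix t :: real and p assume t: "t \<in> {0..1}" and p: "p \<in> ?U - (sphere 0 1 \<inter> Q)"
      have "p \<in> ?U" "p \<notin> Q" using p by blast+
      then show "(case (t, p) of (s, p) \<Rightarrow> sgn (\<Psi> (e * s, p))) = p" using fx[OF t] by simp
    qed
    show "(case (0, p) of (s, p) \<Rightarrow> sgn (\<Psi> (e * s, p))) = p" if "p \<in> ?U" for p
      using fx[of 0 p] that by simp
  qed auto
  have hom: "sgn (\<Psi> (s, sgn z)) = sgn (\<Psi> (s, z))" if s: "s \<in> I" and z: "z \<noteq> 0" for s z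
  proof -
    have "G (s, z) = norm z *\<^sub>R G (s, sgn z)"
      using homog_sgn[OF G(2)[OF s], of z] z by simp
    moreover have "z = norm z *\<^sub>R sgn z" by (simp add: sgn_div_norm z)
    ultimately have "\<Psi> (s, z) = norm z *\<^sub>R \<Psi> (s, sgn z)"
      by (simp add: \<Psi>_def scaleR_right_diff_distrib)
    then show ?thesis using sgn_scaleR_pos[of "norm z" "\<Psi> (s, sgn z)"] z by simp
  qed
  have one: "1 \<in> I" "-1 \<in> I" by (auto simp: I_def)
  show thesis
  proof (rule that[OF Diff[of 1] Diff[of "-1"]])
    fix w :: "(real^'n) \<times> (real^'n)" assume w: "w \<noteq> 0"
    show "sgn (\<Psi> (1, sgn (w - (1/2) *\<^sub>R ham H w))) = sgn (w + (1/2) *\<^sub>R ham H w)"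
      using hom[OF one(1) nz[OF one(1) w]] \<Psi>_eq[OF one(1) w] by (simp add: X_def)
    show "sgn (\<Psi> (- 1, sgn (w + (1/2) *\<^sub>R ham H w))) = sgn (w - (1/2) *\<^sub>R ham H w)"
      using hom[OF one(2) nz[OF one(2) w]] \<Psi>_eq[OF one(2) w] by (simp add: X_def)
  qed auto
qed

lemma symp_J_0 [simp]: "symp_J 0 = 0"
  by (simp add: symp_J_def zero_prod_def)

text \<open>Near a nonzero vector outside \<open>W\<close> all directions avoid the compact set
  \<open>Q\<close>, so the extension by 0 vanishes locally. Evaluating the cutoff at the direction,
  not at the vector, is what preserves homogeneity.\<close>

lemma smooth_on_cutoff_extension:
  fixes f :: "real \<times> 'a::euclidean_space \<Rightarrow> 'b::euclidean_space"
  assumes I: "open I" and W: "open_cone W" and f: "smooth_on (I \<times> W) f"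
    and \<rho>: "smooth_on UNIV \<rho>" "\<And>x. x \<notin> Q \<Longrightarrow> \<rho> x = 0" and Q: "compact Q" "Q \<subseteq> W"
  shows "smooth_on (I \<times> - {0}) (\<lambda>p. if snd p \<in> W then \<rho> (sgn (snd p)) *\<^sub>R f p else 0)" (is "smooth_on _ ?g")
proof (rule smooth_on_local)
  fix x :: "real \<times> 'a" assume x: "x \<in> I \<times> - {0}"
  have oW: "open (I \<times> W)" using I open_coneD(1)[OF W] by (rule open_Times)
  show "\<exists>W'. open W' \<and> x \<in> W' \<and> smooth_on W' ?g"
  proof (cases "snd x \<in> W")
    case True
    have nz: "snd p \<noteq> 0" if "p \<in> I \<times> W" for p using that open_coneD(2)[OF W] by auto
    have "smooth_on (I \<times> W) (\<lambda>p. \<rho> (sgn (snd p)))"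
      by (rule smooth_on_compose[OF oW open_UNIV \<rho>(1)])
        (auto intro!: smooth_on_sgn smooth_on_snd smooth_on_ident oW nz)
    from smooth_on_scaleR[OF oW this f] have "smooth_on (I \<times> W) ?g"
      by (rule smooth_on_cong[OF oW]) auto
    moreover have "x \<in> I \<times> W" using True x by (cases x) auto
    ultimately show ?thesis using oW by blast
  next
    case False
    define S where "S = {z::'a. z \<noteq> 0} \<inter> sgn -` (- Q)"
    have oS: "open S"
      unfolding S_def
    proof (rule continuous_open_preimage)
      show "continuous_on {z::'a. z \<noteq> 0} sgn" by (intro continuous_on_sgn continuous_on_id) auto
      show "open (- Q)" using compact_imp_closed[OF Q(1)] by auto
    qed (simp add: open_Collect_neq)
    have "smooth_on (I \<times> S) (\<lambda>p. 0 :: 'b)" by (rule smooth_on_const[OF open_Times[OF I oS]])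
    then have "smooth_on (I \<times> S) ?g"
      by (rule smooth_on_cong[OF open_Times[OF I oS]]) (auto simp: S_def \<rho>(2))
    moreover have "sgn (snd x) \<notin> Q" using False Q(2) open_cone_sgn[OF W] by blast
    then have "x \<in> I \<times> S" using x by (cases x) (auto simp: S_def)
    ultimately show ?thesis using open_Times[OF I oS] by blast
  qed
qed

lemma homog_cutoff_extension:
  assumes "open_cone W" "homog d W f"
  shows "homog d (- {0}) (\<lambda>z. if z \<in> W then \<rho> (sgn z) *\<^sub>R f z else 0)"
  unfolding homog_def
proof (intro ballI allI impI)
  fix z :: 'a and r :: real assume "z \<in> - {0}" "r > 0"
  then show "(if r *\<^sub>R z \<in> W then \<rho> (sgn (r *\<^sub>R z)) *\<^sub>R f (r *\<^sub>R z) else 0) =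
      r ^ d *\<^sub>R (if z \<in> W then \<rho> (sgn z) *\<^sub>R f z else 0)"
    using open_cone_scale_iff[OF assms(1)] homogD[OF assms(2)] by (simp add: sgn_scaleR_pos)
qed

text \<open>A family of homogeneous symplectic maps starting at the identity is, for small times and near a
  compact set, the Cayley transform of the generating function \<open>w = (z + P z) / 2 \<mapsto> alpha_st z (P z)\<close>.
  In contrast to the maps themselves, this function can be cut off.\<close>

lemma local_extension:
  fixes P :: "real \<times> (real^'n) \<times> (real^'n) \<Rightarrow> (real^'n) \<times> (real^'n)"
  assumes V: "open_cone V" and W: "open_cone W" "W \<subseteq> V"
    and P: "smooth_on (UNIV \<times> W) P" "\<And>t. homog 1 W (\<lambda>z. P (t, z))"
    and alpha: "\<And>t z v. z \<in> W \<Longrightarrow>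
      alpha_st (P (t, z)) (frechet_derivative (\<lambda>z. P (t, z)) (at z) v) = alpha_st z v"
    and P0: "\<And>z. z \<in> W \<Longrightarrow> P (t0, z) = z" and K: "compact K" "K \<subseteq> sphere 0 1 \<inter> W"
  obtains \<epsilon> where "\<epsilon> > 0" "\<And>t. t \<in> ball t0 \<epsilon> \<Longrightarrow>
    \<exists>\<psi>\<in>Diff_c (sphere 0 1 \<inter> V). \<exists>\<psi>'\<in>Diff_c (sphere 0 1 \<inter> V).
      \<forall>p\<in>K. \<psi> p = sgn (P (t, p)) \<and> \<psi>' (sgn (P (t, p))) = p"
proof -
  have oW: "open W" by (rule open_coneD(1)[OF W(1)])
  have oUW: "open (UNIV \<times> W)" by (intro open_Times oW) simp
  have o0: "open (- {0 :: (real^'n) \<times> (real^'n)})" by auto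
  have KW: "K \<subseteq> W" using K(2) by blast
  obtain \<rho> N Q where \<rho>: "smooth_on UNIV \<rho>" "open N" "K \<subseteq> N" "compact Q" "Q \<subseteq> W"
    "\<And>x. x \<in> N \<Longrightarrow> \<rho> x = 1" "\<And>x. x \<notin> Q \<Longrightarrow> \<rho> x = (0::real)"
    by (rule smooth_cutoff[OF K(1) oW KW]) blast+
  \<comment> \<open>Half the displacement, so that \<open>z + D\<close> is the midpoint of
    \<open>z\<close> and \<open>P z\<close> where the cutoff is 1. The cutoff makes this map defined
    on all nonzero vectors and invertible there for \<open>t\<close> near \<open>t0\<close>.
    \<open>H0\<close> is the generating function, still expressed in the variable
    \<open>z\<close>.\<close>
  define D where "D = (\<lambda>p. if snd p \<in> W then \<rho> (sgn (snd p)) *\<^sub>R ((1/2) *\<^sub>R (P p - snd p)) else 0)"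
  define H0 where "H0 = (\<lambda>p. if snd p \<in> W then \<rho> (sgn (snd p)) *\<^sub>R alpha_st (snd p) (P p) else 0)"
  have sD: "smooth_on (UNIV \<times> - {0}) D"
    unfolding D_def
    by (rule smooth_on_cutoff_extension[OF open_UNIV W(1) _ \<rho>(1,7,4,5)])
      (intro smooth_intros oUW P(1))
  have sH0: "smooth_on (UNIV \<times> - {0}) H0"
    unfolding H0_def
    by (rule smooth_on_cutoff_extension[OF open_UNIV W(1) _ \<rho>(1,7,4,5)])
      (intro smooth_intros oUW P(1))
  have hD: "homog 1 (- {0}) (\<lambda>z. D (t, z))" for t
    unfolding D_def fst_conv snd_conv
    by (rule homog_cutoff_extension[OF W(1)])
      (use P(2)[of t] in \<open>simp add: homog_def scaleR_right_diff_distrib\<close>)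
  have hH0: "homog 2 (- {0}) (\<lambda>z. H0 (t, z))" for t
    unfolding H0_def fst_conv snd_conv
    by (rule homog_cutoff_extension[OF W(1)])
      (use P(2)[of t] in \<open>simp add: homog_def alpha_st_simps power2_eq_square\<close>)
  have D0: "D (t0, z) = 0" for z by (simp add: D_def P0)
  have H00: "H0 (t0, z) = 0" for z by (simp add: H0_def P0)
  obtain \<delta>1 where \<delta>1: "\<delta>1 > 0" "ball t0 \<delta>1 \<subseteq> UNIV"
    "\<And>t z v. t \<in> ball t0 \<delta>1 \<Longrightarrow> z \<noteq> 0 \<Longrightarrow> norm (frechet_derivative (\<lambda>z. D (t, z)) (at z) v) \<le> 1/2 * norm v"
    by (rule homog_small_derivative[OF open_UNIV UNIV_I sD hD D0, of "1/2"]) auto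
  define I where "I = ball t0 \<delta>1"
  have I: "open I" "t0 \<in> I" using \<delta>1(1) by (auto simp: I_def)
  have oI: "open (I \<times> - {0 :: (real^'n) \<times> (real^'n)})" by (intro open_Times I o0)
  have sDI: "smooth_on (I \<times> - {0}) D" by (rule smooth_on_subset[OF sD]) auto
  obtain G where G: "smooth_on (I \<times> - {0}) G"
    "\<And>t. t \<in> I \<Longrightarrow> homog 1 (- {0}) (\<lambda>w. G (t, w))"
    "\<And>t w. t \<in> I \<Longrightarrow> w \<noteq> 0 \<Longrightarrow> G (t, w) \<noteq> 0"
    "\<And>t w. t \<in> I \<Longrightarrow> w \<noteq> 0 \<Longrightarrow> G (t, w) + D (t, G (t, w)) = w"
    "\<And>t z. t \<in> I \<Longrightarrow> z \<noteq> 0 \<Longrightarrow> z + D (t, z) \<noteq> 0"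
    "\<And>t z. t \<in> I \<Longrightarrow> z \<noteq> 0 \<Longrightarrow> G (t, z + D (t, z)) = z"
    by (rule homog_perturbation_inverse[OF I(1) sDI hD \<delta>1(3)[folded I_def]]) blast+
  \<comment> \<open>The Cayley transform wants the generating function in the midpoint variable;
    \<open>G\<close> inverts the midpoint map and performs the substitution.\<close>
  define H where "H = (\<lambda>p. H0 (fst p, G p))"
  have sH: "smooth_on (I \<times> - {0}) H"
    unfolding H_def
  proof (rule smooth_on_compose[OF oI _ sH0])
    show "smooth_on (I \<times> - {0}) (\<lambda>p. (fst p, G p))" by (intro smooth_intros oI G(1))
    show "open (UNIV \<times> - {0 :: (real^'n) \<times> (real^'n)})" by (intro open_Times o0) simp
    show "(\<lambda>p. (fst p, G p)) ` (I \<times> - {0}) \<subseteq> UNIV \<times> - {0}"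
    proof (rule image_subsetI)
      fix p assume "p \<in> I \<times> - {0 :: (real^'n) \<times> (real^'n)}"
      then have "fst p \<in> I" "snd p \<noteq> 0" by auto
      from G(3)[OF this] show "(fst p, G p) \<in> UNIV \<times> - {0}" by simp
    qed
  qed
  have sHt: "smooth_on (- {0}) (\<lambda>w. H (t, w))" if "t \<in> I" for t
    by (rule smooth_on_slice[OF sH that I(1) o0])
  have hH: "homog 2 (- {0}) (\<lambda>w. H (t, w))" if t: "t \<in> I" for t
    unfolding homog_def
  proof (intro ballI allI impI)
    fix w :: "(real^'n) \<times> (real^'n)" and r :: real assume w: "w \<in> - {0}" "r > 0"
    have w0: "G (t, w) \<in> - {0}" using G(3)[OF t] w by simp
    show "H (t, r *\<^sub>R w) = r\<^sup>2 *\<^sub>R H (t, w)"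
      using homogD[OF G(2)[OF t] w] homogD[OF hH0[of t] w0 w(2)] by (simp add: H_def)
  qed
  define X where "X = (\<lambda>p. ham (\<lambda>w. H (fst p, w)) (snd p))"
  have Xt: "(\<lambda>w. X (t, w)) = ham (\<lambda>w. H (t, w))" for t by (simp add: X_def)
  have X_eq: "X (t, w) = symp_J (\<Sum>b\<in>Basis. frechet_derivative H (at (t, w)) (0, b) *\<^sub>R b)"
    if "t \<in> I" "w \<noteq> 0" for t w
  proof -
    have "frechet_derivative (\<lambda>w. H (t, w)) (at w) = (\<lambda>v. frechet_derivative H (at (t, w)) (0, v))"
      by (rule frechet_derivative_at[symmetric, OF smooth_on_slice_derivative[OF sH]]) (use that in auto)
    then show ?thesis by (simp add: X_def ham_def)
  qed
  have sX: "smooth_on (I \<times> - {0}) X"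
  proof (rule smooth_on_cong[OF oI])
    show "smooth_on (I \<times> - {0}) (\<lambda>p. symp_J (\<Sum>b\<in>Basis. frechet_derivative H (at p) (0, b) *\<^sub>R b))"
      by (intro smooth_intros oI sH)
    fix p assume "p \<in> I \<times> - {0 :: (real^'n) \<times> (real^'n)}"
    then have "fst p \<in> I" "snd p \<noteq> 0" by auto
    from X_eq[OF this] show "symp_J (\<Sum>b\<in>Basis. frechet_derivative H (at p) (0, b) *\<^sub>R b) = X p" by simp
  qed
  have hX: "homog 1 (- {0}) (\<lambda>w. X (t, w))" if "t \<in> I" for t
    unfolding Xt by (rule ham_homog[OF open_cone_punctured sHt[OF that] hH[OF that]])
  \<comment> \<open>At \<open>t0\<close> the generating function is \<open>alpha_st z z = 0\<close>.
    Its field therefore vanishes, and by continuity its derivative stays within the bound 1/2 of the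
    Cayley transform for nearby \<open>t\<close>.\<close>
  have X0: "X (t0, w) = 0" for w
  proof -
    have "(\<lambda>w. H (t0, w)) = (\<lambda>w. 0)" by (simp add: H_def H00)
    then show ?thesis by (simp add: X_def ham_def)
  qed
  obtain \<epsilon> where \<epsilon>: "\<epsilon> > 0" "ball t0 \<epsilon> \<subseteq> I"
    "\<And>t z v. t \<in> ball t0 \<epsilon> \<Longrightarrow> z \<noteq> 0 \<Longrightarrow> norm (frechet_derivative (\<lambda>z. X (t, z)) (at z) v) \<le> 1/2 * norm v"
    by (rule homog_small_derivative[OF I sX hX X0, of "1/2"]) auto
  show thesis
  proof (rule that[OF \<epsilon>(1)])
    fix t assume t\<epsilon>: "t \<in> ball t0 \<epsilon>"
    then have t: "t \<in> I" using \<epsilon>(2) by blast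
    let ?H = "\<lambda>w. H (t, w)"
    \<comment> \<open>In directions outside \<open>Q\<close> the cutoff is 0, so \<open>G\<close> is
      the identity and \<open>H\<close> vanishes on an open set.\<close>
    have supp: "ham ?H w = 0" if w: "w \<noteq> 0" "sgn w \<notin> Q" for w
    proof -
      define S where "S = {z :: (real^'n) \<times> (real^'n). z \<noteq> 0} \<inter> sgn -` (- Q)"
      have oS: "open S"
        unfolding S_def
      proof (rule continuous_open_preimage)
        show "continuous_on {z :: (real^'n) \<times> (real^'n). z \<noteq> 0} sgn" by (intro continuous_on_sgn continuous_on_id) auto
        show "open (- Q)" using compact_imp_closed[OF \<rho>(4)] by auto
      qed (simp add: open_Collect_neq)
      have H0: "0 = H (t, w)" if "w \<in> S" for w
      proof -
        have w: "w \<noteq> 0" "\<rho> (sgn w) = 0" using that \<rho>(7) by (auto simp: S_def)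
        have "D (t, w) = 0" "H0 (t, w) = 0" using w(2) by (simp_all add: D_def H0_def)
        then show ?thesis using G(6)[OF t w(1)] by (simp add: H_def)
      qed
      have wS: "w \<in> S" using w by (simp add: S_def)
      have "(?H has_derivative (\<lambda>v. 0)) (at w)"
        by (rule has_derivative_transform_within_open[OF has_derivative_const[of 0] oS wS H0])
      then have "frechet_derivative ?H (at w) = (\<lambda>v. 0)" by (rule frechet_derivative_at[symmetric])
      then show ?thesis by (simp add: ham_def)
    qed
    have bd: "norm (frechet_derivative (ham ?H) (at w) v) \<le> 1/2 * norm v" if "w \<noteq> 0" for w v
      using \<epsilon>(3)[OF t\<epsilon> that] unfolding Xt .
    have QV: "Q \<subseteq> V" using \<rho>(5) W(2) by blast
    obtain \<psi> \<psi>' where \<psi>: "\<psi> \<in> Diff_c (sphere 0 1 \<inter> V)" "\<psi>' \<in> Diff_c (sphere 0 1 \<inter> V)"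
      "\<And>w. w \<noteq> 0 \<Longrightarrow> \<psi> (sgn (w - (1/2) *\<^sub>R ham ?H w)) = sgn (w + (1/2) *\<^sub>R ham ?H w)"
      "\<And>w. w \<noteq> 0 \<Longrightarrow> \<psi>' (sgn (w + (1/2) *\<^sub>R ham ?H w)) = sgn (w - (1/2) *\<^sub>R ham ?H w)"
      by (rule cayley_Diff_c[OF V sHt[OF t] hH[OF t] bd \<rho>(4) QV supp]) blast+
    have "\<psi> p = sgn (P (t, p)) \<and> \<psi>' (sgn (P (t, p))) = p" if p: "p \<in> K" for p
    proof -
      have pW: "p \<in> W" and p0: "p \<noteq> 0" and sp: "sgn p = p" using p K(2) by auto
      \<comment> \<open>On this neighbourhood of \<open>p\<close> the cutoff is 1, so the explicit
        formulas for \<open>M\<close> and \<open>H\<close> can be differentiated at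
        \<open>p\<close>.\<close>
      define W1 where "W1 = W \<inter> sgn -` N"
      have "continuous_on W sgn" using open_coneD(2)[OF W(1)] by (intro continuous_on_sgn continuous_on_id) auto
      then have oW1: "open W1" unfolding W1_def by (rule continuous_open_preimage[OF _ oW \<rho>(2)])
      have pW1: "p \<in> W1" using p pW sp \<rho>(3) by (auto simp: W1_def)
      define M where "M = (\<lambda>z. z + D (t, z))"
      have M: "M z = (1/2) *\<^sub>R (z + P (t, z))" if "z \<in> W1" for z
      proof -
        have "M z = z + (1/2) *\<^sub>R (P (t, z) - z)" using that \<rho>(6) by (simp add: M_def D_def W1_def)
        also have "\<dots> = (1/2) *\<^sub>R (z + P (t, z))"
          using scaleR_half_double[of z] by (simp add: algebra_simps flip: scaleR_left_distrib)
        finally show ?thesis .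
      qed
      have HM: "H (t, M z) = alpha_st z (P (t, z))" if "z \<in> W1" for z
      proof -
        have "z \<noteq> 0" using that open_coneD(2)[OF W(1)] by (auto simp: W1_def)
        then show ?thesis using G(6)[OF t] that \<rho>(6) by (simp add: M_def H_def H0_def W1_def)
      qed
      let ?P' = "frechet_derivative (\<lambda>z. P (t, z)) (at p)"
      have "smooth_on W (\<lambda>z. P (t, z))" by (rule smooth_on_slice[OF P(1) UNIV_I open_UNIV oW])
      then have dP: "((\<lambda>z. P (t, z)) has_derivative ?P') (at p)" by (rule smooth_on_has_derivative[OF _ pW])
      define M' where "M' = (\<lambda>v. (1/2) *\<^sub>R (v + ?P' v))"
      have "((\<lambda>z. (1/2) *\<^sub>R (z + P (t, z))) has_derivative M') (at p)"
        unfolding M'_def by (intro has_derivative_scaleR_right has_derivative_add has_derivative_ident dP)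
      then have dM: "(M has_derivative M') (at p)"
        by (rule has_derivative_transform_within_open[OF _ oW1 pW1]) (simp add: M)
      have Mp0: "M p \<noteq> 0" unfolding M_def by (rule G(5)[OF t p0])
      have GMp: "G (t, M p) = p" unfolding M_def by (rule G(6)[OF t p0])
      \<comment> \<open>\<open>M\<close> has the differentiable right inverse \<open>G\<close>.
        Hence the vectors \<open>M' v\<close> exhaust the space, and testing against them suffices
        for nondegeneracy below.\<close>
      have surj: "\<exists>v. M' v = u" for u
      proof -
        let ?G' = "frechet_derivative (\<lambda>w. G (t, w)) (at (M p))"
        have "smooth_on (- {0}) (\<lambda>w. G (t, w))" by (rule smooth_on_slice[OF G(1) t I(1) o0])
        then have dG: "((\<lambda>w. G (t, w)) has_derivative ?G') (at (M p))"
          by (rule smooth_on_has_derivative) (use Mp0 in simp)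
        have "((\<lambda>w. M (G (t, w))) has_derivative (\<lambda>v. M' (?G' v))) (at (M p))"
          by (rule has_derivative_compose[OF dG]) (simp add: GMp dM)
        then have "((\<lambda>w. w) has_derivative (\<lambda>v. M' (?G' v))) (at (M p))"
          by (rule has_derivative_transform_within_open[OF _ o0]) (use Mp0 G(4)[OF t] in \<open>auto simp: M_def\<close>)
        from fun_cong[OF has_derivative_unique[OF this has_derivative_ident], of u]
        show ?thesis by blast
      qed
      have dH: "frechet_derivative ?H (at (M p)) u = 2 * alpha_st u (ham ?H (M p))" for u
        by (rule ham_eq[OF sHt[OF t]]) (use Mp0 in simp)
      have "(?H has_derivative frechet_derivative ?H (at (M p))) (at (M p))"
        by (rule smooth_on_has_derivative[OF sHt[OF t]]) (use Mp0 in simp)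
      from has_derivative_compose[OF dM this]
      have "((\<lambda>z. alpha_st z (P (t, z))) has_derivative (\<lambda>v. frechet_derivative ?H (at (M p)) (M' v))) (at p)"
        by (rule has_derivative_transform_within_open[OF _ oW1 pW1]) (rule HM)
      moreover have "((\<lambda>z. alpha_st z (P (t, z))) has_derivative (\<lambda>v. alpha_st p (?P' v) + alpha_st v (P (t, p)))) (at p)"
        by (rule bounded_bilinear.FDERIV[OF bounded_bilinear_alpha_st has_derivative_ident dP])
      ultimately have "(\<lambda>v. frechet_derivative ?H (at (M p)) (M' v)) = (\<lambda>v. alpha_st p (?P' v) + alpha_st v (P (t, p)))"
        by (rule has_derivative_unique)
      \<comment> \<open>\<open>1\<close> is the derivative of
        \<open>H (M z) = alpha_st z (P z)\<close>, while \<open>2\<close> rearranges the invariance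
        of the Liouville form under \<open>P\<close>. Their comparison identifies the Hamiltonian
        field at the midpoint with the displacement of \<open>p\<close>.\<close>
      from fun_cong[OF this]
      have 1: "2 * alpha_st (M' v) (ham ?H (M p)) = alpha_st p (?P' v) + alpha_st v (P (t, p))" for v
        unfolding dH .
      have 2: "2 * alpha_st (M' v) (P (t, p) - p) = alpha_st p (?P' v) + alpha_st v (P (t, p))" for v
        using alpha[OF pW, of t v] alpha_st_flip[of "?P' v" p] alpha_st_flip[of "?P' v" "P (t, p)"] alpha_st_flip[of v p]
        by (simp add: M'_def alpha_st_simps field_simps)
      have "ham ?H (M p) = P (t, p) - p"
      proof (rule alpha_st_nondegenerate)
        fix u
        obtain v where "M' v = u" using surj by blast
        then show "alpha_st u (ham ?H (M p)) = alpha_st u (P (t, p) - p)" using 1[of v] 2[of v] by simp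
      qed
      moreover have "M p - (1/2) *\<^sub>R (P (t, p) - p) = (1/2) *\<^sub>R (p + p)"
        unfolding M[OF pW1] scaleR_right_diff_distrib[symmetric] by simp
      moreover have "M p + (1/2) *\<^sub>R (P (t, p) - p) = (1/2) *\<^sub>R (P (t, p) + P (t, p))"
        unfolding M[OF pW1] scaleR_right_distrib[symmetric] by simp
      ultimately have "M p - (1/2) *\<^sub>R ham ?H (M p) = p" "M p + (1/2) *\<^sub>R ham ?H (M p) = P (t, p)"
        by (simp_all only: scaleR_half_double)
      then show ?thesis using \<psi>(3,4)[OF Mp0] sp by simp
    qed
    then show "\<exists>\<psi>\<in>Diff_c (sphere 0 1 \<inter> V). \<exists>\<psi>'\<in>Diff_c (sphere 0 1 \<inter> V).
        \<forall>p\<in>K. \<psi> p = sgn (P (t, p)) \<and> \<psi>' (sgn (P (t, p))) = p"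
      using \<psi>(1,2) by blast
  qed
qed

section \<open>From contact embeddings to symplectic lifts\<close>

lemma has_derivative_left_inverse_kernel:
  assumes g: "(g has_derivative g') (at z)" and h: "(h has_derivative h') (at (g z))"
    and k: "(k has_derivative k') (at z)" and W: "open W" "z \<in> W" "\<And>z. z \<in> W \<Longrightarrow> h (g z) = k z"
    and v: "g' v = 0"
  shows "k' v = 0"
proof -
  have "((\<lambda>z. h (g z)) has_derivative (\<lambda>v. h' (g' v))) (at z)"
    by (rule has_derivative_compose[OF g h])
  then have "(k has_derivative (\<lambda>v. h' (g' v))) (at z)"
    by (rule has_derivative_transform_within_open[OF _ W])
  from fun_cong[OF has_derivative_unique[OF k this], of v] show ?thesis
    using v linear_0[OF has_derivative_linear[OF h]] by simp
qed

text \<open>A local smooth extension of the inverse of \<open>f\<close> takes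
  \<open>f (sgn z)\<close> back to \<open>sgn z\<close>. A kernel vector is therefore also killed by
  the derivative of \<open>sgn\<close>, whose kernel is the radial line.\<close>

lemma smooth_embedding_cone_kernel:
  fixes f :: "(real^'n) \<times> (real^'n) \<Rightarrow> (real^'n) \<times> (real^'n)"
  assumes V: "open_cone V" and f: "contact_embedding (sphere 0 1 \<inter> V) f" and z: "z \<in> V"
    and v: "frechet_derivative (\<lambda>z. f (sgn z)) (at z) v = 0"
  obtains r where "v = r *\<^sub>R z"
proof -
  let ?U = "sphere 0 1 \<inter> V"
  note F = contact_embeddingD[OF f]
  have oV: "open V" by (rule open_coneD(1)[OF V])
  have sg: "smooth_on V (\<lambda>z. f (sgn z))" by (rule smooth_map_on_sgn[OF V F(3)])
  have "f (sgn z) \<in> f ` ?U" using open_cone_sgn_sphere[OF V z] by (rule imageI)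
  from smooth_map_onE[OF F(4) this]
  obtain W G where W: "open W" "f (sgn z) \<in> W" "smooth_on W G" "\<forall>y\<in>W \<inter> f ` ?U. G y = inv_into ?U f y" .
  define S where "S = V \<inter> (\<lambda>z. f (sgn z)) -` W"
  have oS: "open S" unfolding S_def by (rule continuous_open_preimage[OF smooth_on_continuous[OF sg] oV W(1)])
  have zS: "z \<in> S" using z W(2) by (simp add: S_def)
  have z0: "z \<noteq> 0" by (rule open_coneD(2)[OF V z])
  obtain l where "(sgn has_derivative (\<lambda>u. l u *\<^sub>R z + inverse (norm z) *\<^sub>R u)) (at z)"
    using sgn_has_derivative[OF z0] .
  from iffD1[OF frechet_derivative_works differentiableI[OF this]]
  have ds: "(sgn has_derivative frechet_derivative sgn (at z)) (at z)" .
  have "frechet_derivative sgn (at z) v = 0"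
  proof (rule has_derivative_left_inverse_kernel[OF smooth_on_has_derivative[OF sg z]
        smooth_on_has_derivative[OF W(3,2)] ds oS zS _ v])
    fix x assume x: "x \<in> S"
    then have xU: "sgn x \<in> ?U" by (intro open_cone_sgn_sphere[OF V]) (simp add: S_def)
    then have "f (sgn x) \<in> W \<inter> f ` ?U" using x by (simp add: S_def)
    then have "G (f (sgn x)) = inv_into ?U f (f (sgn x))" using W(4) by blast
    also have "\<dots> = sgn x" by (rule inv_into_f_f[OF F(2) xU])
    finally show "G (f (sgn x)) = sgn x" .
  qed
  from sgn_derivative_kernel[OF z0 this] show thesis using that .
qed

lemma symp_J_inner [simp]: "p \<bullet> symp_J p = 0"
  by (simp add: symp_J_def inner_prod_def inner_commute)

text \<open>Every vector at a unit vector \<open>p\<close> is a sum of one in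
  \<open>xi_st p\<close>, a radial one and a multiple of \<open>symp_J p\<close>. The pulled back
  form kills the first two, so one number determines it; the 2 compensates for
  \<open>alpha_st p (symp_J p) = 1/2\<close>. If \<open>\<kappa> p\<close> were 0, the image of
  \<open>symp_J p\<close> would lie in the image of \<open>xi_st p\<close>, and injectivity modulo
  the radial line would put \<open>symp_J p\<close> into \<open>xi_st p\<close>.\<close>

lemma contact_embedding_cone_factor:
  fixes f :: "(real^'n) \<times> (real^'n) \<Rightarrow> (real^'n) \<times> (real^'n)"
  assumes V: "open_cone V" and f: "contact_embedding (sphere 0 1 \<inter> V) f"
  defines "g \<equiv> \<lambda>z. f (sgn z)"
  defines "\<kappa> \<equiv> \<lambda>z. 2 * alpha_st (g z) (frechet_derivative g (at z) (symp_J z))"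
  shows "\<And>z v. z \<in> V \<Longrightarrow>
      alpha_st (g z) (frechet_derivative g (at z) v) = \<kappa> z * alpha_st z v / (norm z)\<^sup>2"
    and "\<And>z r. z \<in> V \<Longrightarrow> r > 0 \<Longrightarrow> \<kappa> (r *\<^sub>R z) = \<kappa> z"
    and "\<And>z. z \<in> V \<Longrightarrow> \<kappa> z \<noteq> 0"
proof -
  let ?U = "sphere 0 1 \<inter> V"
  note F = contact_embeddingD[OF f]
  have oV: "open V" by (rule open_coneD(1)[OF V])
  have sg: "smooth_on V g" unfolding g_def by (rule smooth_map_on_sgn[OF V F(3)])
  have hg: "homog 0 V g" by (simp add: homog_def g_def sgn_scaleR_pos)
  have lin: "linear (frechet_derivative g (at z))" if "z \<in> V" for z
    using has_derivative_linear[OF smooth_on_has_derivative[OF sg that]] .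
  have Dz: "frechet_derivative g (at z) z = 0" if "z \<in> V" for z
    using homog_euler[OF sg hg that] by simp
  have sc: "r *\<^sub>R frechet_derivative g (at (r *\<^sub>R z)) v = frechet_derivative g (at z) v" if "z \<in> V" "r > 0" for z r v
    using homog_derivative_scale[OF V sg hg that] by simp
  have Jr: "symp_J (r *\<^sub>R z) = r *\<^sub>R symp_J z" for r and z :: "(real^'n) \<times> (real^'n)"
    by (rule linear_cmul[OF bounded_linear.linear[OF bounded_linear_symp_J]])
  show \<kappa>r: "\<kappa> (r *\<^sub>R z) = \<kappa> z" if z: "z \<in> V" "r > 0" for z r
  proof -
    have rz: "r *\<^sub>R z \<in> V" by (rule open_coneD(3)[OF V z])
    have "g (r *\<^sub>R z) = g z" using homogD[OF hg z] by simp
    moreover have "frechet_derivative g (at (r *\<^sub>R z)) (symp_J (r *\<^sub>R z)) = frechet_derivative g (at z) (symp_J z)"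
      unfolding Jr linear_cmul[OF lin[OF rz]] by (rule sc[OF z])
    ultimately show ?thesis by (simp add: \<kappa>_def)
  qed
  have sd: "sphere_differential f p v = frechet_derivative g (at p) v" for p v
    by (simp add: sphere_differential_def g_def)
  have gU: "g p = f p" if "p \<in> ?U" for p using that by (simp add: g_def)
  have base: "alpha_st (g p) (frechet_derivative g (at p) v) = \<kappa> p * alpha_st p v" if p: "p \<in> ?U" for p v
  proof -
    have pV: "p \<in> V" and np: "norm p = 1" using p by auto
    then have pp: "p \<bullet> p = 1" by (simp add: dot_square_norm)
    define b where "b = 2 * alpha_st p v"
    define w where "w = v - (p \<bullet> v) *\<^sub>R p - b *\<^sub>R symp_J p"
    have "p \<bullet> w = 0" by (simp add: w_def inner_diff_right pp)
    moreover have "alpha_st p w = 0" by (simp add: w_def alpha_st_simps alpha_st_symp_J pp b_def)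
    ultimately have "w \<in> xi_st p" by (simp add: xi_st_def tangent_sphere_def)
    then have "sphere_differential f p w \<in> xi_st (f p)" using F(5)[OF p] by blast
    then have "alpha_st (g p) (frechet_derivative g (at p) w) = 0"
      using gU[OF p] by (simp add: xi_st_def sd)
    moreover have "v = w + (p \<bullet> v) *\<^sub>R p + b *\<^sub>R symp_J p" by (simp add: w_def)
    then have "frechet_derivative g (at p) v =
        frechet_derivative g (at p) w + (p \<bullet> v) *\<^sub>R frechet_derivative g (at p) p
        + b *\<^sub>R frechet_derivative g (at p) (symp_J p)"
      by (metis linear_add[OF lin[OF pV]] linear_cmul[OF lin[OF pV]])
    ultimately show ?thesis by (simp add: Dz[OF pV] alpha_st_simps \<kappa>_def b_def)
  qed
  show "alpha_st (g z) (frechet_derivative g (at z) v) = \<kappa> z * alpha_st z v / (norm z)\<^sup>2" if z: "z \<in> V" for z v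
  proof -
    define r where "r = norm z"
    define p where "p = sgn z"
    have r: "r > 0" using open_coneD(2)[OF V z] by (simp add: r_def)
    have zp: "z = r *\<^sub>R p" using r by (simp add: r_def p_def sgn_div_norm)
    have pU: "p \<in> ?U" unfolding p_def by (rule open_cone_sgn_sphere[OF V z])
    then have pV: "p \<in> V" by blast
    have e1: "g z = g p" using homogD[OF hg pV r] unfolding zp[symmetric] by simp
    have e2: "r *\<^sub>R frechet_derivative g (at z) v = frechet_derivative g (at p) v"
      using sc[OF pV r, of v] unfolding zp[symmetric] .
    have "r * alpha_st (g z) (frechet_derivative g (at z) v) =
        alpha_st (g z) (r *\<^sub>R frechet_derivative g (at z) v)"
      by (simp add: alpha_st_simps)
    also have "\<dots> = \<kappa> p * alpha_st p v" unfolding e1 e2 by (rule base[OF pU])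
    finally have "r * alpha_st (g z) (frechet_derivative g (at z) v) = \<kappa> p * alpha_st p v" .
    moreover have "alpha_st z v = r * alpha_st p v"
      using alpha_st_simps(5)[of r p v] unfolding zp[symmetric] by simp
    moreover have "\<kappa> z = \<kappa> p" using \<kappa>r[OF pV r] unfolding zp[symmetric] .
    ultimately show ?thesis using r
      by (simp add: r_def[symmetric] power2_eq_square nonzero_eq_divide_eq ac_simps)
  qed
  have nzU: "\<kappa> p \<noteq> 0" if p: "p \<in> ?U" for p
  proof
    assume k0: "\<kappa> p = 0"
    have pV: "p \<in> V" and np: "norm p = 1" using p by auto
    then have pp: "p \<bullet> p = 1" by (simp add: dot_square_norm)
    have "f ` ?U \<subseteq> sphere 0 1" using F(1) by blast
    from sphere_differential_tangent[OF V F(3) this p]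
    have "sphere_differential f p (symp_J p) \<in> xi_st (f p)"
      using k0 gU[OF p] by (simp add: xi_st_def \<kappa>_def sd)
    then have "sphere_differential f p (symp_J p) \<in> sphere_differential f p ` xi_st p"
      unfolding F(5)[OF p] .
    then obtain w where w: "w \<in> xi_st p" "sphere_differential f p (symp_J p) = sphere_differential f p w" by blast
    have "frechet_derivative g (at p) (symp_J p - w) = 0"
      using w(2) linear_diff[OF lin[OF pV]] by (simp add: sd)
    then obtain r where r: "symp_J p - w = r *\<^sub>R p"
      using smooth_embedding_cone_kernel[OF V f pV] unfolding g_def by blast
    have "p \<bullet> (symp_J p - w) = 0" using w(1) by (simp add: xi_st_def tangent_sphere_def inner_diff_right)
    then have "r = 0" unfolding r by (simp add: pp)
    then have "symp_J p = w" using r by simp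
    then show False using w(1) alpha_st_symp_J[of p p] by (simp add: xi_st_def pp)
  qed
  show "\<kappa> z \<noteq> 0" if z: "z \<in> V" for z
  proof -
    have nz: "norm z > 0" using open_coneD(2)[OF V z] by simp
    have "sgn z \<in> V" using open_cone_sgn_sphere[OF V z] by blast
    from \<kappa>r[OF this nz] nzU[OF open_cone_sgn_sphere[OF V z]] show ?thesis
      using nz by (simp add: sgn_div_norm)
  qed
qed

text \<open>The isotopy is reparametrized by \<open>smooth_step\<close> in order to be defined for all times.\<close>

lemma symplectic_lift_isotopy:
  fixes F :: "real \<times> ((real^'n) \<times> (real^'n)) \<Rightarrow> (real^'n) \<times> (real^'n)"
  assumes V: "open_cone V" and F: "smooth_map_on ({0..1} \<times> (sphere 0 1 \<inter> V)) F"
    and CE: "\<And>t. t \<in> {0..1} \<Longrightarrow> contact_embedding (sphere 0 1 \<inter> V) (\<lambda>p. F (t, p))"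
    and F0: "\<And>p. p \<in> sphere 0 1 \<inter> V \<Longrightarrow> F (0, p) = p"
  obtains f where "smooth_on (UNIV \<times> V) f" "\<And>t. symplectic_lift V (\<lambda>z. f (t, z))"
    "\<And>t z. z \<in> V \<Longrightarrow> sgn (f (t, z)) = F (smooth_step t, sgn z)"
    "\<And>t. inj_on (\<lambda>z. f (t, z)) V"
    "\<And>t z v. z \<in> V \<Longrightarrow> frechet_derivative (\<lambda>z. f (t, z)) (at z) v = 0 \<Longrightarrow> v = 0"
proof -
  let ?U = "sphere 0 1 \<inter> V"
  have oV: "open V" by (rule open_coneD(1)[OF V])
  have oUV: "open (UNIV \<times> V)" by (intro open_Times oV) simp
  define g where "g = (\<lambda>p. F (smooth_step (fst p), sgn (snd p)))"
  define \<kappa> where "\<kappa> = (\<lambda>p. 2 * alpha_st (g p) (frechet_derivative g (at p) (0, symp_J (snd p))))"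
  \<comment> \<open>Multiplying \<open>g\<close> by a function \<open>c\<close> multiplies the
    pulled back form by \<open>c^2\<close>, since the derivative of \<open>c\<close> contributes
    only multiples of \<open>g\<close> itself. As \<open>g\<close> pulls the form back to
    \<open>\<kappa> / (norm z)^2\<close> times \<open>alpha_st\<close>, this factor is
    forced.\<close>
  define f where "f = (\<lambda>p. (norm (snd p) / sqrt (\<kappa> p)) *\<^sub>R g p)"
  have V0: "snd p \<noteq> 0" if "p \<in> UNIV \<times> V" for p :: "real \<times> (real^'n) \<times> (real^'n)"
    using that open_coneD(2)[OF V, of "snd p"] by (cases p) simp
  have sg: "smooth_on (UNIV \<times> V) g"
    unfolding g_def
  proof (rule smooth_map_on_compose_smooth_on[OF oUV F])
    show "smooth_on (UNIV \<times> V) (\<lambda>p. (smooth_step (fst p), sgn (snd p)))"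
      by (intro smooth_on_Pair smooth_on_smooth_step smooth_on_sgn smooth_on_fst smooth_on_snd smooth_on_ident oUV V0)
    show "(\<lambda>p. (smooth_step (fst p), sgn (snd p))) ` (UNIV \<times> V) \<subseteq> {0..1} \<times> ?U"
    proof (rule image_subsetI)
      fix p :: "real \<times> (real^'n) \<times> (real^'n)" assume "p \<in> UNIV \<times> V"
      then have "snd p \<in> V" by auto
      from SigmaI[OF smooth_step_simps(3) open_cone_sgn_sphere[OF V this]]
      show "(smooth_step (fst p), sgn (snd p)) \<in> {0..1} \<times> ?U" .
    qed
  qed
  have CEt: "contact_embedding ?U (\<lambda>p. F (smooth_step t, p))" for t
    by (rule CE[OF smooth_step_simps(3)])
  have gt: "(\<lambda>z. g (t, z)) = (\<lambda>z. F (smooth_step t, sgn z))" for t by (simp add: g_def)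
  have fr: "frechet_derivative (\<lambda>z. g (t, z)) (at z) v = frechet_derivative g (at (t, z)) (0, v)" if "z \<in> V" for t z v
    by (rule fun_cong[OF frechet_derivative_at[symmetric, OF smooth_on_slice_derivative[OF sg]]]) (use that in simp)
  have \<kappa>_eq: "\<kappa> (t, z) = 2 * alpha_st (F (smooth_step t, sgn z))
      (frechet_derivative (\<lambda>z. F (smooth_step t, sgn z)) (at z) (symp_J z))" if "z \<in> V" for t z
    using fr[OF that, of t "symp_J z"] unfolding gt by (simp add: \<kappa>_def g_def)
  note CF = contact_embedding_cone_factor[OF V CEt]
  have \<kappa>r: "\<kappa> (t, r *\<^sub>R z) = \<kappa> (t, z)" if "z \<in> V" "r > 0" for t z r
    unfolding \<kappa>_eq[OF that(1)] \<kappa>_eq[OF open_coneD(3)[OF V that]] by (rule CF(2)[OF that])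
  have \<kappa>0: "\<kappa> (t, z) \<noteq> 0" if "z \<in> V" for t z
    unfolding \<kappa>_eq[OF that] by (rule CF(3)[OF that])
  have ag: "alpha_st (g (t, z)) (frechet_derivative (\<lambda>z. g (t, z)) (at z) v) = \<kappa> (t, z) * alpha_st z v / (norm z)\<^sup>2"
    if "z \<in> V" for t z v
    using CF(1)[OF that, of t v] unfolding \<kappa>_eq[OF that] gt by (simp add: g_def)
  have s\<kappa>: "smooth_on (UNIV \<times> V) \<kappa>"
    unfolding \<kappa>_def
    by (intro smooth_intros oUV sg)
  have \<kappa>1: "\<kappa> (0, z) = 1" if z: "z \<in> V" for z
  proof -
    have pU: "sgn z \<in> ?U" by (rule open_cone_sgn_sphere[OF V z])
    then have pV: "sgn z \<in> V" and np: "norm (sgn z) = 1" by auto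
    have "(\<lambda>z. g (0, z)) z = sgn z" if "z \<in> V" for z
      using F0[OF open_cone_sgn_sphere[OF V that]] by (simp add: g_def smooth_step_simps(1))
    then have "frechet_derivative (\<lambda>z. g (0, z)) (at (sgn z)) = frechet_derivative sgn (at (sgn z))"
      by (intro frechet_derivative_transform_within_open[OF _ oV pV]
          differentiableI[OF smooth_on_slice_derivative[OF sg]]) (use pV in auto)
    then have "frechet_derivative (\<lambda>z. g (0, z)) (at (sgn z)) (symp_J (sgn z)) = symp_J (sgn z)"
      using sgn_derivative_tangent[OF np symp_J_inner] by simp
    moreover have "g (0, sgn z) = sgn z"
      using F0[OF pU] np by (simp add: g_def smooth_step_simps(1))
    ultimately have "\<kappa> (0, sgn z) = 1"
      using fr[OF pV, of 0 "symp_J (sgn z)"] np by (simp add: \<kappa>_def alpha_st_symp_J dot_square_norm)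
    then show ?thesis
      using \<kappa>r[OF pV, of "norm z" 0] open_coneD(2)[OF V z] by (simp add: sgn_div_norm)
  qed
  \<comment> \<open>\<open>\<kappa>\<close> never vanishes and equals 1 at time 0; connectedness of
    the time axis excludes a negative value, so the square root is smooth.\<close>
  have \<kappa>pos: "\<kappa> (t, z) > 0" if z: "z \<in> V" for t z
  proof (rule ccontr)
    assume "\<not> \<kappa> (t, z) > 0"
    then have neg: "\<kappa> (t, z) \<le> 0" by simp
    have "continuous_on UNIV (\<lambda>t. \<kappa> (t, z))"
      by (rule continuous_on_compose2[OF smooth_on_continuous[OF s\<kappa>]]) (use z in \<open>auto intro!: continuous_intros\<close>)
    from connected_continuous_image[OF this connected_UNIV]
    have "0 \<in> range (\<lambda>t. \<kappa> (t, z))"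
      by (rule connectedD_interval[of _ "\<kappa> (t, z)" "\<kappa> (0, z)"]) (use neg \<kappa>1[OF z] in auto)
    then show False using \<kappa>0[OF z] by auto
  qed
  have sf: "smooth_on (UNIV \<times> V) f"
    unfolding f_def
  proof (intro smooth_on_scaleR smooth_on_divide smooth_on_norm smooth_on_sqrt smooth_on_snd smooth_on_ident oUV s\<kappa> sg V0)
    fix p :: "real \<times> (real^'n) \<times> (real^'n)" assume "p \<in> UNIV \<times> V"
    then have "snd p \<in> V" by auto
    from \<kappa>pos[OF this, of "fst p"] show k: "\<kappa> p > 0" by simp
    then show "sqrt (\<kappa> p) \<noteq> 0" by simp
  qed
  have gU: "g (t, z) \<in> ?U" if "z \<in> V" for t z
    using contact_embeddingD(1)[OF CEt[of t]] open_cone_sgn_sphere[OF V that] by (auto simp: g_def image_subset_iff)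
  define c where "c = (\<lambda>t z. norm z / sqrt (\<kappa> (t, z)))"
  have cpos: "c t z > 0" if "z \<in> V" for t z
    unfolding c_def using \<kappa>pos[OF that, of t] open_coneD(2)[OF V that] by simp
  have ft: "f (t, z) = c t z *\<^sub>R g (t, z)" for t z by (simp add: f_def c_def)
  have sgn_f: "sgn (f (t, z)) = g (t, z)" if "z \<in> V" for t z
    unfolding ft sgn_scaleR_pos[OF cpos[OF that]] using gU[OF that, of t] by simp
  have fV: "f (t, z) \<in> V" if "z \<in> V" for t z
    unfolding ft using gU[OF that, of t] by (intro open_coneD(3)[OF V _ cpos[OF that]]) simp
  have slg: "smooth_on V (\<lambda>z. g (t, z))" for t by (rule smooth_on_slice[OF sg UNIV_I open_UNIV oV])
  have slf: "smooth_on V (\<lambda>z. f (t, z))" for t by (rule smooth_on_slice[OF sf UNIV_I open_UNIV oV])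
  have hf: "homog 1 V (\<lambda>z. f (t, z))" for t
    unfolding homog_def
    by (intro ballI allI impI) (simp add: f_def \<kappa>r g_def sgn_scaleR_pos)
  have lift: "symplectic_lift V (\<lambda>z. f (t, z))" for t
    unfolding symplectic_lift_def
  proof (intro conjI ballI allI slf hf)
    show "(\<lambda>z. f (t, z)) ` V \<subseteq> V" using fV by blast
    fix z v assume z: "z \<in> V"
    have "smooth_on V (\<lambda>z. norm z / sqrt (\<kappa> (t, z)))"
    proof (intro smooth_on_divide smooth_on_norm smooth_on_sqrt smooth_on_ident oV smooth_on_slice[OF s\<kappa> UNIV_I open_UNIV oV])
      fix z assume z: "z \<in> V"
      show "\<kappa> (t, z) > 0" by (rule \<kappa>pos[OF z])
      show "sqrt (\<kappa> (t, z)) \<noteq> 0" using \<kappa>pos[OF z, of t] by simp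
      show "z \<noteq> 0" by (rule open_coneD(2)[OF V z])
    qed
    then have sc: "smooth_on V (c t)" by (simp add: c_def)
    have "((\<lambda>z. f (t, z)) has_derivative (\<lambda>v. c t z *\<^sub>R frechet_derivative (\<lambda>z. g (t, z)) (at z) v
        + frechet_derivative (c t) (at z) v *\<^sub>R g (t, z))) (at z)"
      unfolding ft by (rule has_derivative_scaleR[OF smooth_on_has_derivative[OF sc z] smooth_on_has_derivative[OF slg z]])
    from fun_cong[OF frechet_derivative_at[OF this], of v, symmetric]
    have "alpha_st (f (t, z)) (frechet_derivative (\<lambda>z. f (t, z)) (at z) v) =
        (c t z)\<^sup>2 * alpha_st (g (t, z)) (frechet_derivative (\<lambda>z. g (t, z)) (at z) v)"
      by (simp add: ft alpha_st_simps power2_eq_square)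
    also have "\<dots> = alpha_st z v"
      unfolding ag[OF z] using \<kappa>pos[OF z, of t] open_coneD(2)[OF V z] by (simp add: c_def power_divide)
    finally show "alpha_st (f (t, z)) (frechet_derivative (\<lambda>z. f (t, z)) (at z) v) = alpha_st z v" .
  qed
  have sgnF: "sgn (f (t, z)) = F (smooth_step t, sgn z)" if "z \<in> V" for t z
    using sgn_f[OF that] by (simp add: g_def)
  have inj: "inj_on (\<lambda>z. f (t, z)) V" for t
  proof (rule inj_onI)
    fix z z' assume z: "z \<in> V" "z' \<in> V" and eq: "f (t, z) = f (t, z')"
    have "F (smooth_step t, sgn z) = F (smooth_step t, sgn z')"
      using arg_cong[OF eq, of sgn] unfolding sgnF[OF z(1)] sgnF[OF z(2)] .
    from inj_onD[OF contact_embeddingD(2)[OF CEt] this open_cone_sgn_sphere[OF V z(1)] open_cone_sgn_sphere[OF V z(2)]]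
    have s: "sgn z = sgn z'" .
    have z0: "z \<noteq> 0" "z' \<noteq> 0" using open_coneD(2)[OF V] z by blast+
    have pV: "sgn z' \<in> V" using open_cone_sgn_sphere[OF V z(2)] by blast
    have "norm z *\<^sub>R f (t, sgn z') = norm z' *\<^sub>R f (t, sgn z')"
      using eq homog_sgn[OF hf z(1) z0(1), of t] homog_sgn[OF hf z(2) z0(2), of t] s by simp
    then have "norm z = norm z'" using open_coneD(2)[OF V fV[OF pV, of t]] by simp
    moreover have "z = norm z *\<^sub>R sgn z" "z' = norm z' *\<^sub>R sgn z'" using z0 by (simp_all add: sgn_div_norm)
    ultimately show "z = z'" using s by simp
  qed
  \<comment> \<open>A kernel vector of the derivative of \<open>f\<close> is killed by that of
    \<open>g\<close> as well, hence is radial; on \<open>r z\<close> Euler's identity gives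
    \<open>r\<close> times the nonzero vector \<open>f (t, z)\<close>.\<close>
  have ker: "v = 0" if z: "z \<in> V" and v: "frechet_derivative (\<lambda>z. f (t, z)) (at z) v = 0" for t z v
  proof -
    have fz0: "f (t, z) \<noteq> 0" by (rule open_coneD(2)[OF V fV[OF z]])
    obtain l where "(sgn has_derivative (\<lambda>u. l u *\<^sub>R f (t, z) + inverse (norm (f (t, z))) *\<^sub>R u)) (at (f (t, z)))"
      using sgn_has_derivative[OF fz0] .
    from has_derivative_left_inverse_kernel[OF smooth_on_has_derivative[OF slf z] this
        smooth_on_has_derivative[OF slg z] oV z sgn_f v]
    have "frechet_derivative (\<lambda>z. F (smooth_step t, sgn z)) (at z) v = 0" by (simp add: g_def)
    then obtain r where r: "v = r *\<^sub>R z"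
      by (rule smooth_embedding_cone_kernel[OF V CEt z])
    have "r *\<^sub>R f (t, z) = 0"
      using v homog_euler[OF slf[of t] hf[of t] z]
        linear_cmul[OF has_derivative_linear[OF smooth_on_has_derivative[OF slf[of t] z]], of r z]
      unfolding r by simp
    then show "v = 0" using fz0 r by simp
  qed
  show thesis by (rule that[OF sf lift sgnF inj ker])
qed

section \<open>Composition of isotopies\<close>

lemma smooth_map_on_Pair:
  assumes "smooth_map_on X f" "smooth_map_on X g" shows "smooth_map_on X (\<lambda>x. (f x, g x))"
proof (rule smooth_map_on_localI)
  fix x assume x: "x \<in> X"
  obtain W F where W: "open W" "x \<in> W" "smooth_on W F" "\<forall>z\<in>W \<inter> X. F z = f z"
    using smooth_map_onE[OF assms(1) x] .
  obtain W' G where W': "open W'" "x \<in> W'" "smooth_on W' G" "\<forall>z\<in>W' \<inter> X. G z = g z"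
    using smooth_map_onE[OF assms(2) x] .
  have o: "open (W \<inter> W')" using W(1) W'(1) by (rule open_Int)
  have "smooth_on (W \<inter> W') (\<lambda>x. (F x, G x))"
    by (intro smooth_on_Pair o smooth_on_subset[OF W(3)] smooth_on_subset[OF W'(3)]) auto
  then show "\<exists>W H. open W \<and> x \<in> W \<and> smooth_on W H \<and> (\<forall>z\<in>W \<inter> X. H z = (f z, g z))"
    using o W W' by (intro exI[of _ "W \<inter> W'"] exI[of _ "\<lambda>x. (F x, G x)"]) simp
qed

lemma smooth_map_on_fst: "smooth_map_on X fst"
  by (rule smooth_map_onI[OF open_UNIV _ smooth_on_linear[OF open_UNIV bounded_linear_fst]]) auto

lemma isotopy_compose:
  assumes "smooth_map_on ({0..1} \<times> U) F" "smooth_map_on ({0..1} \<times> U) G"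
    and "\<And>t p. t \<in> {0..1} \<Longrightarrow> p \<in> U \<Longrightarrow> G (t, p) \<in> U"
  shows "smooth_map_on ({0..1} \<times> U) (\<lambda>p. F (fst p, G p))"
proof (rule smooth_map_on_compose[OF assms(1) smooth_map_on_Pair[OF smooth_map_on_fst assms(2)]])
  show "(\<lambda>p. (fst p, G p)) ` ({0..1} \<times> U) \<subseteq> {0..1} \<times> U"
    using assms(3) by (simp add: image_subset_iff)
qed

lemma Diff_c_compose:
  fixes V :: "((real^'n) \<times> (real^'n)) set"
  assumes V: "open_cone V" and g: "g \<in> Diff_c (sphere 0 1 \<inter> V)" and h: "h \<in> Diff_c (sphere 0 1 \<inter> V)"
  shows "(\<lambda>p. g (h p)) \<in> Diff_c (sphere 0 1 \<inter> V)"
proof -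
  let ?U = "sphere 0 1 \<inter> V"
  obtain F C where F: "smooth_map_on ({0..1::real} \<times> ?U) F"
    "\<forall>t\<in>{0..1}. contactomorphism ?U (\<lambda>p. F (t, p))" "compact C" "C \<subseteq> ?U"
    "\<forall>t\<in>{0..1}. \<forall>p\<in>?U - C. F (t, p) = p" "\<forall>p\<in>?U. F (0, p) = p" "\<forall>p\<in>?U. F (1, p) = g p"
    using g unfolding Diff_c_def by (elim CollectE exE conjE)
  obtain G B where G: "smooth_map_on ({0..1::real} \<times> ?U) G"
    "\<forall>t\<in>{0..1}. contactomorphism ?U (\<lambda>p. G (t, p))" "compact B" "B \<subseteq> ?U"
    "\<forall>t\<in>{0..1}. \<forall>p\<in>?U - B. G (t, p) = p" "\<forall>p\<in>?U. G (0, p) = p" "\<forall>p\<in>?U. G (1, p) = h p"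
    using h unfolding Diff_c_def by (elim CollectE exE conjE)
  have GU: "G (t, p) \<in> ?U" if "t \<in> {0..1}" "p \<in> ?U" for t p
    using bspec[OF G(2) that(1)] that(2) unfolding contactomorphism_def by blast
  show ?thesis
    unfolding Diff_c_def
  proof (intro CollectI exI[of _ "\<lambda>p. F (fst p, G p)"] conjI ballI)
    show "smooth_map_on ({0..1} \<times> ?U) (\<lambda>p. F (fst p, G p))"
      by (rule isotopy_compose[OF F(1) G(1) GU])
    fix t :: real assume t: "t \<in> {0..1}"
    have ce: "contact_embedding ?U (\<lambda>p. F (t, G (t, p)))"
      by (rule contact_embedding_compose[OF V, of "\<lambda>p. F (t, p)" "\<lambda>p. G (t, p)"])
        (use bspec[OF F(2) t] bspec[OF G(2) t] in \<open>simp_all add: contactomorphism_def\<close>)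
    have "(\<lambda>p. F (t, G (t, p))) ` ?U = (\<lambda>p. F (t, p)) ` (\<lambda>p. G (t, p)) ` ?U" by (simp add: image_image)
    also have "(\<lambda>p. G (t, p)) ` ?U = ?U" using bspec[OF G(2) t] by (simp add: contactomorphism_def)
    also have "(\<lambda>p. F (t, p)) ` ?U = ?U" using bspec[OF F(2) t] by (simp add: contactomorphism_def)
    finally show "contactomorphism ?U (\<lambda>p. F (fst (t, p), G (t, p)))"
      using ce by (simp add: contactomorphism_def)
  next
    show "\<exists>C. compact C \<and> C \<subseteq> ?U \<and> (\<forall>t\<in>{0..1}. \<forall>p\<in>?U - C. F (fst (t, p), G (t, p)) = p)"
      using F(3-5) G(3-5) by (intro exI[of _ "C \<union> B"]) auto
    fix p assume p: "p \<in> ?U"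
    show "F (fst (0, p), G (0, p)) = p" using F(6) G(6) p by simp
    have "h p \<in> ?U" using GU[of 1 p] G(7) p by simp
    then show "F (fst (1, p), G (1, p)) = g (h p)" using F(7) G(7) p by simp
  qed
qed

text \<open>Composing with the inverse of the lift at \<open>t0\<close> gives the family
  \<open>P\<close> on the image cone \<open>W\<close>, equal to the identity at \<open>t0\<close>,
  so that \<open>local_extension\<close> applies to the compact set of directions of
  \<open>f (t0, p)\<close>. Movement in both time directions is recorded because membership has to
  be transported both ways later.\<close>

lemma isotopy_step:
  fixes f :: "real \<times> ((real^'n) \<times> (real^'n)) \<Rightarrow> (real^'n) \<times> (real^'n)"
  assumes V: "open_cone V" and sf: "smooth_on (UNIV \<times> V) f"
    and lift: "\<And>t. symplectic_lift V (\<lambda>z. f (t, z))"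
    and inj: "\<And>t. inj_on (\<lambda>z. f (t, z)) V"
    and ker: "\<And>t z v. z \<in> V \<Longrightarrow> frechet_derivative (\<lambda>z. f (t, z)) (at z) v = 0 \<Longrightarrow> v = 0"
    and K: "compact K" "K \<subseteq> sphere 0 1 \<inter> V"
  obtains \<epsilon> where "\<epsilon> > 0" "\<And>t. t \<in> ball t0 \<epsilon> \<Longrightarrow>
    \<exists>\<psi>\<in>Diff_c (sphere 0 1 \<inter> V). \<exists>\<psi>'\<in>Diff_c (sphere 0 1 \<inter> V).
      \<forall>p\<in>K. \<psi> (sgn (f (t0, p))) = sgn (f (t, p)) \<and> \<psi>' (sgn (f (t, p))) = sgn (f (t0, p))"
proof -
  have oV: "open V" by (rule open_coneD(1)[OF V])
  define f0 where "f0 = (\<lambda>z. f (t0, z))"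
  define f0' where "f0' = inv_into V f0"
  define W where "W = f0 ` V"
  have sft: "smooth_on V (\<lambda>z. f (t, z))" and hft: "homog 1 V (\<lambda>z. f (t, z))"
    and fV: "\<And>z. z \<in> V \<Longrightarrow> f (t, z) \<in> V"
    and alpha: "\<And>z v. z \<in> V \<Longrightarrow> alpha_st (f (t, z)) (frechet_derivative (\<lambda>z. f (t, z)) (at z) v) = alpha_st z v" for t
    using lift[of t] unfolding symplectic_lift_def by blast+
  note s0 = sft[of t0, folded f0_def] and h0 = hft[of t0, folded f0_def] and f0V = fV[of _ t0]
    and alpha0 = alpha[of _ t0, folded f0_def]
  have f0_eq: "f (t0, z) = f0 z" for z by (simp add: f0_def)
  have f0'1: "f0' (f0 z) = z" if "z \<in> V" for z
    unfolding f0'_def by (rule inv_into_f_f[OF inj[of t0, folded f0_def] that])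
  have f0'2: "f0 (f0' w) = w" "f0' w \<in> V" if "w \<in> W" for w
    using that unfolding W_def f0'_def by (auto intro: f_inv_into_f inv_into_into)
  have oW: "open W" and s0': "smooth_on W f0'"
    unfolding W_def by (rule smooth_on_inverse_map[OF oV s0 f0'1 ker[of _ t0, folded f0_def]]; assumption)+
  have WV: "W \<subseteq> V" unfolding W_def using f0V by (auto simp: f0_def)
  have coneW: "open_cone W"
    unfolding open_cone_def
  proof (intro conjI ballI allI impI)
    show "0 \<notin> W" using WV open_coneD(2)[OF V] by blast
    fix w and r :: real assume w: "w \<in> W" "r > 0"
    have "r *\<^sub>R w = f0 (r *\<^sub>R f0' w)" using homogD[OF h0 f0'2(2)[OF w(1)] w(2)] f0'2(1)[OF w(1)] by simp
    moreover have "r *\<^sub>R f0' w \<in> V" by (rule open_coneD(3)[OF V f0'2(2)[OF w(1)] w(2)])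
    ultimately show "r *\<^sub>R w \<in> W" unfolding W_def by (rule image_eqI)
  qed (rule oW)
  have h0': "f0' (r *\<^sub>R w) = r *\<^sub>R f0' w" if w: "w \<in> W" "r > 0" for w r
  proof -
    have "r *\<^sub>R w = f0 (r *\<^sub>R f0' w)" using homogD[OF h0 f0'2(2)[OF w(1)] w(2)] f0'2(1)[OF w(1)] by simp
    then show ?thesis using f0'1[OF open_coneD(3)[OF V f0'2(2)[OF w(1)] w(2)]] by simp
  qed
  define P where "P = (\<lambda>p. f (fst p, f0' (snd p)))"
  have oUW: "open (UNIV \<times> W)" and oUV: "open (UNIV \<times> V)" by (intro open_Times oW oV open_UNIV)+
  have sP: "smooth_on (UNIV \<times> W) P"
    unfolding P_def
  proof (rule smooth_on_compose[OF oUW oUV sf])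
    have "smooth_on (UNIV \<times> W) (\<lambda>p. f0' (snd p))"
      by (rule smooth_on_compose[OF oUW oW s0' smooth_on_snd[OF oUW smooth_on_ident[OF oUW]]]) auto
    then show "smooth_on (UNIV \<times> W) (\<lambda>p. (fst p, f0' (snd p)))"
      by (intro smooth_on_Pair smooth_on_fst smooth_on_ident oUW)
    show "(\<lambda>p. (fst p, f0' (snd p))) ` (UNIV \<times> W) \<subseteq> UNIV \<times> V"
      using f0'2(2) by (simp add: image_subset_iff)
  qed
  have hP: "homog 1 W (\<lambda>z. P (t, z))" for t
    unfolding homog_def
  proof (intro ballI allI impI)
    fix w and r :: real assume w: "w \<in> W" "r > 0"
    show "P (t, r *\<^sub>R w) = r ^ 1 *\<^sub>R P (t, w)"
      using homogD[OF hft f0'2(2)[OF w(1)] w(2), of t] h0'[OF w] by (simp add: P_def)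
  qed
  have aP: "alpha_st (P (t, w)) (frechet_derivative (\<lambda>z. P (t, z)) (at w) v) = alpha_st w v" if w: "w \<in> W" for t w v
  proof -
    let ?u = "frechet_derivative f0' (at w) v"
    have q: "f0' w \<in> V" by (rule f0'2(2)[OF w])
    have d': "(f0' has_derivative frechet_derivative f0' (at w)) (at w)" by (rule smooth_on_has_derivative[OF s0' w])
    have "((\<lambda>z. f0 (f0' z)) has_derivative (\<lambda>v. frechet_derivative f0 (at (f0' w)) (frechet_derivative f0' (at w) v))) (at w)"
      by (rule has_derivative_compose[OF d' smooth_on_has_derivative[OF s0 q]])
    then have "((\<lambda>z. z) has_derivative (\<lambda>v. frechet_derivative f0 (at (f0' w)) (frechet_derivative f0' (at w) v))) (at w)"
      by (rule has_derivative_transform_within_open[OF _ oW w f0'2(1)])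
    from fun_cong[OF has_derivative_unique[OF this has_derivative_ident], of v]
    have "frechet_derivative f0 (at (f0' w)) ?u = v" .
    then have 1: "alpha_st w v = alpha_st (f0' w) ?u" using alpha0[OF q, of ?u] f0'2(1)[OF w] by (simp add: f0_eq)
    have "((\<lambda>z. P (t, z)) has_derivative (\<lambda>v. frechet_derivative (\<lambda>z. f (t, z)) (at (f0' w)) (frechet_derivative f0' (at w) v))) (at w)"
      unfolding P_def fst_conv snd_conv by (rule has_derivative_compose[OF d' smooth_on_has_derivative[OF sft q]])
    from fun_cong[OF frechet_derivative_at[OF this], of v, symmetric] show ?thesis
      using alpha[OF q, of t ?u] 1 by (simp add: P_def)
  qed
  have P0: "P (t0, w) = w" if "w \<in> W" for w using f0'2(1)[OF that] by (simp add: P_def f0_eq)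
  define K0 where "K0 = (\<lambda>p. sgn (f0 p)) ` K"
  have KV: "K \<subseteq> V" using K(2) by blast
  have f00: "f0 z \<noteq> 0" if "z \<in> V" for z using open_coneD(2)[OF V f0V[OF that]] by (simp add: f0_eq)
  have "continuous_on K (\<lambda>p. sgn (f0 p))"
    by (rule continuous_on_subset[OF smooth_on_continuous[OF smooth_on_sgn[OF oV s0 f00]] KV])
  then have cK0: "compact K0" unfolding K0_def using K(1) by (rule compact_continuous_image)
  have "K0 \<subseteq> sphere 0 1 \<inter> W"
    unfolding K0_def
  proof (rule image_subsetI)
    fix p assume "p \<in> K"
    then have "f0 p \<in> W" using KV unfolding W_def by blast
    then show "sgn (f0 p) \<in> sphere 0 1 \<inter> W" by (rule open_cone_sgn_sphere[OF coneW])
  qed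
  from local_extension[OF V coneW WV sP hP aP P0 cK0 this]
  obtain \<epsilon> where \<epsilon>: "\<epsilon> > 0" "\<And>t. t \<in> ball t0 \<epsilon> \<Longrightarrow>
    \<exists>\<psi>\<in>Diff_c (sphere 0 1 \<inter> V). \<exists>\<psi>'\<in>Diff_c (sphere 0 1 \<inter> V).
      \<forall>p\<in>K0. \<psi> p = sgn (P (t, p)) \<and> \<psi>' (sgn (P (t, p))) = p" by blast
  have Pf: "sgn (P (t, sgn (f0 p))) = sgn (f (t, p))" if p: "p \<in> K" for t p
  proof -
    have pV: "p \<in> V" using p KV by blast
    have pos: "inverse (norm (f0 p)) > 0" using f00[OF pV] by simp
    have w: "f0 p \<in> W" using pV unfolding W_def by blast
    have "P (t, sgn (f0 p)) = inverse (norm (f0 p)) *\<^sub>R P (t, f0 p)"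
      using homogD[OF hP[of t] w pos] by (simp add: sgn_div_norm)
    also have "P (t, f0 p) = f (t, p)" using f0'1[OF pV] by (simp add: P_def)
    finally show ?thesis using sgn_scaleR_pos[OF pos] by simp
  qed
  show thesis
  proof (rule that[OF \<epsilon>(1)])
    fix t assume "t \<in> ball t0 \<epsilon>"
    from \<epsilon>(2)[OF this] obtain \<psi> \<psi>' where \<psi>: "\<psi> \<in> Diff_c (sphere 0 1 \<inter> V)" "\<psi>' \<in> Diff_c (sphere 0 1 \<inter> V)"
      "\<forall>p\<in>K0. \<psi> p = sgn (P (t, p)) \<and> \<psi>' (sgn (P (t, p))) = p" by blast
    have "\<psi> (sgn (f (t0, p))) = sgn (f (t, p)) \<and> \<psi>' (sgn (f (t, p))) = sgn (f (t0, p))" if p: "p \<in> K" for p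
    proof -
      have "sgn (f0 p) \<in> K0" using p unfolding K0_def by blast
      from bspec[OF \<psi>(3) this] show ?thesis unfolding Pf[OF p] f0_eq .
    qed
    then show "\<exists>\<psi>\<in>Diff_c (sphere 0 1 \<inter> V). \<exists>\<psi>'\<in>Diff_c (sphere 0 1 \<inter> V).
      \<forall>p\<in>K. \<psi> (sgn (f (t0, p))) = sgn (f (t, p)) \<and> \<psi>' (sgn (f (t, p))) = sgn (f (t0, p))"
      using \<psi>(1,2) by blast
  qed
qed

text \<open>The times at which the isotopy restricted to \<open>K\<close> extends form an open set
  with open complement: near each \<open>t0\<close> the maps \<open>\<psi>\<close> and
  \<open>\<psi>'\<close> of \<open>isotopy_step\<close> carry extensions from \<open>t0\<close> to
  \<open>t\<close> and back. Since \<open>smooth_step\<close> is 1 at time 1, that time yields the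
  extension of \<open>F (1, p)\<close>.\<close>

lemma contact_isotopy_extension:
  fixes F :: "real \<times> ((real^'n) \<times> (real^'n)) \<Rightarrow> (real^'n) \<times> (real^'n)"
  assumes V: "open_cone V" and F: "smooth_map_on ({0..1} \<times> (sphere 0 1 \<inter> V)) F"
    and CE: "\<And>t. t \<in> {0..1} \<Longrightarrow> contact_embedding (sphere 0 1 \<inter> V) (\<lambda>p. F (t, p))"
    and F0: "\<And>p. p \<in> sphere 0 1 \<inter> V \<Longrightarrow> F (0, p) = p"
    and K: "compact K" "K \<subseteq> sphere 0 1 \<inter> V"
  obtains g where "g \<in> Diff_c (sphere 0 1 \<inter> V)" "\<And>p. p \<in> K \<Longrightarrow> g p = F (1, p)"
proof -
  let ?U = "sphere 0 1 \<inter> V"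
  obtain f where f: "smooth_on (UNIV \<times> V) f" "\<And>t. symplectic_lift V (\<lambda>z. f (t, z))"
    "\<And>t z. z \<in> V \<Longrightarrow> sgn (f (t, z)) = F (smooth_step t, sgn z)"
    "\<And>t. inj_on (\<lambda>z. f (t, z)) V"
    "\<And>t z v. z \<in> V \<Longrightarrow> frechet_derivative (\<lambda>z. f (t, z)) (at z) v = 0 \<Longrightarrow> v = 0"
    by (rule symplectic_lift_isotopy[OF V F CE F0]) blast+
  have fF: "sgn (f (t, p)) = F (smooth_step t, p)" if "p \<in> K" for t p
  proof -
    have "p \<in> V" "sgn p = p" using that K(2) by auto
    then show ?thesis using f(3) by simp
  qed
  define T where "T = {t. \<exists>g\<in>Diff_c ?U. \<forall>p\<in>K. g p = sgn (f (t, p))}"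
  have step: "\<exists>\<epsilon>>0. \<forall>t\<in>ball t0 \<epsilon>. \<exists>\<psi>\<in>Diff_c ?U. \<exists>\<psi>'\<in>Diff_c ?U.
      \<forall>p\<in>K. \<psi> (sgn (f (t0, p))) = sgn (f (t, p)) \<and> \<psi>' (sgn (f (t, p))) = sgn (f (t0, p))" for t0
    by (rule isotopy_step[OF V f(1,2,4,5) K, where ?t0.0 = t0]) blast+
  have stepT: "\<exists>\<epsilon>>0. \<forall>t\<in>ball t0 \<epsilon>. t \<in> T \<longleftrightarrow> t0 \<in> T" for t0
  proof -
    obtain \<epsilon> where \<epsilon>: "\<epsilon> > 0" "\<forall>t\<in>ball t0 \<epsilon>. \<exists>\<psi>\<in>Diff_c ?U. \<exists>\<psi>'\<in>Diff_c ?U.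
      \<forall>p\<in>K. \<psi> (sgn (f (t0, p))) = sgn (f (t, p)) \<and> \<psi>' (sgn (f (t, p))) = sgn (f (t0, p))"
      using step[of t0] by blast
    have "t \<in> T \<longleftrightarrow> t0 \<in> T" if t: "t \<in> ball t0 \<epsilon>" for t
    proof -
      obtain \<psi> \<psi>' where \<psi>: "\<psi> \<in> Diff_c ?U" "\<psi>' \<in> Diff_c ?U"
        "\<forall>p\<in>K. \<psi> (sgn (f (t0, p))) = sgn (f (t, p)) \<and> \<psi>' (sgn (f (t, p))) = sgn (f (t0, p))"
        using bspec[OF \<epsilon>(2) t] by blast
      show ?thesis
      proof
        assume "t \<in> T"
        then obtain g where g: "g \<in> Diff_c ?U" "\<forall>p\<in>K. g p = sgn (f (t, p))" unfolding T_def by blast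
        show "t0 \<in> T"
          unfolding T_def using g(2) \<psi>(3) by (intro CollectI bexI[OF _ Diff_c_compose[OF V \<psi>(2) g(1)]]) simp
      next
        assume "t0 \<in> T"
        then obtain g where g: "g \<in> Diff_c ?U" "\<forall>p\<in>K. g p = sgn (f (t0, p))" unfolding T_def by blast
        show "t \<in> T"
          unfolding T_def using g(2) \<psi>(3) by (intro CollectI bexI[OF _ Diff_c_compose[OF V \<psi>(1) g(1)]]) simp
      qed
    qed
    then show ?thesis using \<epsilon>(1) by blast
  qed
  have "open T" "open (- T)"
    unfolding open_contains_ball using stepT by (metis Compl_iff subsetI)+
  \<comment> \<open>An element of \<open>Diff_c\<close> fixing \<open>K\<close> pointwise is wanted;
    the local step from time 0 to itself provides one.\<close>
  moreover have "0 \<in> T"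
  proof -
    obtain \<psi> where \<psi>: "\<psi> \<in> Diff_c ?U" "\<forall>p\<in>K. \<psi> (sgn (f (0, p))) = sgn (f (0, p))"
      using step[of 0] by (metis centre_in_ball)
    have "\<psi> p = sgn (f (0, p))" if p: "p \<in> K" for p
    proof -
      have "p \<in> ?U" using p K(2) by blast
      then have "sgn (f (0, p)) = p" using fF[OF p, of 0] F0 by (simp add: smooth_step_simps(1))
      then show ?thesis using bspec[OF \<psi>(2) p] by simp
    qed
    then show ?thesis unfolding T_def using \<psi>(1) by blast
  qed
  ultimately have "T = UNIV" using clopen[of T] by (auto simp: closed_def)
  then obtain g where "g \<in> Diff_c ?U" "\<forall>p\<in>K. g p = sgn (f (1, p))" unfolding T_def by blast
  then show thesis using fF by (intro that[of g]) (simp_all add: smooth_step_simps(2))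
qed

section \<open>Squeezing towards the transverse coordinate sphere\<close>

lemma smooth_on_vec_lambda:
  fixes f :: "'n::finite \<Rightarrow> 'a::euclidean_space \<Rightarrow> real"
  assumes "open W" "\<And>i. smooth_on W (f i)" shows "smooth_on W (\<lambda>p. \<chi> i. f i p)"
proof -
  have "(\<chi> i. f i p) = (\<Sum>i\<in>UNIV. f i p *\<^sub>R axis i 1)" for p
    by (simp add: vec_eq_iff axis_def if_distrib[of "\<lambda>x. _ * x"] cong: if_cong)
  moreover have "smooth_on W (\<lambda>p. \<Sum>i\<in>UNIV. f i p *\<^sub>R axis i (1::real))"
    by (intro smooth_intros assms)
  ultimately show ?thesis by presburger
qed

definition proj_on :: "'n set \<Rightarrow> (real^'n) \<times> (real^'n) \<Rightarrow> real^'n" where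
  "proj_on M z = (\<chi> i. if i \<in> M then fst z $ i else 0)"

definition squeeze :: "'n set \<Rightarrow> real \<Rightarrow> (real^'n) \<times> (real^'n) \<Rightarrow> (real^'n) \<times> (real^'n)" where
  "squeeze M s z = (\<chi> i. (if i \<in> M then exp s else 1) * fst z $ i,
                    \<chi> i. (if i \<in> M then exp (- s) else 1) * snd z $ i)"

lemma squeeze_linear: "linear (squeeze M s)"
  by (rule linearI) (simp_all add: squeeze_def prod_eq_iff vec_eq_iff algebra_simps)

lemma smooth_on_squeeze:
  fixes M :: "'n::finite set"
  shows "smooth_on UNIV (\<lambda>p. squeeze M (fst p) (snd p))"
proof -
  have nth: "smooth_on UNIV (\<lambda>p :: real \<times> (real^'n) \<times> (real^'n). fst (snd p) $ i)"
    "smooth_on UNIV (\<lambda>p :: real \<times> (real^'n) \<times> (real^'n). snd (snd p) $ i)" for i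
    by (rule smooth_on_linear_compose[OF open_UNIV bounded_linear_vec_nth];
        intro smooth_intros open_UNIV)+
  have e: "smooth_on UNIV (\<lambda>p :: real \<times> (real^'n) \<times> (real^'n). if i \<in> M then exp (fst p) else 1)"
    "smooth_on UNIV (\<lambda>p :: real \<times> (real^'n) \<times> (real^'n). if i \<in> M then exp (- fst p) else 1)" for i
    by (cases "i \<in> M"; simp; intro smooth_intros open_UNIV)+
  show ?thesis
    unfolding squeeze_def by (intro smooth_on_Pair smooth_on_vec_lambda smooth_on_mult open_UNIV nth e)
qed

lemma squeeze_inverse [simp]: "squeeze M (- s) (squeeze M s z) = z" "squeeze M s (squeeze M (- s) z) = z"
  by (auto simp: squeeze_def prod_eq_iff vec_eq_iff exp_minus)

lemma squeeze_0 [simp]: "squeeze M 0 z = z"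
  by (simp add: squeeze_def prod_eq_iff vec_eq_iff)

lemma alpha_st_squeeze: "alpha_st (squeeze M s z) (squeeze M s v) = alpha_st z v"
proof -
  have "fst (squeeze M s z) $ i * snd (squeeze M s v) $ i = fst z $ i * snd v $ i"
    "snd (squeeze M s z) $ i * fst (squeeze M s v) $ i = snd z $ i * fst v $ i" for i
    by (cases "i \<in> M"; simp add: squeeze_def exp_minus)+
  then show ?thesis by (simp add: alpha_st_def)
qed

lemma proj_on_squeeze: "proj_on M (squeeze M s z) = exp s *\<^sub>R proj_on M z"
  by (simp add: proj_on_def squeeze_def vec_eq_iff)

lemma proj_on_scaleR: "proj_on M (r *\<^sub>R z) = r *\<^sub>R proj_on M z"
  by (simp add: proj_on_def vec_eq_iff)

lemma norm_proj_on_le: "norm (proj_on M z) \<le> norm z"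
proof -
  have "norm (proj_on M z) \<le> norm (fst z)"
    unfolding norm_vec_def by (rule L2_set_mono) (auto simp: proj_on_def)
  also have "\<dots> \<le> norm z" using norm_fst_le[of "fst z" "snd z"] by simp
  finally show ?thesis .
qed

text \<open>For nonnegative \<open>s\<close> all factors are at most \<open>exp s\<close>, while
  \<open>proj_on M\<close> grows by exactly \<open>exp s\<close>. The ratio of the two norms
  therefore cannot decrease under squeezing.\<close>

lemma norm_squeeze_le:
  assumes "s \<ge> 0" shows "norm (squeeze M s z) \<le> exp s * norm z"
proof -
  have e: "exp (- s) \<le> exp s" "1 \<le> exp s" using assms by auto
  have f: "norm (fst (squeeze M s z) $ i) \<le> norm ((exp s *\<^sub>R fst z) $ i)" for i
    using mult_right_mono[OF e(2) abs_ge_zero[of "fst z $ i"]]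
    by (cases "i \<in> M") (simp_all add: squeeze_def abs_mult)
  have g: "norm (snd (squeeze M s z) $ i) \<le> norm ((exp s *\<^sub>R snd z) $ i)" for i
    using mult_right_mono[OF e(1) abs_ge_zero[of "snd z $ i"]]
      mult_right_mono[OF e(2) abs_ge_zero[of "snd z $ i"]]
    by (cases "i \<in> M") (simp_all add: squeeze_def abs_mult)
  have "norm (fst (squeeze M s z)) \<le> norm (exp s *\<^sub>R fst z)"
    unfolding norm_vec_def by (rule L2_set_mono[OF f norm_ge_zero])
  moreover have "norm (snd (squeeze M s z)) \<le> norm (exp s *\<^sub>R snd z)"
    unfolding norm_vec_def by (rule L2_set_mono[OF g norm_ge_zero])
  ultimately have "norm (squeeze M s z) \<le> norm (exp s *\<^sub>R z)"
    unfolding norm_prod_def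
    by (intro real_sqrt_le_mono add_mono power_mono) auto
  then show ?thesis by simp
qed

lemma continuous_on_proj_on: "continuous_on S (proj_on M)"
proof -
  have "linear (proj_on M)"
    by (rule linearI) (simp_all add: proj_on_def vec_eq_iff)
  then show ?thesis by (rule linear_continuous_on[OF linear_conv_bounded_linear[THEN iffD1]])
qed

text \<open>Because \<open>n \<le> k\<close>, every y-direction lies in the spanning set, so that
  membership constrains only the first \<open>2n - k\<close> of the x-coordinates.\<close>

lemma Pi_last_eq:
  assumes "CARD('n::{finite,linorder}) \<le> k"
  shows "- Pi_last k = {z :: (real^'n::{finite,linorder}) \<times> (real^'n::{finite,linorder}). proj_on {i. coord_pos i \<le> 2 * CARD('n) - k} z \<noteq> 0}"
proof -
  let ?M = "{i :: 'n::{finite,linorder}. coord_pos i \<le> 2 * CARD('n) - k}"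
  let ?B = "{(axis i 1, 0) |i :: 'n::{finite,linorder}. coord_pos i > 2 * CARD('n) - k} \<union>
      {(0, axis i 1) |i :: 'n::{finite,linorder}. CARD('n) + coord_pos i > 2 * CARD('n) - k} :: ((real^'n::{finite,linorder}) \<times> (real^'n::{finite,linorder})) set"
  have "Pi_last k = {z :: (real^'n::{finite,linorder}) \<times> (real^'n::{finite,linorder}). proj_on ?M z = 0}"
  proof
    have "subspace {z :: (real^'n::{finite,linorder}) \<times> (real^'n::{finite,linorder}). proj_on ?M z = 0}"
      by (auto simp: subspace_def proj_on_def vec_eq_iff)
    then show "Pi_last k \<subseteq> {z :: (real^'n::{finite,linorder}) \<times> (real^'n::{finite,linorder}). proj_on ?M z = 0}"
      unfolding Pi_last_def
      by (intro span_minimal) (auto simp: proj_on_def vec_eq_iff axis_def)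
    show "{z :: (real^'n::{finite,linorder}) \<times> (real^'n::{finite,linorder}). proj_on ?M z = 0} \<subseteq> Pi_last k"
    proof
      fix z :: "(real^'n::{finite,linorder}) \<times> (real^'n::{finite,linorder})" assume "z \<in> {z. proj_on ?M z = 0}"
      then have z: "fst z $ i = 0" if "i \<in> ?M" for i
        using that by (auto simp: proj_on_def vec_eq_iff split: if_splits)
      have 1: "(fst z $ i) *\<^sub>R (axis i 1, 0) \<in> span ?B" for i
      proof (cases "i \<in> ?M")
        case True
        then show ?thesis using z[OF True] span_zero[of ?B] by (simp add: zero_prod_def)
      next
        case False
        then show ?thesis by (intro span_scale span_base) auto
      qed
      have 2: "(snd z $ i) *\<^sub>R (0, axis i 1) \<in> span ?B" for i
      proof -
        \<comment> \<open>Positions start at 1; this strictness is what includes all y-directions in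
          the boundary case \<open>k = n\<close>.\<close>
        have "i \<in> {j. j \<le> i}" by simp
        then have "coord_pos i > 0" unfolding coord_pos_def by (intro card_gt_0_iff[THEN iffD2]) auto
        then have "CARD('n) + coord_pos i > 2 * CARD('n) - k" using assms by linarith
        then show ?thesis by (intro span_scale span_base) auto
      qed
      have "z = (\<Sum>i\<in>UNIV. (fst z $ i) *\<^sub>R (axis i 1, 0)) + (\<Sum>i\<in>UNIV. (snd z $ i) *\<^sub>R (0, axis i 1))"
        by (simp add: prod_eq_iff fst_sum snd_sum vec_eq_iff axis_def if_distrib[of "\<lambda>x. _ * x"] cong: if_cong)
      also have "\<dots> \<in> span ?B" by (intro span_add span_sum 1 2)
      finally show "z \<in> Pi_last k" unfolding Pi_last_def .
    qed
  qed
  then show ?thesis by auto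
qed

section \<open>Conformal factors and lifts of the squeezing maps\<close>

lemma conformal_factor_eq:
  assumes "norm p = 1"
    and "\<And>v. v \<in> tangent_sphere p \<Longrightarrow> alpha_st (\<psi> p) (sphere_differential \<psi> p v) = c * alpha_st p v"
  shows "conformal_factor \<psi> p = c"
  unfolding conformal_factor_def
proof (rule the_equality)
  fix d assume d: "\<forall>v\<in>tangent_sphere p. alpha_st (\<psi> p) (sphere_differential \<psi> p v) = d * alpha_st p v"
  \<comment> \<open>On this tangent vector \<open>alpha_st p\<close> takes the value 1/2, so it
    alone determines the factor.\<close>
  have J: "symp_J p \<in> tangent_sphere p" by (simp add: tangent_sphere_def)
  have "alpha_st p (symp_J p) = 1/2" using assms(1) by (simp add: alpha_st_symp_J dot_square_norm)
  then show "d = c" using bspec[OF d J] assms(2)[OF J] by simp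
qed (use assms(2) in blast)

lemma symplectic_lift_compose:
  assumes V: "open_cone V" and f: "symplectic_lift V f" and g: "symplectic_lift V g"
  shows "symplectic_lift V (\<lambda>z. f (g z))"
proof -
  have F: "smooth_on V f" "homog 1 V f" "f ` V \<subseteq> V"
    "\<forall>z\<in>V. \<forall>v. alpha_st (f z) (frechet_derivative f (at z) v) = alpha_st z v"
    using f unfolding symplectic_lift_def by blast+
  have G: "smooth_on V g" "homog 1 V g" "g ` V \<subseteq> V"
    "\<forall>z\<in>V. \<forall>v. alpha_st (g z) (frechet_derivative g (at z) v) = alpha_st z v"
    using g unfolding symplectic_lift_def by blast+
  have oV: "open V" by (rule open_coneD(1)[OF V])
  have gV: "g z \<in> V" if "z \<in> V" for z using G(3) that by blast
  show ?thesis
    unfolding symplectic_lift_def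
  proof (intro conjI ballI allI)
    show "smooth_on V (\<lambda>z. f (g z))" by (rule smooth_on_compose[OF oV oV F(1) G(1,3)])
    show "(\<lambda>z. f (g z)) ` V \<subseteq> V" using F(3) gV by blast
    show "homog 1 V (\<lambda>z. f (g z))"
      unfolding homog_def
    proof (intro ballI allI impI)
      fix z and r :: real assume z: "z \<in> V" "r > 0"
      show "f (g (r *\<^sub>R z)) = r ^ 1 *\<^sub>R f (g z)"
        using homogD[OF G(2) z] homogD[OF F(2) gV[OF z(1)] z(2)] by simp
    qed
    fix z v assume z: "z \<in> V"
    have "((\<lambda>z. f (g z)) has_derivative (\<lambda>v. frechet_derivative f (at (g z)) (frechet_derivative g (at z) v))) (at z)"
      by (rule has_derivative_compose[OF smooth_on_has_derivative[OF G(1) z] smooth_on_has_derivative[OF F(1) gV[OF z]]])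
    note e = fun_cong[OF frechet_derivative_at[OF this], of v, symmetric]
    show "alpha_st (f (g z)) (frechet_derivative (\<lambda>z. f (g z)) (at z) v) = alpha_st z v"
      unfolding e
      using spec[OF bspec[OF F(4) gV[OF z]], of "frechet_derivative g (at z) v"]
        spec[OF bspec[OF G(4) z], of v] by (rule trans)
  qed
qed

lemma symplectic_lift_squeeze:
  fixes M :: "'n::finite set"
  assumes V: "V = {z. proj_on M z \<noteq> 0}"
  shows "symplectic_lift V (squeeze M s)"
  unfolding symplectic_lift_def
proof (intro conjI ballI allI)
  have bl: "bounded_linear (squeeze M s)" using squeeze_linear linear_conv_bounded_linear by blast
  have "open V"
    unfolding V by (intro open_Collect_neq continuous_on_proj_on continuous_on_const)
  then show "smooth_on V (squeeze M s)" using bl by (rule smooth_on_linear)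
  show "homog 1 V (squeeze M s)" by (simp add: homog_def linear_cmul[OF squeeze_linear])
  show "squeeze M s ` V \<subseteq> V" unfolding V by (auto simp: proj_on_squeeze)
  fix z v assume "z \<in> V"
  have "frechet_derivative (squeeze M s) (at z) = squeeze M s"
    using frechet_derivative_at[OF bounded_linear_imp_has_derivative[OF bl]] by simp
  then show "alpha_st (squeeze M s z) (frechet_derivative (squeeze M s) (at z) v) = alpha_st z v"
    by (simp add: alpha_st_squeeze)
qed

lemma compact_continuous_positive_bound:
  fixes f :: "'a::topological_space \<Rightarrow> real"
  assumes "compact S" "continuous_on S f" "\<And>x. x \<in> S \<Longrightarrow> f x > 0"
  obtains m where "m > 0" "\<And>x. x \<in> S \<Longrightarrow> m \<le> f x"
proof (cases "S = {}")
  case False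
  obtain x where x: "x \<in> S" "\<forall>y\<in>S. f x \<le> f y"
    using continuous_attains_inf[OF assms(1) False assms(2)] by blast
  show thesis by (rule that[of "f x"]) (use x assms(3) in auto)
qed (use that[of 1] in auto)

theorem corollary1p10:
  fixes k :: nat
  assumes "CARD('n::{finite,linorder}) \<le> k" and "k \<le> 2 * CARD('n::{finite,linorder}) - 1"
  shows "non_orderable_up_to_conjugation
    (sphere 0 1 - Pi_last k :: ((real^'n::{finite,linorder}) \<times> (real^'n::{finite,linorder})) set)"
proof -
  define M where "M = {i :: 'n::{finite,linorder}. coord_pos i \<le> 2 * CARD('n) - k}"
  define V where "V = {z :: (real^'n::{finite,linorder}) \<times> (real^'n::{finite,linorder}). proj_on M z \<noteq> 0}"
  let ?U = "sphere 0 1 \<inter> V"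
  have VP: "- Pi_last k = V" unfolding V_def M_def by (rule Pi_last_eq[OF assms(1)])
  have U_eq: "sphere 0 1 - Pi_last k = ?U" unfolding VP[symmetric] by blast
  have oV: "open V"
    unfolding V_def by (intro open_Collect_neq continuous_on_proj_on continuous_on_const)
  have V: "open_cone V"
    unfolding open_cone_def using oV by (auto simp: V_def proj_on_scaleR) (simp add: proj_on_def vec_eq_iff)
  define C where "C = (\<lambda>\<delta>. sphere 0 1 \<inter> {z. \<delta> \<le> norm (proj_on M z)})"
  have cC: "compact (C \<delta>)" for \<delta>
    unfolding C_def
    by (intro compact_Int_closed compact_sphere closed_Collect_le continuous_on_norm continuous_on_proj_on continuous_on_const)
  have CU: "C \<delta> \<subseteq> ?U" if "\<delta> > 0" for \<delta>
    using that by (auto simp: C_def V_def)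
  have lA: "symplectic_lift V (squeeze M s)" for s by (rule symplectic_lift_squeeze[OF V_def])
  have "\<exists>h\<in>Diff_c ?U. \<forall>p\<in>?U. Ad ?U h K\<^sub>1 p \<le> K\<^sub>2 p" if K1: "K\<^sub>1 \<in> g_plus ?U" and K2: "K\<^sub>2 \<in> g_plus ?U" for K\<^sub>1 K\<^sub>2
  proof -
    have sK1: "smooth_map_on ?U K\<^sub>1" and sK2: "smooth_map_on ?U K\<^sub>2"
      using K1 K2 by (simp_all add: g_plus_def g_nonneg_def lie_g_def)
    have K2nn: "0 \<le> K\<^sub>2 p" if "p \<in> ?U" for p using K2 that by (simp add: g_plus_def g_nonneg_def)
    obtain C1 where C1: "compact C1" "C1 \<subseteq> ?U" "\<forall>p\<in>?U - C1. K\<^sub>1 p = 0"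
      using K1 unfolding g_plus_def g_nonneg_def lie_g_def by blast
    obtain \<delta> where \<delta>: "\<delta> > 0" "\<And>p. p \<in> C1 \<Longrightarrow> \<delta> \<le> norm (proj_on M p)"
      by (rule compact_continuous_positive_bound[OF C1(1), of "\<lambda>p. norm (proj_on M p)"])
        (use C1(2) in \<open>auto simp: V_def intro!: continuous_on_norm continuous_on_proj_on\<close>)
    have C1C: "C1 \<subseteq> C \<delta>" using \<delta>(2) C1(2) by (auto simp: C_def)
    \<comment> \<open>The extension is made from the larger set \<open>C (\<delta> / 2)\<close>,
      which contains a neighbourhood of \<open>C \<delta>\<close> in the sphere. On
      \<open>C \<delta>\<close>, which contains the support of \<open>K\<^sub>1\<close>, derivatives
      of the extension are then known as well.\<close>
    have \<delta>2: "\<delta> / 2 > 0" using \<delta>(1) by simp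
    have CC: "C \<delta> \<subseteq> C (\<delta> / 2)" using \<delta>(1) by (auto simp: C_def)
    have "bounded (K\<^sub>1 ` C \<delta>)"
      by (rule compact_imp_bounded[OF compact_continuous_image[OF
            continuous_on_subset[OF smooth_map_on_continuous[OF sK1] CU[OF \<delta>(1)]] cC]])
    then obtain B where B: "B > 0" "\<forall>x\<in>K\<^sub>1 ` C \<delta>. norm x \<le> B" unfolding bounded_pos by blast
    obtain \<sigma> where \<sigma>: "\<sigma> \<in> compressing_embeddings ?U" "\<forall>p\<in>\<sigma> ` ?U. 0 < K\<^sub>2 p"
      using K2 unfolding g_plus_def by blast
    obtain F where F: "smooth_map_on ({0..1::real} \<times> ?U) F"
      "\<forall>t\<in>{0..1}. contact_embedding ?U (\<lambda>p. F (t, p))" "\<forall>p\<in>?U. F (0, p) = p" "\<forall>p\<in>?U. F (1, p) = \<sigma> p"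
      using \<sigma>(1) unfolding compressing_embeddings_def by (elim CollectE exE conjE)
    obtain f where f: "smooth_on (UNIV \<times> V) f" "\<And>t. symplectic_lift V (\<lambda>z. f (t, z))"
      "\<And>t z. z \<in> V \<Longrightarrow> sgn (f (t, z)) = F (smooth_step t, sgn z)"
      by (rule symplectic_lift_isotopy[OF V F(1) bspec[OF F(2)] bspec[OF F(3)]]) blast+
    define f1 where "f1 = (\<lambda>z. f (1, z))"
    have lf: "symplectic_lift V f1" unfolding f1_def by (rule f(2))
    have sf1: "smooth_on V f1" and hf1: "homog 1 V f1" and f1V: "\<And>z. z \<in> V \<Longrightarrow> f1 z \<in> V"
      using lf unfolding symplectic_lift_def by blast+
    have f1F: "sgn (f1 z) = F (1, sgn z)" if "z \<in> V" for z
      using f(3)[OF that, of 1] by (simp add: f1_def smooth_step_simps(2))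
    have C2V: "C (\<delta> / 2) \<subseteq> V" using CU[OF \<delta>2] by blast
    have cf1: "continuous_on (C (\<delta> / 2)) f1" by (rule continuous_on_subset[OF smooth_on_continuous[OF sf1] C2V])
    have f1nz: "f1 p \<noteq> 0" if "p \<in> V" for p by (rule open_coneD(2)[OF V f1V[OF that]])
    \<comment> \<open>A lower bound for the norm of the lift of \<open>\<sigma>\<close>, that is, an
      upper bound for its conformal factor, on a set that squeezing does not leave.\<close>
    obtain \<mu> where \<mu>: "\<mu> > 0" "\<And>p. p \<in> C (\<delta> / 2) \<Longrightarrow> \<mu> \<le> norm (f1 p)"
      by (rule compact_continuous_positive_bound[OF cC[of "\<delta> / 2"], of "\<lambda>p. norm (f1 p)"])
        (use cf1 f1nz C2V in \<open>auto intro!: continuous_on_norm\<close>)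
    have sgnC: "sgn p = p" if "p \<in> ?U" for p using that by simp
    have \<sigma>f1: "sgn (f1 p) = \<sigma> p" if "p \<in> ?U" for p
      using f1F[of p] sgnC[OF that] bspec[OF F(4) that] that by simp
    have cK2: "continuous_on (C (\<delta> / 2)) (\<lambda>p. K\<^sub>2 (sgn (f1 p)))"
    proof (rule continuous_on_compose2[OF smooth_map_on_continuous[OF sK2]])
      show "continuous_on (C (\<delta> / 2)) (\<lambda>p. sgn (f1 p))"
        using cf1 f1nz C2V by (intro continuous_on_sgn) blast+
      show "(\<lambda>p. sgn (f1 p)) ` C (\<delta> / 2) \<subseteq> ?U"
        using symplectic_lift_sphere(2)[OF V lf] CU[OF \<delta>2] by blast
    qed
    have "K\<^sub>2 (sgn (f1 p)) > 0" if "p \<in> C (\<delta> / 2)" for p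
    proof -
      have "p \<in> ?U" using that CU[OF \<delta>2] by blast
      then show ?thesis using \<sigma>(2) \<sigma>f1 by simp
    qed
    from compact_continuous_positive_bound[OF cC cK2 this]
    obtain \<epsilon> where \<epsilon>: "\<epsilon> > 0" "\<And>p. p \<in> C (\<delta> / 2) \<Longrightarrow> \<epsilon> \<le> K\<^sub>2 (sgn (f1 p))" by blast
    \<comment> \<open>Chosen so that
      \<open>B / (exp s * \<delta> * \<mu>)^2 \<le> \<epsilon>\<close>, by the crude estimate
      \<open>s \<le> exp s \<le> (exp s)^2\<close>.\<close>
    define s where "s = B / (\<epsilon> * (\<delta> * \<mu>)\<^sup>2)"
    have s0: "s \<ge> 0" unfolding s_def using B(1) \<epsilon>(1) by simp
    define A where "A = squeeze M s"
    have AV: "squeeze M t z \<in> V" if "z \<in> V" for t z using that by (simp add: V_def proj_on_squeeze)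
    have Anz: "squeeze M t z \<noteq> 0" if "z \<in> V" for t z by (rule open_coneD(2)[OF V AV[OF that]])
    have AC: "sgn (A p) \<in> C \<eta>" if p: "p \<in> C \<eta>" "\<eta> > 0" for p \<eta>
    proof -
      have pU: "p \<in> ?U" using CU p by blast
      then have np: "norm p = 1" and pV: "p \<in> V" by auto
      have nA: "norm (A p) > 0" using Anz[OF pV] by (simp add: A_def)
      have "\<eta> * norm (A p) \<le> norm (proj_on M p) * exp s"
        using norm_squeeze_le[OF s0, of M p] p np nA by (intro mult_mono) (auto simp: C_def A_def)
      then have "\<eta> \<le> norm (proj_on M (sgn (A p)))"
        using nA by (simp add: sgn_div_norm proj_on_scaleR) (simp add: A_def proj_on_squeeze field_simps)
      then show ?thesis using nA by (simp add: C_def norm_sgn)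
    qed
    define fA where "fA = (\<lambda>z. f1 (A z))"
    have lfA: "symplectic_lift V fA" unfolding fA_def A_def by (rule symplectic_lift_compose[OF V lf lA])
    \<comment> \<open>Homogeneity splits the norm of the lift into the growth of \<open>p\<close>
      under squeezing, at least \<open>exp s * \<delta>\<close>, and the norm of \<open>f1\<close>
      at the direction of \<open>A p\<close>, at least \<open>\<mu>\<close>.\<close>
    have fA_ge: "exp s * \<delta> * \<mu> \<le> norm (fA p)" if p: "p \<in> C \<delta>" for p
    proof -
      have pV: "p \<in> V" using p CU[OF \<delta>(1)] by blast
      have "norm (fA p) = norm (A p) * norm (f1 (sgn (A p)))"
        unfolding fA_def A_def using homog_sgn[OF hf1 AV[OF pV] Anz[OF pV]] by simp
      moreover have "\<mu> \<le> norm (f1 (sgn (A p)))" using AC[OF p \<delta>(1)] CC by (intro \<mu>(2)) blast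
      moreover have "exp s * \<delta> \<le> norm (A p)"
      proof -
        have "exp s * \<delta> \<le> exp s * norm (proj_on M p)" using p by (simp add: C_def)
        also have "\<dots> = norm (proj_on M (A p))" by (simp add: A_def proj_on_squeeze)
        also have "\<dots> \<le> norm (A p)" by (rule norm_proj_on_le)
        finally show ?thesis .
      qed
      ultimately show ?thesis using \<delta>(1) \<mu>(1) by (auto intro!: mult_mono)
    qed
    define G where "G = (\<lambda>p. sgn (squeeze M (fst p * s) (snd p)))"
    have GU: "G (t, p) \<in> ?U" if "p \<in> ?U" for t p
    proof -
      have "squeeze M (t * s) p \<in> V" using that by (intro AV) simp
      from open_cone_sgn_sphere[OF V this] show ?thesis by (simp add: G_def)
    qed
    have sG: "smooth_map_on ({0..1} \<times> ?U) G"
    proof (rule smooth_map_onI)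
      show o: "open (UNIV \<times> V)" by (intro open_Times oV open_UNIV)
      have "smooth_on (UNIV \<times> V) (\<lambda>p. squeeze M (fst (fst p * s, snd p)) (snd (fst p * s, snd p)))"
        by (rule smooth_on_compose[OF o open_UNIV smooth_on_squeeze]) (intro smooth_intros o subset_UNIV)+
      then have "smooth_on (UNIV \<times> V) (\<lambda>p. squeeze M (fst p * s) (snd p))" by simp
      then show "smooth_on (UNIV \<times> V) G"
        unfolding G_def by (rule smooth_on_sgn[OF o]) (use Anz in auto)
    qed auto
    have ceG: "contact_embedding ?U (\<lambda>p. G (t, p))" for t
    proof -
      have "contactomorphism ?U (\<lambda>p. sgn (squeeze M (t * s) p))"
        by (rule symplectic_lift_contactomorphism[OF V lA, of "squeeze M (- (t * s))"])
          (use lA[of "- (t * s)"] in \<open>simp_all add: symplectic_lift_def\<close>)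
      then show ?thesis by (simp add: contactomorphism_def G_def)
    qed
    \<comment> \<open>Both isotopies run simultaneously, the squeezing parameter being
      \<open>t * s\<close>. The result is one path of contact embeddings of U from the identity to
      \<open>\<sigma>\<close> after the full squeeze.\<close>
    define FG where "FG = (\<lambda>p. F (fst p, G p))"
    have sFG: "smooth_map_on ({0..1} \<times> ?U) FG"
      unfolding FG_def by (rule isotopy_compose[OF F(1) sG GU])
    have ceFG: "contact_embedding ?U (\<lambda>p. FG (t, p))" if t: "t \<in> {0..1}" for t
      unfolding FG_def fst_conv
      by (rule contact_embedding_compose[OF V bspec[OF F(2) t] ceG])
    have FG0: "FG (0, p) = p" if "p \<in> ?U" for p
      using bspec[OF F(3) that] sgnC[OF that] by (simp add: FG_def G_def)
    obtain g where g: "g \<in> Diff_c ?U" "\<And>p. p \<in> C (\<delta> / 2) \<Longrightarrow> g p = FG (1, p)"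
      by (rule contact_isotopy_extension[OF V sFG ceFG FG0 cC CU[OF \<delta>2]]) blast+
    have gfA: "g p = sgn (fA p)" if p: "p \<in> C (\<delta> / 2)" for p
    proof -
      have "p \<in> V" using p C2V by blast
      then show ?thesis using g(2)[OF p] f1F[OF AV, of p s] by (simp add: FG_def G_def fA_def A_def)
    qed
    have gC: "inj_on g ?U" "g ` ?U = ?U"
    proof -
      obtain H where H: "\<forall>t\<in>{0..1::real}. contactomorphism ?U (\<lambda>p. H (t, p))" "\<forall>p\<in>?U. H (1, p) = g p"
        using g(1) unfolding Diff_c_def by blast
      have "contactomorphism ?U (\<lambda>p. H (1, p))" using H(1) by simp
      then have "inj_on (\<lambda>p. H (1, p)) ?U" "(\<lambda>p. H (1, p)) ` ?U = ?U"
        unfolding contactomorphism_def using contact_embeddingD(2) by blast+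
      then show "inj_on g ?U" "g ` ?U = ?U"
        using H(2) inj_on_cong[of ?U "\<lambda>p. H (1, p)" g] image_cong[of ?U ?U "\<lambda>p. H (1, p)" g] by simp_all
    qed
    \<comment> \<open>The conformal factor depends on the values of \<open>g\<close> near
      \<open>p\<close>. The strict inequality in \<open>S\<close> makes it open, and on
      \<open>S\<close> the directions lie in \<open>C (\<delta> / 2)\<close>, where \<open>g\<close>
      is the explicit map.\<close>
    have cf: "conformal_factor g p = 1 / (norm (fA p))\<^sup>2" if p: "p \<in> C \<delta>" for p
    proof (rule conformal_factor_eq)
      have pU: "p \<in> ?U" using p CU[OF \<delta>(1)] by blast
      then show "norm p = 1" by simp
      have pV: "p \<in> V" using pU by blast
      have p2: "p \<in> C (\<delta> / 2)" using p CC by blast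
      define S where "S = V \<inter> sgn -` {z. \<delta> / 2 < norm (proj_on M z)}"
      have oS: "open S"
        unfolding S_def
      proof (rule continuous_open_preimage[OF _ oV])
        show "continuous_on V sgn" using open_coneD(2)[OF V] by (intro continuous_on_sgn continuous_on_id) auto
        show "open {z. \<delta> / 2 < norm (proj_on M z)}"
          by (intro open_Collect_less continuous_on_norm continuous_on_proj_on continuous_on_const)
      qed
      have pS: "p \<in> S" using pV sgnC[OF pU] p \<delta>(1) by (simp add: S_def C_def)
      have "((\<lambda>z. g (sgn z)) has_derivative sphere_differential (\<lambda>p. sgn (fA p)) p) (at p)"
      proof (rule has_derivative_transform_within_open[OF _ oS pS])
        show "((\<lambda>z. sgn (fA (sgn z))) has_derivative sphere_differential (\<lambda>p. sgn (fA p)) p) (at p)"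
          by (rule sphere_differential_has_derivative[OF V symplectic_lift_sphere(1)[OF V lfA] pV])
        fix z assume z: "z \<in> S"
        then have "sgn z \<in> sphere 0 1 \<inter> V" by (intro open_cone_sgn_sphere[OF V]) (simp add: S_def)
        then have "sgn z \<in> C (\<delta> / 2)" using z by (simp add: S_def C_def)
        then show "sgn (fA (sgn z)) = g (sgn z)" using gfA by simp
      qed
      then have "sphere_differential g p v = sphere_differential (\<lambda>p. sgn (fA p)) p v" for v
        unfolding sphere_differential_def[of g] by (simp add: frechet_derivative_at[symmetric])
      then show "alpha_st (g p) (sphere_differential g p v) = 1 / (norm (fA p))\<^sup>2 * alpha_st p v" for v
        using symplectic_lift_sphere(3)[OF V lfA pU, of v] gfA[OF p2] by simp
    qed
    have "Ad ?U g K\<^sub>1 y \<le> K\<^sub>2 y" if y: "y \<in> ?U" for y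
    proof -
      define q where "q = inv_into ?U g y"
      have yg: "y \<in> g ` ?U" unfolding gC(2) by (rule y)
      have q: "q \<in> ?U" "g q = y" unfolding q_def by (rule inv_into_into[OF yg], rule f_inv_into_f[OF yg])
      have Ad: "Ad ?U g K\<^sub>1 y = conformal_factor g q * K\<^sub>1 q" by (simp add: Ad_def q_def)
      show ?thesis
      proof (cases "q \<in> C1")
        case False
        then show ?thesis using Ad C1(3) q(1) K2nn[OF y] by simp
      next
        case True
        then have qC: "q \<in> C \<delta>" using C1C by blast
        have K1B: "K\<^sub>1 q \<le> B" using bspec[OF B(2) imageI[OF qC]] by simp
        let ?m = "exp s * \<delta> * \<mu>"
        have m: "?m > 0" using \<delta>(1) \<mu>(1) by simp
        have "1 / (norm (fA q))\<^sup>2 \<le> 1 / ?m\<^sup>2"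
          using fA_ge[OF qC] m by (intro divide_left_mono power_mono mult_pos_pos) (auto intro: less_le_trans zero_less_power)
        moreover have "0 \<le> 1 / (norm (fA q))\<^sup>2" by simp
        ultimately have "1 / (norm (fA q))\<^sup>2 * K\<^sub>1 q \<le> 1 / ?m\<^sup>2 * B"
          using K1B B(1) by (meson less_imp_le mult_left_mono mult_right_mono order_trans)
        also have "\<dots> \<le> \<epsilon>"
        proof -
          have "s \<le> exp s" using exp_ge_add_one_self[of s] by linarith
          also have "\<dots> \<le> (exp s)\<^sup>2" using s0 by (simp add: power2_eq_square)
          finally have "s \<le> (exp s)\<^sup>2" .
          then have "B \<le> (exp s)\<^sup>2 * (\<epsilon> * (\<delta> * \<mu>)\<^sup>2)"
            using \<epsilon>(1) \<delta>(1) \<mu>(1) by (simp add: s_def pos_divide_le_eq)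
          then have "B \<le> \<epsilon> * ?m\<^sup>2" by (simp add: power_mult_distrib ac_simps)
          moreover have "?m\<^sup>2 > 0" using m by (rule zero_less_power)
          ultimately show ?thesis by (simp add: pos_divide_le_eq)
        qed
        \<comment> \<open>By the invariance under squeezing, \<open>y\<close> is the image under
          \<open>\<sigma>\<close> of a point of \<open>C (\<delta> / 2)\<close>, and on such images
          \<open>\<epsilon>\<close> bounds \<open>K\<^sub>2\<close> from below independently of
          \<open>s\<close>.\<close>
        also have "\<epsilon> \<le> K\<^sub>2 y"
        proof -
          have "y = sgn (fA q)" using q(2) gfA qC CC by blast
          also have "\<dots> = sgn (f1 (sgn (A q)))"
          proof -
            have "q \<in> V" using q(1) by blast
            from symplectic_lift_sphere(5)[OF V lf AV[OF this]] show ?thesis by (simp add: fA_def A_def)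
          qed
          finally have "y = sgn (f1 (sgn (A q)))" .
          moreover have "sgn (A q) \<in> C (\<delta> / 2)" using AC[OF qC \<delta>(1)] CC by blast
          ultimately show ?thesis using \<epsilon>(2) by simp
        qed
        finally show ?thesis unfolding Ad cf[OF qC] .
      qed
    qed
    then show ?thesis using g(1) by blast
  qed
  then show ?thesis unfolding non_orderable_up_to_conjugation_def U_eq by blast
qed

end
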